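(* Let $X$ be an $F$-finite integral scheme of characteristic $p>0$. Write $A_X(\cdot)=A(\cdot\,;\mathcal{C}^X)$. (1) If $X$ is $F$-pure, then $X$ is log canonical, i.e. $A_X(\mathrm{ord}_E)\ge0$ for all divisors $E$ over $X$. (2) If $X$ is $F$-regular, then $X$ is klt, i.e. $A_X(\mathrm{ord}_E)>0$ for all divisors $E$ over $X$. (3) Conversely, if $A_X(\xi)\ge0$ (respectively $A_X(\xi)>0$) for all $\xi\in X^\beth$ other than the trivial valuation on $X$ (the trivial valuation of the function field of $X$), then $X$ is $F$-pure (respectively $F$-regular).
   Context: Schemes are separated and noetherian. $X$ is $F$-finite if its Frobenius morphism is finite. Let $L$ be the function field of $X$. A divisor $E$ over $X$ is a prime divisor on a normal integral scheme $Y$ with a proper birational morphism $Y\to X$; $\mathrm{ord}_E$ is the associated valuation on $L$. **Semivaluations.** $X^\beth$ is the set of pairs $\zeta=(w,x)$ with $x\in X$ and $w$ a real-valued valuation (values in $\mathbb{R}\cup\{+\infty\}$, possibly trivial) on the residue field $\kappa(x)$, which is centered on $X$, i.e. non-negative on a local ring $\mathcal{O}_{Z,z}$ of $Z=\overline{\{x\}}$ (reduced structure). For $f\in\mathcal{O}_{X,x}$, $\zeta(f)=w(f(x))$ where $f(x)\in\kappa(x)$ is the residue. The home of $\zeta$ is $h_X(\zeta)=x$; the center $c_X(\zeta)$ is the point $z\in Z$ such that the valuation ring of $w$ dominates $\mathcal{O}_{Z,z}$. $\mathrm{Val}_X$ denotes the semivaluations whose home is the generic point, i.e. valuations on $L$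 centered on $X$. **Cartier algebras.** A $p^{-e}$-linear map on $L$ is an additive $\psi:L\to L$ with $\psi(f^{p^e}g)=f\psi(g)$; it is a $p^{-e}$-linear map on $X$ if $\psi(\mathcal{O}_X)\subseteq\mathcal{O}_X$. $\mathcal{C}^X=\bigoplus_{e\ge0}\mathcal{C}^X_e$ is the sheaf of graded rings of $p^{-e}$-linear maps on open subsets of $X$, with composition as product, $\mathcal{C}^X_0=\mathcal{O}_X$. A Cartier subalgebra is a quasi-coherent sheaf of graded subrings $\mathcal{D}=\bigoplus\mathcal{D}_e\subseteq\mathcal{C}^X$ with $\mathcal{D}_0=\mathcal{O}_X$. $X$ is $F$-pure if for every $x\in X$ there are $e\ge1$ and $\psi\in(\mathcal{C}^X_e)_x$ surjective as a function $\mathcal{O}_{X,x}\to\mathcal{O}_{X,x}$. $X$ is $F$-regular if for every $x\in X$ and every nonzero $f\in\mathcal{O}_{X,x}$ there are $e\ge1$ and $\psi\in(\mathcal{C}^X_e)_x$ with $\psi(f)=1$. **Log discrepancies.** For a nonzero $p^{-e}$-linear $\psi:L\to L$ ($e\ge1$), $0\ne f\in L$, $v\in\mathrm{Val}_X$: $E(f,\psi,v)=\frac{v(f)-p^ev(\psi(f))}{p^e-1}$, $A(v;\psi)=\sup_{f\neq0,n\ge1}E(f,\psi^n,v)$, and $A(v;\mathcal{D})=\sup_{e\ge1}\sup_{0\ne\psi\in(\mathcal{D}_e)_x}A(v;\psi)$ with $x=c_X(v)$ (and $\sup\varnothing=-\infty$). A closed integral subscheme $Z\subseteq X$ with ideal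 $\mathcal{I}_Z$ is uniformly $\mathcal{D}$-compatible if $\psi(\mathcal{I}_{Z,x})\subseteq\mathcal{I}_{Z,x}$ for all $x\in X$, $e\ge1$, $\psi\in(\mathcal{D}_e)_x$; then each $\psi$ induces a $p^{-e}$-linear map $\psi\|_Z$ on $Z$, and these form a Cartier subalgebra $\mathcal{D}\|_Z$ on $Z$. For $\zeta\in X^\beth$ with home $x$ and $Z=\overline{\{x\}}$, $A(\zeta;\mathcal{D}):=A(\zeta;\mathcal{D}\|_Z)$ (viewing $\zeta\in\mathrm{Val}_Z$) if $Z$ is uniformly $\mathcal{D}$-compatible, and $A(\zeta;\mathcal{D}):=+\infty$ otherwise. *)

theory Defs
  imports
    "HOL-Analysis.Abstract_Topology"
    "HOL-Library.Extended_Real"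
    "HOL-Computational_Algebra.Primes"
    "HOL-Algebra.QuotRing"
    "HOL-Algebra.Generated_Rings"
    "HOL-Algebra.Ring_Divisibility"
begin

section \<open>Ringed spaces and stalks\<close>

record ('x, 'a) rspace =
  topo :: "'x topology"
  sec :: "'x set \<Rightarrow> 'a ring"
  res :: "'x set \<Rightarrow> 'x set \<Rightarrow> 'a \<Rightarrow> 'a"

type_synonym ('x, 'a) germ = "('x set \<times> 'a) set"

locale ringed_space =
  fixes X :: "('x, 'a) rspace"
  assumes sec_cring: "openin (topo X) U \<Longrightarrow> cring (sec X U)"
    and res_hom: "openin (topo X) U \<Longrightarrow> openin (topo X) V \<Longrightarrow> V \<subseteq> U
        \<Longrightarrow> res X U V \<in> ring_hom (sec X U) (sec X V)"
    and res_id: "openin (topo X) U \<Longrightarrow> s \<in> carrier (sec X U) \<Longrightarrow> res X U U s = s"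
    and res_res: "openin (topo X) U \<Longrightarrow> openin (topo X) V \<Longrightarrow> openin (topo X) W
        \<Longrightarrow> W \<subseteq> V \<Longrightarrow> V \<subseteq> U \<Longrightarrow> s \<in> carrier (sec X U)
        \<Longrightarrow> res X V W (res X U V s) = res X U W s"
    and locality: "(\<And>U. U \<in> \<U> \<Longrightarrow> openin (topo X) U)
        \<Longrightarrow> s \<in> carrier (sec X (\<Union>\<U>)) \<Longrightarrow> t \<in> carrier (sec X (\<Union>\<U>))
        \<Longrightarrow> (\<And>U. U \<in> \<U> \<Longrightarrow> res X (\<Union>\<U>) U s = res X (\<Union>\<U>) U t) \<Longrightarrow> s = t"
    and gluing: "(\<And>U. U \<in> \<U> \<Longrightarrow> openin (topo X) U)
        \<Longrightarrow> (\<And>U. U \<in> \<U> \<Longrightarrow> \<sigma> U \<in> carrier (sec X U))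
        \<Longrightarrow> (\<And>U V. U \<in> \<U> \<Longrightarrow> V \<in> \<U> \<Longrightarrow> res X U (U \<inter> V) (\<sigma> U) = res X V (U \<inter> V) (\<sigma> V))
        \<Longrightarrow> \<exists>s \<in> carrier (sec X (\<Union>\<U>)). \<forall>U\<in>\<U>. res X (\<Union>\<U>) U s = \<sigma> U"

definition germ_of :: "('x, 'a) rspace \<Rightarrow> 'x \<Rightarrow> 'x set \<Rightarrow> 'a \<Rightarrow> ('x, 'a) germ" where
  "germ_of X x U s = {(V, t). openin (topo X) V \<and> x \<in> V \<and> t \<in> carrier (sec X V) \<and>
     (\<exists>W. openin (topo X) W \<and> x \<in> W \<and> W \<subseteq> U \<inter> V \<and> res X U W s = res X V W t)}"

text \<open>A germ is the set of all its representatives \<open>(U, s)\<close>; the ring operations are computed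
  on representatives, \<open>the_elem\<close> expressing that the result does not depend on their choice.\<close>

definition stalk :: "('x, 'a) rspace \<Rightarrow> 'x \<Rightarrow> ('x, 'a) germ ring" where
  "stalk X x =
    \<lparr>carrier = {germ_of X x U s | U s. openin (topo X) U \<and> x \<in> U \<and> s \<in> carrier (sec X U)},
     monoid.mult = (\<lambda>a b. the_elem {germ_of X x (U \<inter> V)
               (res X U (U \<inter> V) s \<otimes>\<^bsub>sec X (U \<inter> V)\<^esub> res X V (U \<inter> V) t)
             | U s V t. (U, s) \<in> a \<and> (V, t) \<in> b}),
     one = germ_of X x (topspace (topo X)) \<one>\<^bsub>sec X (topspace (topo X))\<^esub>,
     zero = germ_of X x (topspace (topo X)) \<zero>\<^bsub>sec X (topspace (topo X))\<^esub>,
     add = (\<lambda>a b. the_elem {germ_of X x (U \<inter> V)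
               (res X U (U \<inter> V) s \<oplus>\<^bsub>sec X (U \<inter> V)\<^esub> res X V (U \<inter> V) t)
             | U s V t. (U, s) \<in> a \<and> (V, t) \<in> b})\<rparr>"

definition local_ring :: "('r, 'm) ring_scheme \<Rightarrow> bool" where
  "local_ring R \<longleftrightarrow> cring R \<and> (\<exists>!m. maximalideal m R)"

text \<open>Only applied to local rings, whose maximal ideal is the set of non-units.\<close>

definition max_ideal :: "('r, 'm) ring_scheme \<Rightarrow> 'r set" where
  "max_ideal R = carrier R - Units R"

locale locally_ringed_space = ringed_space X for X :: "('x, 'a) rspace" +
  assumes stalk_local: "x \<in> topspace (topo X) \<Longrightarrow> local_ring (stalk X x)"

section \<open>Schemes\<close>

definition point_ideal :: "('x, 'a) rspace \<Rightarrow> 'x set \<Rightarrow> 'x \<Rightarrow> 'a set" where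
  "point_ideal X U x = {s \<in> carrier (sec X U). germ_of X x U s \<in> max_ideal (stalk X x)}"

definition basic_open :: "('x, 'a) rspace \<Rightarrow> 'x set \<Rightarrow> 'a \<Rightarrow> 'x set" where
  "basic_open X U s = {x \<in> U. s \<notin> point_ideal X U x}"

text \<open>\<open>\<phi> : A \<rightarrow> B\<close> is the localization of \<open>A\<close> at the powers of \<open>s\<close>.\<close>

definition is_localization_away ::
  "('r, 'm) ring_scheme \<Rightarrow> 'r \<Rightarrow> ('q, 'n) ring_scheme \<Rightarrow> ('r \<Rightarrow> 'q) \<Rightarrow> bool" where
  "is_localization_away A s B \<phi> \<longleftrightarrow>
     \<phi> s \<in> Units B \<and>
     (\<forall>b\<in>carrier B. \<exists>a\<in>carrier A. \<exists>n::nat. b \<otimes>\<^bsub>B\<^esub> \<phi> s [^]\<^bsub>B\<^esub> n = \<phi> a) \<and>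
     (\<forall>a\<in>carrier A. \<phi> a = \<zero>\<^bsub>B\<^esub> \<longrightarrow> (\<exists>n::nat. a \<otimes>\<^bsub>A\<^esub> s [^]\<^bsub>A\<^esub> n = \<zero>\<^bsub>A\<^esub>))"

text \<open>The canonical map from \<open>U\<close> to the spectrum of \<open>A = \<O>(U)\<close> is an isomorphism of locally
  ringed spaces: it is bijective onto the primes of \<open>A\<close>, it identifies the opens of \<open>U\<close> with the
  Zariski opens \<open>{P. \<not> I \<subseteq> P}\<close>, and it identifies \<open>\<O>\<close> with the structure sheaf, which is
  determined by its sections \<open>A\<^sub>s\<close> over the basic opens.\<close>

definition affine_open :: "('x, 'a) rspace \<Rightarrow> 'x set \<Rightarrow> bool" where
  "affine_open X U \<longleftrightarrow>
     openin (topo X) U \<and>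
     bij_betw (point_ideal X U) U {P. primeideal P (sec X U)} \<and>
     (\<forall>V\<subseteq>U. openin (topo X) V \<longleftrightarrow>
        (\<exists>I\<subseteq>carrier (sec X U). V = {x \<in> U. \<not> I \<subseteq> point_ideal X U x})) \<and>
     (\<forall>s\<in>carrier (sec X U).
        is_localization_away (sec X U) s (sec X (basic_open X U s)) (res X U (basic_open X U s)))"

locale scheme = locally_ringed_space X for X :: "('x, 'a) rspace" +
  assumes affine_cover: "x \<in> topspace (topo X) \<Longrightarrow> \<exists>U. affine_open X U \<and> x \<in> U"

definition noetherian_scheme :: "('x, 'a) rspace \<Rightarrow> bool" where
  "noetherian_scheme X \<longleftrightarrow> (\<exists>\<U>. finite \<U> \<and> \<Union>\<U> = topspace (topo X) \<and>
     (\<forall>U\<in>\<U>. affine_open X U \<and> noetherian_ring (sec X U)))"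

text \<open>The diagonal, restricted to the affine open \<open>U \<times> V\<close> of the product, is the closed immersion
  of an affine scheme: \<open>U \<inter> V\<close> is affine and \<open>\<O>(U) \<otimes> \<O>(V) \<rightarrow> \<O>(U \<inter> V)\<close> is surjective.\<close>

definition diagonal_closed_on :: "('x, 'a) rspace \<Rightarrow> 'x set \<Rightarrow> 'x set \<Rightarrow> bool" where
  "diagonal_closed_on X U V \<longleftrightarrow>
     affine_open X (U \<inter> V) \<and>
     (\<forall>c\<in>carrier (sec X (U \<inter> V)). \<exists>n::nat. \<exists>a b.
        (\<forall>i<n. a i \<in> carrier (sec X U) \<and> b i \<in> carrier (sec X V)) \<and>
        c = (\<Oplus>\<^bsub>sec X (U \<inter> V)\<^esub> i\<in>{..<n}.
              res X U (U \<inter> V) (a i) \<otimes>\<^bsub>sec X (U \<inter> V)\<^esub> res X V (U \<inter> V) (b i)))"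

definition separated_scheme :: "('x, 'a) rspace \<Rightarrow> bool" where
  "separated_scheme X \<longleftrightarrow>
     (\<forall>U V. affine_open X U \<and> affine_open X V \<longrightarrow> diagonal_closed_on X U V)"

definition integral_scheme :: "('x, 'a) rspace \<Rightarrow> bool" where
  "integral_scheme X \<longleftrightarrow> topspace (topo X) \<noteq> {} \<and>
     (\<forall>U. openin (topo X) U \<and> U \<noteq> {} \<longrightarrow> domain (sec X U))"

definition has_char :: "('x, 'a) rspace \<Rightarrow> nat \<Rightarrow> bool" where
  "has_char X p \<longleftrightarrow> Factorial_Ring.prime p \<and>
     [p] \<cdot>\<^bsub>sec X (topspace (topo X))\<^esub> \<one>\<^bsub>sec X (topspace (topo X))\<^esub>
       = \<zero>\<^bsub>sec X (topspace (topo X))\<^esub>"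

definition irreducible_closed :: "'x topology \<Rightarrow> 'x set \<Rightarrow> bool" where
  "irreducible_closed T E \<longleftrightarrow> closedin T E \<and> E \<noteq> {} \<and>
     (\<forall>A B. closedin T A \<and> closedin T B \<and> E \<subseteq> A \<union> B \<longrightarrow> E \<subseteq> A \<or> E \<subseteq> B)"

definition generic_of :: "('x, 'a) rspace \<Rightarrow> 'x set \<Rightarrow> 'x" where
  "generic_of X E = (THE x. x \<in> E \<and> topo X closure_of {x} = E)"

definition generic_point :: "('x, 'a) rspace \<Rightarrow> 'x" where
  "generic_point X = generic_of X (topspace (topo X))"

section \<open>Function field and local rings\<close>

definition funfield :: "('x, 'a) rspace \<Rightarrow> ('x, 'a) germ ring" where
  "funfield X = stalk X (generic_point X)"

text \<open>For an integral scheme and non-empty \<open>U\<close>, the rings \<open>\<O>(U)\<close> and the stalks embed into the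
  function field; the next two definitions are their images.\<close>

definition sec_in :: "('x, 'a) rspace \<Rightarrow> 'x set \<Rightarrow> ('x, 'a) germ set" where
  "sec_in X U = germ_of X (generic_point X) U ` carrier (sec X U)"

definition local_at :: "('x, 'a) rspace \<Rightarrow> 'x \<Rightarrow> ('x, 'a) germ set" where
  "local_at X x = \<Union>{sec_in X U | U. openin (topo X) U \<and> x \<in> U}"

definition local_ring_at :: "('x, 'a) rspace \<Rightarrow> 'x \<Rightarrow> ('x, 'a) germ ring" where
  "local_ring_at X x = (funfield X)\<lparr>carrier := local_at X x\<rparr>"

definition residue_field :: "('x, 'a) rspace \<Rightarrow> 'x \<Rightarrow> ('x, 'a) germ set ring" where
  "residue_field X x = local_ring_at X x Quot max_ideal (local_ring_at X x)"

definition residue :: "('x, 'a) rspace \<Rightarrow> 'x \<Rightarrow> ('x, 'a) germ \<Rightarrow> ('x, 'a) germ set" where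
  "residue X x f = max_ideal (local_ring_at X x) +>\<^bsub>local_ring_at X x\<^esub> f"

definition integral_over :: "('k, 'm) ring_scheme \<Rightarrow> 'k set \<Rightarrow> 'k \<Rightarrow> bool" where
  "integral_over K R g \<longleftrightarrow> (\<exists>n::nat. \<exists>c. (\<forall>i<n. c i \<in> R) \<and>
     g [^]\<^bsub>K\<^esub> n \<oplus>\<^bsub>K\<^esub> (\<Oplus>\<^bsub>K\<^esub> i\<in>{..<n}. c i \<otimes>\<^bsub>K\<^esub> g [^]\<^bsub>K\<^esub> i) = \<zero>\<^bsub>K\<^esub>)"

definition normal_scheme :: "('x, 'a) rspace \<Rightarrow> bool" where
  "normal_scheme X \<longleftrightarrow> (\<forall>x\<in>topspace (topo X). \<forall>g\<in>carrier (funfield X).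
     integral_over (funfield X) (local_at X x) g \<longrightarrow> g \<in> local_at X x)"

section \<open>Morphisms\<close>

record ('y, 'b, 'x, 'a) rmor =
  pt :: "'y \<Rightarrow> 'x"
  comor :: "'x set \<Rightarrow> 'a \<Rightarrow> 'b"

definition preim :: "('y, 'b) rspace \<Rightarrow> ('y, 'b, 'x, 'a) rmor \<Rightarrow> 'x set \<Rightarrow> 'y set" where
  "preim Y f V = {y \<in> topspace (topo Y). pt f y \<in> V}"

definition stalk_map ::
  "('y, 'b) rspace \<Rightarrow> ('y, 'b, 'x, 'a) rmor \<Rightarrow> 'y \<Rightarrow> ('x, 'a) germ \<Rightarrow> ('y, 'b) germ" where
  "stalk_map Y f y a = the_elem ((\<lambda>(V, s). germ_of Y y (preim Y f V) (comor f V s)) ` a)"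

definition scheme_morphism ::
  "('y, 'b) rspace \<Rightarrow> ('x, 'a) rspace \<Rightarrow> ('y, 'b, 'x, 'a) rmor \<Rightarrow> bool" where
  "scheme_morphism Y X f \<longleftrightarrow>
     continuous_map (topo Y) (topo X) (pt f) \<and>
     (\<forall>V. openin (topo X) V \<longrightarrow> comor f V \<in> ring_hom (sec X V) (sec Y (preim Y f V))) \<and>
     (\<forall>V W. openin (topo X) V \<and> openin (topo X) W \<and> W \<subseteq> V \<longrightarrow>
        (\<forall>s\<in>carrier (sec X V).
           comor f W (res X V W s) = res Y (preim Y f V) (preim Y f W) (comor f V s))) \<and>
     (\<forall>y\<in>topspace (topo Y). \<forall>a\<in>max_ideal (stalk X (pt f y)).
        stalk_map Y f y a \<in> max_ideal (stalk Y y))"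

definition mor_comp ::
  "('y, 'b) rspace \<Rightarrow> ('y, 'b, 'x, 'a) rmor \<Rightarrow> ('z, 'c, 'y, 'b) rmor \<Rightarrow> ('z, 'c, 'x, 'a) rmor" where
  "mor_comp Y f g =
     \<lparr>pt = pt f \<circ> pt g, comor = (\<lambda>V. comor g (preim Y f V) \<circ> comor f V)\<rparr>"

definition mor_eq ::
  "('y, 'b) rspace \<Rightarrow> ('x, 'a) rspace \<Rightarrow> ('y, 'b, 'x, 'a) rmor \<Rightarrow> ('y, 'b, 'x, 'a) rmor \<Rightarrow> bool" where
  "mor_eq Y X f g \<longleftrightarrow> (\<forall>y\<in>topspace (topo Y). pt f y = pt g y) \<and>
     (\<forall>V. openin (topo X) V \<longrightarrow> (\<forall>s\<in>carrier (sec X V). comor f V s = comor g V s))"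

text \<open>\<open>P\<close> with \<open>q1 : P \<rightarrow> Y\<close> and \<open>q2 : P \<rightarrow> T\<close> is the fibre product of \<open>f : Y \<rightarrow> X\<close> and
  \<open>g : T \<rightarrow> X\<close>. The universal property is tested on schemes over the carrier types of \<open>P\<close>.\<close>

definition is_fibre_product ::
  "('y, 'b) rspace \<Rightarrow> ('x, 'a) rspace \<Rightarrow> ('y, 'b, 'x, 'a) rmor \<Rightarrow>
   ('t, 's) rspace \<Rightarrow> ('t, 's, 'x, 'a) rmor \<Rightarrow>
   ('u, 'w) rspace \<Rightarrow> ('u, 'w, 'y, 'b) rmor \<Rightarrow> ('u, 'w, 't, 's) rmor \<Rightarrow> bool" where
  "is_fibre_product Y X f T g P q1 q2 \<longleftrightarrow>
     scheme P \<and> scheme_morphism P Y q1 \<and> scheme_morphism P T q2 \<and>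
     mor_eq P X (mor_comp Y f q1) (mor_comp T g q2) \<and>
     (\<forall>(Q :: ('u, 'w) rspace) r1 r2.
        scheme Q \<and> scheme_morphism Q Y r1 \<and> scheme_morphism Q T r2 \<and>
        mor_eq Q X (mor_comp Y f r1) (mor_comp T g r2) \<longrightarrow>
        (\<exists>h. scheme_morphism Q P h \<and>
             mor_eq Q Y (mor_comp P q1 h) r1 \<and> mor_eq Q T (mor_comp P q2 h) r2 \<and>
             (\<forall>h'. scheme_morphism Q P h' \<and>
                mor_eq Q Y (mor_comp P q1 h') r1 \<and> mor_eq Q T (mor_comp P q2 h') r2 \<longrightarrow>
                mor_eq Q P h' h)))"

text \<open>HOL cannot quantify over types inside a definition, so the carrier types \<open>'t, 's\<close> of the base
  changes and \<open>'u, 'w\<close> of the fibre products are parameters. The usual notion is obtained when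
  \<open>'t, 's\<close> are large enough to carry the affine spaces over \<open>X\<close> (which suffice to test universal
  closedness) and \<open>'u, 'w\<close> are large enough to carry the fibre products of \<open>Y\<close> with all \<open>T\<close>.\<close>

definition universally_closed ::
  "('t, 's) rspace itself \<Rightarrow> ('u, 'w) rspace itself \<Rightarrow>
   ('y, 'b) rspace \<Rightarrow> ('x, 'a) rspace \<Rightarrow> ('y, 'b, 'x, 'a) rmor \<Rightarrow> bool" where
  "universally_closed _ _ Y X f \<longleftrightarrow>
     (\<forall>(T :: ('t, 's) rspace) g (P :: ('u, 'w) rspace) q1 q2.
        scheme T \<and> scheme_morphism T X g \<and> is_fibre_product Y X f T g P q1 q2 \<longrightarrow>
        closed_map (topo P) (topo T) (pt q2))"

definition separated_morphism ::
  "('y, 'b) rspace \<Rightarrow> ('x, 'a) rspace \<Rightarrow> ('y, 'b, 'x, 'a) rmor \<Rightarrow> bool" where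
  "separated_morphism Y X f \<longleftrightarrow>
     (\<forall>V U1 U2. affine_open X V \<and> affine_open Y U1 \<and> affine_open Y U2 \<and>
        U1 \<subseteq> preim Y f V \<and> U2 \<subseteq> preim Y f V \<longrightarrow> diagonal_closed_on Y U1 U2)"

definition finite_type ::
  "('y, 'b) rspace \<Rightarrow> ('x, 'a) rspace \<Rightarrow> ('y, 'b, 'x, 'a) rmor \<Rightarrow> bool" where
  "finite_type Y X f \<longleftrightarrow>
     (\<forall>x\<in>topspace (topo X). \<exists>V \<U>. affine_open X V \<and> x \<in> V \<and>
        finite \<U> \<and> \<Union>\<U> = preim Y f V \<and>
        (\<forall>U\<in>\<U>. affine_open Y U \<and>
           (\<exists>B\<subseteq>carrier (sec Y U). finite B \<and>
              carrier (sec Y U) = generate_ring (sec Y U)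
                ((\<lambda>s. res Y (preim Y f V) U (comor f V s)) ` carrier (sec X V) \<union> B))))"

definition proper_morphism ::
  "('t, 's) rspace itself \<Rightarrow> ('u, 'w) rspace itself \<Rightarrow>
   ('y, 'b) rspace \<Rightarrow> ('x, 'a) rspace \<Rightarrow> ('y, 'b, 'x, 'a) rmor \<Rightarrow> bool" where
  "proper_morphism TT UU Y X f \<longleftrightarrow> scheme_morphism Y X f \<and>
     separated_morphism Y X f \<and> finite_type Y X f \<and> universally_closed TT UU Y X f"

definition birational_morphism ::
  "('y, 'b) rspace \<Rightarrow> ('x, 'a) rspace \<Rightarrow> ('y, 'b, 'x, 'a) rmor \<Rightarrow> bool" where
  "birational_morphism Y X f \<longleftrightarrow> scheme_morphism Y X f \<and>
     pt f (generic_point Y) = generic_point X \<and>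
     bij_betw (stalk_map Y f (generic_point Y)) (carrier (funfield X)) (carrier (funfield Y))"

definition finite_morphism ::
  "('y, 'b) rspace \<Rightarrow> ('x, 'a) rspace \<Rightarrow> ('y, 'b, 'x, 'a) rmor \<Rightarrow> bool" where
  "finite_morphism Y X f \<longleftrightarrow> scheme_morphism Y X f \<and>
     (\<forall>x\<in>topspace (topo X). \<exists>V. affine_open X V \<and> x \<in> V \<and> affine_open Y (preim Y f V) \<and>
        (\<exists>B\<subseteq>carrier (sec Y (preim Y f V)). finite B \<and>
           (\<forall>s\<in>carrier (sec Y (preim Y f V)). \<exists>c. (\<forall>b\<in>B. c b \<in> carrier (sec X V)) \<and>
              s = (\<Oplus>\<^bsub>sec Y (preim Y f V)\<^esub> b\<in>B.
                    comor f V (c b) \<otimes>\<^bsub>sec Y (preim Y f V)\<^esub> b))))"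

definition frobenius :: "('x, 'a) rspace \<Rightarrow> nat \<Rightarrow> ('x, 'a, 'x, 'a) rmor" where
  "frobenius X p = \<lparr>pt = id, comor = (\<lambda>U s. s [^]\<^bsub>sec X U\<^esub> p)\<rparr>"

definition F_finite :: "('x, 'a) rspace \<Rightarrow> nat \<Rightarrow> bool" where
  "F_finite X p \<longleftrightarrow> finite_morphism X X (frobenius X p)"

section \<open>Valuations and their centers\<close>

definition is_valuation :: "('k, 'm) ring_scheme \<Rightarrow> ('k \<Rightarrow> ereal) \<Rightarrow> bool" where
  "is_valuation K v \<longleftrightarrow>
     v \<zero>\<^bsub>K\<^esub> = \<infinity> \<and>
     (\<forall>a\<in>carrier K - {\<zero>\<^bsub>K\<^esub>}. \<bar>v a\<bar> \<noteq> \<infinity>) \<and>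
     (\<forall>a\<in>carrier K. \<forall>b\<in>carrier K. v (a \<otimes>\<^bsub>K\<^esub> b) = v a + v b) \<and>
     (\<forall>a\<in>carrier K. \<forall>b\<in>carrier K. min (v a) (v b) \<le> v (a \<oplus>\<^bsub>K\<^esub> b))"

text \<open>An integral scheme with points \<open>S\<close> enters the notions below only through its function field
  \<open>K\<close> and its local rings \<open>R z \<subseteq> K\<close> for \<open>z \<in> S\<close>. They are used both for \<open>X\<close> itself and for its
  closed integral subschemes.\<close>

definition centered :: "'x set \<Rightarrow> ('x \<Rightarrow> 'k set) \<Rightarrow> ('k \<Rightarrow> ereal) \<Rightarrow> bool" where
  "centered S R v \<longleftrightarrow> (\<exists>z\<in>S. \<forall>a\<in>R z. 0 \<le> v a)"

definition val_dominates :: "('k, 'm) ring_scheme \<Rightarrow> 'k set \<Rightarrow> ('k \<Rightarrow> ereal) \<Rightarrow> bool" where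
  "val_dominates K R v \<longleftrightarrow> (\<forall>a\<in>R. 0 \<le> v a) \<and> (\<forall>a\<in>max_ideal (K\<lparr>carrier := R\<rparr>). 0 < v a)"

definition center ::
  "('k, 'm) ring_scheme \<Rightarrow> 'x set \<Rightarrow> ('x \<Rightarrow> 'k set) \<Rightarrow> ('k \<Rightarrow> ereal) \<Rightarrow> 'x" where
  "center K S R v = (THE z. z \<in> S \<and> val_dominates K (R z) v)"

section \<open>Semivaluations\<close>

text \<open>The local ring at \<open>z\<close> of the reduced closed subscheme with generic point \<open>x\<close> is the quotient of
  \<open>\<O>\<^bsub>X,z\<^esub>\<close> by the prime of \<open>x\<close>, that is, the image of \<open>\<O>\<^bsub>X,z\<^esub>\<close> in the residue field of \<open>x\<close>.\<close>

definition closed_local_at ::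
  "('x, 'a) rspace \<Rightarrow> 'x \<Rightarrow> 'x \<Rightarrow> ('x, 'a) germ set set" where
  "closed_local_at X x z = residue X x ` local_at X z"

definition beth :: "('x, 'a) rspace \<Rightarrow> ((('x, 'a) germ set \<Rightarrow> ereal) \<times> 'x) set" where
  "beth X = {(w, x). x \<in> topspace (topo X) \<and> is_valuation (residue_field X x) w \<and>
     centered (topo X closure_of {x}) (closed_local_at X x) w}"

definition trivial_generic ::
  "('x, 'a) rspace \<Rightarrow> (('x, 'a) germ set \<Rightarrow> ereal) \<times> 'x \<Rightarrow> bool" where
  "trivial_generic X = (\<lambda>(w, x). x = generic_point X \<and>
     (\<forall>a\<in>carrier (residue_field X x) - {\<zero>\<^bsub>residue_field X x\<^esub>}. w a = 0))"

section \<open>Cartier algebras, F-purity and F-regularity\<close>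

definition p_linear :: "('k, 'm) ring_scheme \<Rightarrow> nat \<Rightarrow> nat \<Rightarrow> ('k \<Rightarrow> 'k) \<Rightarrow> bool" where
  "p_linear K p e \<psi> \<longleftrightarrow>
     (\<forall>f\<in>carrier K. \<psi> f \<in> carrier K) \<and>
     (\<forall>f\<in>carrier K. \<forall>g\<in>carrier K. \<psi> (f \<oplus>\<^bsub>K\<^esub> g) = \<psi> f \<oplus>\<^bsub>K\<^esub> \<psi> g) \<and>
     (\<forall>f\<in>carrier K. \<forall>g\<in>carrier K. \<psi> (f [^]\<^bsub>K\<^esub> (p ^ e) \<otimes>\<^bsub>K\<^esub> g) = f \<otimes>\<^bsub>K\<^esub> \<psi> g)"

text \<open>A family \<open>D U e\<close> of sets of \<open>p\<^sup>-\<^sup>e\<close>-linear maps on the function field, indexed by the open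
  sets \<open>U\<close> and the degrees \<open>e\<close>.\<close>

type_synonym ('x, 'a) map_family =
  "'x set \<Rightarrow> nat \<Rightarrow> (('x, 'a) germ \<Rightarrow> ('x, 'a) germ) set"

definition full_cartier :: "('x, 'a) rspace \<Rightarrow> nat \<Rightarrow> ('x, 'a) map_family" where
  "full_cartier X p U e = {\<psi>. p_linear (funfield X) p e \<psi> \<and>
     (\<forall>V. openin (topo X) V \<and> V \<noteq> {} \<and> V \<subseteq> U \<longrightarrow> \<psi> ` sec_in X V \<subseteq> sec_in X V)}"

definition map_stalk ::
  "('x, 'a) rspace \<Rightarrow> ('x, 'a) map_family \<Rightarrow> 'x \<Rightarrow> nat \<Rightarrow> (('x, 'a) germ \<Rightarrow> ('x, 'a) germ) set" where
  "map_stalk X D x e = \<Union>{D U e | U. openin (topo X) U \<and> x \<in> U}"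

definition F_pure :: "('x, 'a) rspace \<Rightarrow> nat \<Rightarrow> bool" where
  "F_pure X p \<longleftrightarrow> (\<forall>x\<in>topspace (topo X). \<exists>e\<ge>1. \<exists>\<psi>\<in>map_stalk X (full_cartier X p) x e.
     \<psi> ` local_at X x = local_at X x)"

definition F_regular :: "('x, 'a) rspace \<Rightarrow> nat \<Rightarrow> bool" where
  "F_regular X p \<longleftrightarrow>
     (\<forall>x\<in>topspace (topo X). \<forall>f\<in>local_at X x - {\<zero>\<^bsub>funfield X\<^esub>}.
        \<exists>e\<ge>1. \<exists>\<psi>\<in>map_stalk X (full_cartier X p) x e. \<psi> f = \<one>\<^bsub>funfield X\<^esub>)"

section \<open>Log discrepancies\<close>

definition E_quot :: "nat \<Rightarrow> nat \<Rightarrow> 'k \<Rightarrow> ('k \<Rightarrow> 'k) \<Rightarrow> ('k \<Rightarrow> ereal) \<Rightarrow> ereal" where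
  "E_quot p e f \<psi> v = (v f - ereal (real p ^ e) * v (\<psi> f)) / ereal (real p ^ e - 1)"

text \<open>Here \<open>\<psi>\<close> is \<open>p\<^sup>-\<^sup>e\<close>-linear, so its \<open>n\<close>-th iterate has degree \<open>n * e\<close>.\<close>

definition A_map ::
  "('k, 'm) ring_scheme \<Rightarrow> nat \<Rightarrow> nat \<Rightarrow> ('k \<Rightarrow> 'k) \<Rightarrow> ('k \<Rightarrow> ereal) \<Rightarrow> ereal" where
  "A_map K p e \<psi> v =
     (SUP n\<in>{1..}. SUP f\<in>carrier K - {\<zero>\<^bsub>K\<^esub>}. E_quot p (n * e) f (\<psi> ^^ n) v)"

text \<open>The points, the function field, the local rings and the stalks \<open>D z e\<close> of the algebra are
  passed separately. The supremum of the empty set in \<open>ereal\<close> is \<open>-\<infinity>\<close>.\<close>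

definition A_gen ::
  "('k, 'm) ring_scheme \<Rightarrow> 'x set \<Rightarrow> ('x \<Rightarrow> 'k set) \<Rightarrow> nat \<Rightarrow>
   ('x \<Rightarrow> nat \<Rightarrow> ('k \<Rightarrow> 'k) set) \<Rightarrow> ('k \<Rightarrow> ereal) \<Rightarrow> ereal" where
  "A_gen K S R p D v =
     (SUP e\<in>{1..}. SUP \<psi>\<in>{\<psi> \<in> D (center K S R v) e. \<exists>f\<in>carrier K. \<psi> f \<noteq> \<zero>\<^bsub>K\<^esub>}. A_map K p e \<psi> v)"

definition A_val ::
  "('x, 'a) rspace \<Rightarrow> nat \<Rightarrow> ('x, 'a) map_family \<Rightarrow> (('x, 'a) germ \<Rightarrow> ereal) \<Rightarrow> ereal" where
  "A_val X p D v = A_gen (funfield X) (topspace (topo X)) (local_at X) p (map_stalk X D) v"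

definition ideal_stalk :: "('x, 'a) rspace \<Rightarrow> 'x set \<Rightarrow> 'x \<Rightarrow> ('x, 'a) germ set" where
  "ideal_stalk X Z x = {g. \<exists>U. openin (topo X) U \<and> x \<in> U \<and> g \<in> sec_in X U \<and>
     (\<forall>y\<in>U \<inter> Z. g \<in> max_ideal (local_ring_at X y))}"

definition uniformly_compatible ::
  "('x, 'a) rspace \<Rightarrow> ('x, 'a) map_family \<Rightarrow> 'x set \<Rightarrow> bool" where
  "uniformly_compatible X D Z \<longleftrightarrow>
     (\<forall>x\<in>topspace (topo X). \<forall>e\<ge>1. \<forall>\<psi>\<in>map_stalk X D x e.
        \<psi> ` ideal_stalk X Z x \<subseteq> ideal_stalk X Z x)"

text \<open>The map induced by \<open>\<psi>\<close> on the residue field of \<open>x\<close>, the function field of the closure of \<open>x\<close>.\<close>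

definition induced_map ::
  "('x, 'a) rspace \<Rightarrow> 'x \<Rightarrow> (('x, 'a) germ \<Rightarrow> ('x, 'a) germ) \<Rightarrow>
   ('x, 'a) germ set \<Rightarrow> ('x, 'a) germ set" where
  "induced_map X x \<psi> c = the_elem ((\<lambda>f. residue X x (\<psi> f)) ` c)"

definition A_beth ::
  "('x, 'a) rspace \<Rightarrow> nat \<Rightarrow> ('x, 'a) map_family \<Rightarrow> (('x, 'a) germ set \<Rightarrow> ereal) \<times> 'x \<Rightarrow> ereal" where
  "A_beth X p D = (\<lambda>(w, x).
     if uniformly_compatible X D (topo X closure_of {x})
     then A_gen (residue_field X x) (topo X closure_of {x}) (closed_local_at X x) p
            (\<lambda>z e. induced_map X x ` map_stalk X D z e) w
     else \<infinity>)"

section \<open>Divisors over a scheme\<close>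

definition prime_divisor :: "('y, 'b) rspace \<Rightarrow> 'y set \<Rightarrow> bool" where
  "prime_divisor Y E \<longleftrightarrow> irreducible_closed (topo Y) E \<and> E \<noteq> topspace (topo Y) \<and>
     \<not> (\<exists>F. irreducible_closed (topo Y) F \<and> E \<subset> F \<and> F \<subset> topspace (topo Y))"

definition divisor_over ::
  "('t, 's) rspace itself \<Rightarrow> ('u, 'w) rspace itself \<Rightarrow>
   ('x, 'a) rspace \<Rightarrow> ('y, 'b) rspace \<Rightarrow> ('y, 'b, 'x, 'a) rmor \<Rightarrow> 'y set \<Rightarrow> bool" where
  "divisor_over TT UU X Y f E \<longleftrightarrow>
     scheme Y \<and> separated_scheme Y \<and> noetherian_scheme Y \<and>
     integral_scheme Y \<and> normal_scheme Y \<and>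
     proper_morphism TT UU Y X f \<and> birational_morphism Y X f \<and> prime_divisor Y E"

text \<open>\<open>w\<close> is the normalized discrete valuation of the function field of \<open>Y\<close> whose valuation ring is
  the local ring of \<open>Y\<close> at the generic point of \<open>E\<close>; it is unique on the function field.\<close>

definition is_ord_along :: "('y, 'b) rspace \<Rightarrow> 'y set \<Rightarrow> (('y, 'b) germ \<Rightarrow> ereal) \<Rightarrow> bool" where
  "is_ord_along Y E w \<longleftrightarrow> is_valuation (funfield Y) w \<and>
     (\<forall>g\<in>carrier (funfield Y) - {\<zero>\<^bsub>funfield Y\<^esub>}. \<exists>k::int. w g = ereal (of_int k)) \<and>
     (\<exists>g\<in>carrier (funfield Y). w g = 1) \<and>
     {g \<in> carrier (funfield Y). 0 \<le> w g} = local_at Y (generic_of Y E)"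

text \<open>\<open>v\<close> is the valuation attached to \<open>E\<close>, transported to the function field of \<open>X\<close>.\<close>

definition is_ord ::
  "('x, 'a) rspace \<Rightarrow> ('y, 'b) rspace \<Rightarrow> ('y, 'b, 'x, 'a) rmor \<Rightarrow> 'y set \<Rightarrow>
   (('x, 'a) germ \<Rightarrow> ereal) \<Rightarrow> bool" where
  "is_ord X Y f E v \<longleftrightarrow> (\<exists>w. is_ord_along Y E w \<and>
     (\<forall>g\<in>carrier (funfield X). v g = w (stalk_map Y f (generic_point Y) g)))"

end

(*
  (1), (2): if v = ord_E has center x on X and \<psi> is a p^-e-linear map of O_(X,x) with \<psi>(g) = 1,
  then v(\<psi> g) = 0 and hence A(v; \<psi>) \<ge> v(g) / (p^e - 1). F-purity supplies such a \<psi> for some g in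
  O_(X,x); F-regularity supplies one for a nonzero g with v(g) > 0. The center is the image of the
  generic point of E; it is unique because X is separated.

  (3): only the trivial semivaluations are needed. For x other than the generic point, let w be the
  trivial valuation of the residue field of x. If the closure of x is uniformly compatible, then
  A(w) \<le> 0, with A(w) = -\<infinity> when every p^-e-linear map sends O_(X,x) into its maximal ideal.
  If X is not F-pure at x, the latter happens, so A(w) = -\<infinity>. (At the generic point the Frobenius
  splits, because K is a vector space over K^p and denominators can be cleared by F-finiteness.) If X
  is F-pure but f at x is a witness against F-regularity, then f lies in the splitting prime of
  O_(X,x). This prime corresponds to a point z which is not the generic point. The closure of z is
  uniformly compatible, so that A(w) \<le> 0 for the trivial valuation w at z.
*)

theory Submission
  imports Defs
begin

section \<open>Germs\<close>

text \<open>Sections, stalks and Cartier maps are compared inside the function field, where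
  restriction maps become inclusions; statements about sheaves thereby turn into statements about
  fractions over one affine open set. The obstacle in (3) is that the point \<open>z\<close> of the
  splitting prime has to be stable under all maps defined near \<open>z\<close>, whereas the
  splitting prime is built from maps defined near \<open>x\<close>. F-finiteness bridges the two:
  over an affine open set \<open>V\<close> containing both points, the sections are generated by
  finitely many elements over their \<open>p\<close>-th powers, so a single denominator
  \<open>s\<close> outside the prime makes \<open>s * \<psi>\<close> preserve the sections over
  \<open>V\<close>. Being compatible with localization, \<open>s * \<psi>\<close> is then a map near
  \<open>x\<close>, and primality removes \<open>s\<close> from the conclusion. The same clearing of
  denominators moves the splitting of Frobenius from the function field to an open set. The value
  \<open>-\<infinity>\<close> in the case of F-purity is a supremum over an empty set of maps. To
  know that this set is empty, the center of the trivial valuation at \<open>x\<close> has to be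
  shown to be \<open>x\<close> itself and not a specialization of it.\<close>

context ringed_space
begin

lemma res_closed:
  assumes "openin (topo X) U" "openin (topo X) V" "V \<subseteq> U" "s \<in> carrier (sec X U)"
  shows "res X U V s \<in> carrier (sec X V)"
  using ring_hom_closed[OF res_hom[OF assms(1-3)] assms(4)] .

text \<open>Agreement on a smaller neighbourhood is transitive, because two witnessing
  neighbourhoods may be intersected. The sets formed by \<open>germ_of\<close> are therefore
  equivalence classes.\<close>

lemma germ_of_eq_iff:
  assumes "openin (topo X) U" "x \<in> U" "s \<in> carrier (sec X U)"
    and "openin (topo X) V" "x \<in> V" "t \<in> carrier (sec X V)"
  shows "germ_of X x U s = germ_of X x V t \<longleftrightarrow>
    (\<exists>W. openin (topo X) W \<and> x \<in> W \<and> W \<subseteq> U \<inter> V \<and> res X U W s = res X V W t)"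
    (is "?L = ?R")
proof -
  define R where "R = (\<lambda>U s V t. \<exists>W. openin (topo X) W \<and> x \<in> W \<and> W \<subseteq> U \<inter> V \<and> res X U W s = res X V W t)"
  have tr: "R U s W u"
    if U: "openin (topo X) U" "x \<in> U" "s \<in> carrier (sec X U)"
    and V: "openin (topo X) V" "x \<in> V" "t \<in> carrier (sec X V)"
    and W: "openin (topo X) W" "x \<in> W" "u \<in> carrier (sec X W)"
    and 1: "R U s V t" and 2: "R V t W u" for U s V t W u
  proof -
    obtain A where A: "openin (topo X) A" "x \<in> A" "A \<subseteq> U \<inter> V" "res X U A s = res X V A t"
      using 1 by (auto simp: R_def)
    obtain B where B: "openin (topo X) B" "x \<in> B" "B \<subseteq> V \<inter> W" "res X V B t = res X W B u"
      using 2 by (auto simp: R_def)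
    have o: "openin (topo X) (A \<inter> B)" using A B by auto
    have "res X U (A \<inter> B) s = res X A (A \<inter> B) (res X U A s)"
      using res_res[of U A "A \<inter> B" s] A U o by auto
    also have "\<dots> = res X V (A \<inter> B) t"
      unfolding A(4) using res_res[of V A "A \<inter> B" t] A V o by auto
    also have "\<dots> = res X B (A \<inter> B) (res X V B t)"
      using res_res[of V B "A \<inter> B" t] B V o by auto
    also have "\<dots> = res X W (A \<inter> B) u"
      unfolding B(4) using res_res[of W B "A \<inter> B" u] B W o by auto
    finally show ?thesis unfolding R_def using A B o by (intro exI[of _ "A \<inter> B"]) auto
  qed
  have sy: "R U s V t \<Longrightarrow> R V t U s" for U s V t unfolding R_def by (elim exE conjE, rule exI) auto
  have mem: "(V, t) \<in> germ_of X x U s \<longleftrightarrow> openin (topo X) V \<and> x \<in> V \<and> t \<in> carrier (sec X V) \<and> R U s V t" for U s V t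
    by (auto simp: germ_of_def R_def)
  have rf: "R V t V t" unfolding R_def using assms(4,5) by auto
  show ?thesis
  proof
    assume ?L
    have "(V, t) \<in> germ_of X x V t" using rf assms by (simp add: mem)
    then have "(V, t) \<in> germ_of X x U s" using \<open>?L\<close> by simp
    then show ?R unfolding mem R_def by blast
  next
    assume ?R
    then have r: "R U s V t" unfolding R_def .
    have "p \<in> germ_of X x U s \<longleftrightarrow> p \<in> germ_of X x V t" for p
    proof (cases p)
      case (Pair W u)
      have "R V t W u" if "R U s W u" "openin (topo X) W" "x \<in> W" "u \<in> carrier (sec X W)"
        using tr[OF assms(4-6) assms(1-3) that(2-4) sy[OF r] that(1)] .
      moreover have "R U s W u" if "R V t W u" "openin (topo X) W" "x \<in> W" "u \<in> carrier (sec X W)"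
        using tr[OF assms(1-3) assms(4-6) that(2-4) r that(1)] .
      ultimately show ?thesis unfolding Pair mem by blast
    qed
    then show ?L by blast
  qed
qed

lemma mem_germ_of:
  assumes "openin (topo X) U" "x \<in> U" "s \<in> carrier (sec X U)"
  shows "(V, t) \<in> germ_of X x U s \<longleftrightarrow>
    openin (topo X) V \<and> x \<in> V \<and> t \<in> carrier (sec X V) \<and> germ_of X x U s = germ_of X x V t"
proof -
  have "(V, t) \<in> germ_of X x U s \<longleftrightarrow> openin (topo X) V \<and> x \<in> V \<and> t \<in> carrier (sec X V) \<and>
    (\<exists>W. openin (topo X) W \<and> x \<in> W \<and> W \<subseteq> U \<inter> V \<and> res X U W s = res X V W t)"
    by (auto simp: germ_of_def)
  then show ?thesis using germ_of_eq_iff[OF assms] by blast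
qed

lemma germ_of_res:
  assumes "openin (topo X) U" "openin (topo X) V" "V \<subseteq> U" "x \<in> V" "s \<in> carrier (sec X U)"
  shows "germ_of X x V (res X U V s) = germ_of X x U s"
proof -
  have r: "res X U V s \<in> carrier (sec X V)" using assms res_closed by blast
  have "x \<in> U" using assms by blast
  moreover have "res X V V (res X U V s) = res X U V s" using r assms res_id by blast
  ultimately show ?thesis using assms r by (subst germ_of_eq_iff) blast+
qed

text \<open>The operation \<open>opr\<close> is arbitrary as long as it commutes with restriction,
  so that sums and products of germs are handled by one proof. The two results already agree on the
  intersection of the neighbourhoods on which the representatives agree.\<close>

lemma germ_of_Int_res:
  assumes "openin (topo X) U" "openin (topo X) V" "x \<in> U" "x \<in> V"
    and "s \<in> carrier (sec X U)" "t \<in> carrier (sec X V)"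
    and "openin (topo X) U'" "openin (topo X) V'" "x \<in> U'" "x \<in> V'"
    and "s' \<in> carrier (sec X U')" "t' \<in> carrier (sec X V')"
    and eq: "germ_of X x U s = germ_of X x U' s'" "germ_of X x V t = germ_of X x V' t'"
    and op_closed: "\<And>W a b. \<lbrakk>openin (topo X) W; a \<in> carrier (sec X W); b \<in> carrier (sec X W)\<rbrakk>
      \<Longrightarrow> opr W a b \<in> carrier (sec X W)"
    and op_res: "\<And>W W' a b. \<lbrakk>openin (topo X) W; openin (topo X) W'; W' \<subseteq> W;
       a \<in> carrier (sec X W); b \<in> carrier (sec X W)\<rbrakk>
      \<Longrightarrow> res X W W' (opr W a b) = opr W' (res X W W' a) (res X W W' b)"
  shows "germ_of X x (U \<inter> V) (opr (U \<inter> V) (res X U (U \<inter> V) s) (res X V (U \<inter> V) t))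
    = germ_of X x (U' \<inter> V') (opr (U' \<inter> V') (res X U' (U' \<inter> V') s') (res X V' (U' \<inter> V') t'))"
proof -
  obtain A where A: "openin (topo X) A" "x \<in> A" "A \<subseteq> U \<inter> U'" "res X U A s = res X U' A s'"
    using eq(1) assms by (subst (asm) germ_of_eq_iff) auto
  obtain B where B: "openin (topo X) B" "x \<in> B" "B \<subseteq> V \<inter> V'" "res X V B t = res X V' B t'"
    using eq(2) assms by (subst (asm) germ_of_eq_iff) auto
  have o: "openin (topo X) (A \<inter> B)" "openin (topo X) (U \<inter> V)" "openin (topo X) (U' \<inter> V')"
    using A B assms by auto
  have s: "res X U (A \<inter> B) s = res X U' (A \<inter> B) s'"
    using res_res[of U A "A \<inter> B" s] res_res[of U' A "A \<inter> B" s'] A assms o by auto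
  have t: "res X V (A \<inter> B) t = res X V' (A \<inter> B) t'"
    using res_res[of V B "A \<inter> B" t] res_res[of V' B "A \<inter> B" t'] B assms o by auto
  have 1: "res X (U \<inter> V) (A \<inter> B) (opr (U \<inter> V) (res X U (U \<inter> V) s) (res X V (U \<inter> V) t))
     = opr (A \<inter> B) (res X U (A \<inter> B) s) (res X V (A \<inter> B) t)"
    using op_res[OF o(2,1), of "res X U (U \<inter> V) s" "res X V (U \<inter> V) t"]
      res_res[OF assms(1) o(2,1), of s] res_res[OF assms(2) o(2,1), of t]
      res_closed[OF assms(1) o(2), of s] res_closed[OF assms(2) o(2), of t] A(3) B(3) assms(5,6)
    by fastforce
  have 2: "res X (U' \<inter> V') (A \<inter> B) (opr (U' \<inter> V') (res X U' (U' \<inter> V') s') (res X V' (U' \<inter> V') t'))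
     = opr (A \<inter> B) (res X U' (A \<inter> B) s') (res X V' (A \<inter> B) t')"
    using op_res[OF o(3,1), of "res X U' (U' \<inter> V') s'" "res X V' (U' \<inter> V') t'"]
      res_res[OF assms(7) o(3,1), of s'] res_res[OF assms(8) o(3,1), of t']
      res_closed[OF assms(7) o(3), of s'] res_closed[OF assms(8) o(3), of t'] A(3) B(3) assms(11,12)
    by fastforce
  have c: "opr (U \<inter> V) (res X U (U \<inter> V) s) (res X V (U \<inter> V) t) \<in> carrier (sec X (U \<inter> V))"
    "opr (U' \<inter> V') (res X U' (U' \<inter> V') s') (res X V' (U' \<inter> V') t') \<in> carrier (sec X (U' \<inter> V'))"
    using assms(1-12) o by (intro op_closed res_closed; blast)+
  have "A \<inter> B \<subseteq> (U \<inter> V) \<inter> (U' \<inter> V')" "x \<in> A \<inter> B" using A B by auto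
  then show ?thesis
    unfolding germ_of_eq_iff[OF o(2) IntI[OF assms(3,4)] c(1) o(3) IntI[OF assms(9,10)] c(2)]
    using o(1) 1 2 s t by (intro exI[of _ "A \<inter> B"]) simp
qed

text \<open>The well-definedness behind \<open>the_elem\<close> in \<open>stalk\<close>: all choices
  of representatives yield one and the same germ, so the set of results is a singleton.\<close>

lemma the_elem_germ_of:
  assumes "openin (topo X) U" "x \<in> U" "s \<in> carrier (sec X U)" "t \<in> carrier (sec X U)"
    and op_closed: "\<And>W a b. \<lbrakk>openin (topo X) W; a \<in> carrier (sec X W); b \<in> carrier (sec X W)\<rbrakk>
      \<Longrightarrow> opr W a b \<in> carrier (sec X W)"
    and op_res: "\<And>W W' a b. \<lbrakk>openin (topo X) W; openin (topo X) W'; W' \<subseteq> W;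
       a \<in> carrier (sec X W); b \<in> carrier (sec X W)\<rbrakk>
      \<Longrightarrow> res X W W' (opr W a b) = opr W' (res X W W' a) (res X W W' b)"
  shows "the_elem {germ_of X x (U' \<inter> V') (opr (U' \<inter> V') (res X U' (U' \<inter> V') s') (res X V' (U' \<inter> V') t'))
     | U' s' V' t'. (U', s') \<in> germ_of X x U s \<and> (V', t') \<in> germ_of X x U t}
    = germ_of X x U (opr U s t)" (is "the_elem ?S = ?g")
proof -
  have "a = ?g" if aS: "a \<in> ?S" for a
  proof -
    obtain U' s' V' t' where a: "a = germ_of X x (U' \<inter> V') (opr (U' \<inter> V') (res X U' (U' \<inter> V') s') (res X V' (U' \<inter> V') t'))"
      and m: "(U', s') \<in> germ_of X x U s" "(V', t') \<in> germ_of X x U t" using aS by blast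
    have m': "openin (topo X) U'" "x \<in> U'" "s' \<in> carrier (sec X U')" "germ_of X x U s = germ_of X x U' s'"
      "openin (topo X) V'" "x \<in> V'" "t' \<in> carrier (sec X V')" "germ_of X x U t = germ_of X x V' t'"
      using m mem_germ_of[OF assms(1-3)] mem_germ_of[OF assms(1,2,4)] by auto
    have "a = germ_of X x (U \<inter> U) (opr (U \<inter> U) (res X U (U \<inter> U) s) (res X U (U \<inter> U) t))"
      unfolding a
      by (rule germ_of_Int_res[symmetric, where opr = opr,
            OF assms(1,1,2,2,3,4) m'(1,5,2,6,3,7,4,8)]) (fact op_closed op_res)+
    then show ?thesis using res_id[OF assms(1)] assms(3,4) by simp
  qed
  moreover have "?g \<in> ?S"
  proof -
    have "(U, s) \<in> germ_of X x U s" "(U, t) \<in> germ_of X x U t" using mem_germ_of[OF assms(1-3)] mem_germ_of[OF assms(1,2,4)] assms(1-4) by auto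
    moreover have "?g = germ_of X x (U \<inter> U) (opr (U \<inter> U) (res X U (U \<inter> U) s) (res X U (U \<inter> U) t))"
      using res_id[OF assms(1)] assms(3,4) by simp
    ultimately show ?thesis by blast
  qed
  ultimately have "?S = {?g}" by blast
  then show ?thesis by simp
qed

section \<open>Ring operations of a stalk, computed over a common neighbourhood\<close>

lemma stalk_add:
  assumes "openin (topo X) U" "x \<in> U" "s \<in> carrier (sec X U)" "t \<in> carrier (sec X U)"
  shows "germ_of X x U s \<oplus>\<^bsub>stalk X x\<^esub> germ_of X x U t = germ_of X x U (s \<oplus>\<^bsub>sec X U\<^esub> t)"
  using the_elem_germ_of[OF assms, where opr = "\<lambda>W. add (sec X W)"]
  by (simp add: stalk_def ring.ring_simprules cring.axioms(1) sec_cring ring_hom_add[OF res_hom])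

lemma stalk_mult:
  assumes "openin (topo X) U" "x \<in> U" "s \<in> carrier (sec X U)" "t \<in> carrier (sec X U)"
  shows "germ_of X x U s \<otimes>\<^bsub>stalk X x\<^esub> germ_of X x U t = germ_of X x U (s \<otimes>\<^bsub>sec X U\<^esub> t)"
  using the_elem_germ_of[OF assms, where opr = "\<lambda>W. mult (sec X W)"]
  by (simp add: stalk_def ring.ring_simprules cring.axioms(1) sec_cring ring_hom_mult[OF res_hom])

lemma stalk_one:
  assumes "openin (topo X) U" "x \<in> U"
  shows "\<one>\<^bsub>stalk X x\<^esub> = germ_of X x U \<one>\<^bsub>sec X U\<^esub>"
proof -
  have o: "openin (topo X) (topspace (topo X))" "U \<subseteq> topspace (topo X)" using assms openin_subset by auto
  have "germ_of X x U (res X (topspace (topo X)) U \<one>\<^bsub>sec X (topspace (topo X))\<^esub>) = \<one>\<^bsub>stalk X x\<^esub>"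
    using assms o sec_cring[OF o(1)] by (subst germ_of_res) (auto simp: stalk_def cring.cring_simprules)
  then show ?thesis using ring_hom_one[OF res_hom[OF o(1) assms(1) o(2)]] by simp
qed

lemma stalk_carrierI:
  "openin (topo X) U \<Longrightarrow> x \<in> U \<Longrightarrow> s \<in> carrier (sec X U) \<Longrightarrow> germ_of X x U s \<in> carrier (stalk X x)"
  by (auto simp: stalk_def)

lemma stalk_carrierE:
  assumes "a \<in> carrier (stalk X x)"
  obtains U s where "openin (topo X) U" "x \<in> U" "s \<in> carrier (sec X U)" "a = germ_of X x U s"
  using assms by (auto simp: stalk_def)

lemma germ_hom:
  assumes "openin (topo X) U" "x \<in> U"
  shows "germ_of X x U \<in> ring_hom (sec X U) (stalk X x)"
  by (rule ring_hom_memI)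
    (use assms in \<open>auto simp: stalk_add stalk_mult stalk_one[OF assms] intro: stalk_carrierI\<close>)

text \<open>The empty family covers the empty set, so locality holds there without any
  condition.\<close>

lemma sections_over_empty:
  assumes "s \<in> carrier (sec X {})" "t \<in> carrier (sec X {})" shows "s = t"
  using locality[of "{}" s t] assms by simp

end

section \<open>Integral schemes\<close>

context scheme
begin

lemma affine_open_openin: "affine_open X V \<Longrightarrow> openin (topo X) V"
  by (simp add: affine_open_def)

lemma point_ideal_prime:
  assumes "affine_open X V" "x \<in> V"
  shows "primeideal (point_ideal X V x) (sec X V)"
proof -
  have "point_ideal X V ` V = {P. primeideal P (sec X V)}"
    using assms(1) unfolding affine_open_def bij_betw_def by blast
  then show ?thesis using assms(2) by blast
qed

lemma prime_is_point_ideal: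
  assumes "affine_open X V" "primeideal P (sec X V)"
  obtains x where "x \<in> V" "point_ideal X V x = P"
proof -
  have "point_ideal X V ` V = {P. primeideal P (sec X V)}"
    using assms(1) unfolding affine_open_def bij_betw_def by blast
  then have "P \<in> point_ideal X V ` V" using assms(2) by simp
  then show ?thesis using that by (elim imageE) simp
qed

lemma point_ideal_inj:
  assumes "affine_open X V" "x \<in> V" "y \<in> V" "point_ideal X V x = point_ideal X V y"
  shows "x = y"
proof -
  have "inj_on (point_ideal X V) V"
    using assms(1) unfolding affine_open_def bij_betw_def by blast
  then show ?thesis using assms by (auto dest: inj_onD)
qed

lemma openin_affine_iff:
  assumes "affine_open X V" "W \<subseteq> V"
  shows "openin (topo X) W \<longleftrightarrow> (\<exists>I\<subseteq>carrier (sec X V). W = {x \<in> V. \<not> I \<subseteq> point_ideal X V x})"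
  using assms unfolding affine_open_def by blast

lemma basic_open_subset: "basic_open X V s \<subseteq> V"
  by (auto simp: basic_open_def)

lemma openin_basic_open:
  assumes "affine_open X V" "s \<in> carrier (sec X V)"
  shows "openin (topo X) (basic_open X V s)"
  unfolding openin_affine_iff[OF assms(1) basic_open_subset]
  by (rule exI[of _ "{s}"]) (use assms(2) in \<open>auto simp: basic_open_def\<close>)

lemma basic_open_basis:
  assumes "affine_open X V" "openin (topo X) W" "x \<in> W" "x \<in> V"
  obtains h where "h \<in> carrier (sec X V)" "x \<in> basic_open X V h" "basic_open X V h \<subseteq> W"
proof -
  have "openin (topo X) (W \<inter> V)" using assms affine_open_openin by blast
  then obtain I where I: "I \<subseteq> carrier (sec X V)" "W \<inter> V = {x \<in> V. \<not> I \<subseteq> point_ideal X V x}"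
    unfolding openin_affine_iff[OF assms(1) Int_lower2] by blast
  have "x \<in> W \<inter> V" using assms by blast
  then obtain h where h: "h \<in> I" "h \<notin> point_ideal X V x" unfolding I(2) by blast
  have "basic_open X V h \<subseteq> W \<inter> V" unfolding I(2) using h(1) by (auto simp: basic_open_def)
  then show ?thesis using that[of h] h I(1) assms(4) by (auto simp: basic_open_def)
qed

lemma localization_basic_open:
  assumes "affine_open X V" "s \<in> carrier (sec X V)"
  shows "is_localization_away (sec X V) s (sec X (basic_open X V s)) (res X V (basic_open X V s))"
  using assms unfolding affine_open_def by blast

lemma zero_in_point_ideal:
  "affine_open X V \<Longrightarrow> x \<in> V \<Longrightarrow> \<zero>\<^bsub>sec X V\<^esub> \<in> point_ideal X V x"
  using point_ideal_prime additive_subgroup.zero_closed ideal.axioms(1) primeideal.axioms(1) by blast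

end

section \<open>Irreducibility, the generic point and injectivity of restriction\<close>

locale integral_scheme_space = scheme X for X :: "('x, 'a) rspace" +
  assumes integral: "integral_scheme X"
begin

lemma sec_domain: "openin (topo X) U \<Longrightarrow> U \<noteq> {} \<Longrightarrow> domain (sec X U)"
  using integral by (simp add: integral_scheme_def)

text \<open>On a disjoint union the sections that are (1, 0) and (0, 1) on the two pieces exist by
  gluing. They are nonzero with product 0, which a domain forbids.\<close>

lemma opens_meet:
  assumes U: "openin (topo X) U" "U \<noteq> {}" and V: "openin (topo X) V" "V \<noteq> {}"
  shows "U \<inter> V \<noteq> {}"
proof
  assume disj: "U \<inter> V = {}"
  have o: "openin (topo X) (U \<union> V)" using U V by blast
  interpret D: domain "sec X (U \<union> V)" using sec_domain[OF o] U by blast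
  interpret DU: domain "sec X U" using sec_domain U by blast
  interpret DV: domain "sec X V" using sec_domain V by blast
  have sub: "U \<subseteq> U \<union> V" "V \<subseteq> U \<union> V" by auto
  note hU = res_hom[OF o U(1) sub(1)] and hV = res_hom[OF o V(1) sub(2)]
  \<comment> \<open>The gluing condition on the overlap is automatic, since the overlap is empty and
    carries only one section.\<close>
  have glue: "\<exists>s\<in>carrier (sec X (U \<union> V)). res X (U \<union> V) U s = a \<and> res X (U \<union> V) V s = b"
    if ab: "a \<in> carrier (sec X U)" "b \<in> carrier (sec X V)" for a b
  proof -
    define \<sigma> where "\<sigma> = (\<lambda>W. if W = U then a else b)"
    have ne: "U \<noteq> V" using disj U by auto
    have \<sigma>: "\<sigma> U = a" "\<sigma> V = b" using ne by (auto simp: \<sigma>_def)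
    have 1: "res X U (U \<inter> V) a = res X V (U \<inter> V) b" "res X V (V \<inter> U) b = res X U (V \<inter> U) a"
      unfolding disj Int_commute[of V U]
      using ab U V by (auto intro!: sections_over_empty res_closed)
    have "\<exists>s\<in>carrier (sec X (\<Union>{U, V})). \<forall>W\<in>{U, V}. res X (\<Union>{U, V}) W s = \<sigma> W"
    proof (rule gluing)
      fix W W' assume "W \<in> {U, V}" "W' \<in> {U, V}"
      then show "res X W (W \<inter> W') (\<sigma> W) = res X W' (W \<inter> W') (\<sigma> W')"
        using 1 \<sigma> by (elim insertE emptyE) simp_all
    qed (use U V ab \<sigma> in auto)
    then show ?thesis using \<sigma> by auto
  qed
  obtain s where s: "s \<in> carrier (sec X (U \<union> V))" "res X (U \<union> V) U s = \<one>\<^bsub>sec X U\<^esub>"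
    "res X (U \<union> V) V s = \<zero>\<^bsub>sec X V\<^esub>" using glue[OF DU.one_closed DV.zero_closed] by blast
  obtain t where t: "t \<in> carrier (sec X (U \<union> V))" "res X (U \<union> V) U t = \<zero>\<^bsub>sec X U\<^esub>"
    "res X (U \<union> V) V t = \<one>\<^bsub>sec X V\<^esub>" using glue[OF DU.zero_closed DV.one_closed] by blast
  have z: "res X (U \<union> V) U \<zero>\<^bsub>sec X (U \<union> V)\<^esub> = \<zero>\<^bsub>sec X U\<^esub>"
    "res X (U \<union> V) V \<zero>\<^bsub>sec X (U \<union> V)\<^esub> = \<zero>\<^bsub>sec X V\<^esub>"
    using ring_hom_zero[OF hU] ring_hom_zero[OF hV] D.ring_axioms DU.ring_axioms DV.ring_axioms by auto
  have m: "res X (U \<union> V) U (s \<otimes>\<^bsub>sec X (U \<union> V)\<^esub> t) = \<zero>\<^bsub>sec X U\<^esub>"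
    "res X (U \<union> V) V (s \<otimes>\<^bsub>sec X (U \<union> V)\<^esub> t) = \<zero>\<^bsub>sec X V\<^esub>"
    unfolding ring_hom_mult[OF hU s(1) t(1)] ring_hom_mult[OF hV s(1) t(1)] using s t by simp_all
  have "s \<otimes>\<^bsub>sec X (U \<union> V)\<^esub> t = \<zero>\<^bsub>sec X (U \<union> V)\<^esub>"
    by (rule locality[of "{U, V}"]) (use U V s t m z in auto)
  then have "s = \<zero>\<^bsub>sec X (U \<union> V)\<^esub> \<or> t = \<zero>\<^bsub>sec X (U \<union> V)\<^esub>"
    using D.integral s(1) t(1) by blast
  then show False using s t z DU.one_not_zero DV.one_not_zero by metis
qed

lemma topspace_nonempty: "topspace (topo X) \<noteq> {}"
  using integral by (simp add: integral_scheme_def)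

text \<open>The zero ideal of one affine open set \<open>V\<close> is the prime of some point. That
  point lies in every nonempty open \<open>U\<close>, because \<open>U\<close> meets
  \<open>V\<close> and so contains the basic open set of a nonzero \<open>h\<close>.\<close>

lemma generic_point_ex:
  obtains \<eta> where "\<eta> \<in> topspace (topo X)"
    "\<And>U. openin (topo X) U \<Longrightarrow> U \<noteq> {} \<Longrightarrow> \<eta> \<in> U"
proof -
  obtain x where "x \<in> topspace (topo X)" using topspace_nonempty by blast
  then obtain V where V: "affine_open X V" "x \<in> V" using affine_cover by blast
  have oV: "openin (topo X) V" "V \<noteq> {}" using V affine_open_openin by auto
  interpret DV: domain "sec X V" using sec_domain oV by blast
  have "primeideal {\<zero>\<^bsub>sec X V\<^esub>} (sec X V)" using DV.zeroprimeideal .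
  then obtain \<eta> where \<eta>: "\<eta> \<in> V" "point_ideal X V \<eta> = {\<zero>\<^bsub>sec X V\<^esub>}"
    using prime_is_point_ideal[OF V(1)] by blast
  show ?thesis
  proof
    show "\<eta> \<in> topspace (topo X)" using \<eta>(1) oV openin_subset by blast
    fix U assume U: "openin (topo X) U" "U \<noteq> {}"
    then obtain y where y: "y \<in> U" "y \<in> V" using opens_meet[OF U oV] by blast
    obtain h where h: "h \<in> carrier (sec X V)" "y \<in> basic_open X V h" "basic_open X V h \<subseteq> U"
      using basic_open_basis[OF V(1) U(1) y] by blast
    have "h \<noteq> \<zero>\<^bsub>sec X V\<^esub>" using h(2) zero_in_point_ideal[OF V(1) y(2)] by (auto simp: basic_open_def)
    then have "\<eta> \<in> basic_open X V h" using \<eta> by (auto simp: basic_open_def)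
    then show "\<eta> \<in> U" using h(3) by blast
  qed
qed

text \<open>\<open>generic_point\<close> is a definite description, so uniqueness has to accompany
  existence. Two points lying in every nonempty open set cannot be told apart by basic open sets,
  hence have the same prime in an affine open set.\<close>

lemma generic_point_in:
  assumes "openin (topo X) U" "U \<noteq> {}"
  shows "generic_point X \<in> U"
    and generic_point_unique: "\<And>x. x \<in> topspace (topo X) \<Longrightarrow>
      (\<And>U. openin (topo X) U \<Longrightarrow> U \<noteq> {} \<Longrightarrow> x \<in> U) \<Longrightarrow> x = generic_point X"
proof -
  obtain \<eta> where \<eta>: "\<eta> \<in> topspace (topo X)"
    "\<And>U. openin (topo X) U \<Longrightarrow> U \<noteq> {} \<Longrightarrow> \<eta> \<in> U" using generic_point_ex by blast
  have cl: "topo X closure_of {x} = topspace (topo X) \<longleftrightarrow>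
      (\<forall>U. openin (topo X) U \<and> U \<noteq> {} \<longrightarrow> x \<in> U)" for x
    by (auto simp: dense_intersects_open)
  have uniq: "x = \<eta>" if x: "x \<in> topspace (topo X)"
    and xo: "\<And>U. openin (topo X) U \<Longrightarrow> U \<noteq> {} \<Longrightarrow> x \<in> U" for x
  proof -
    obtain V where V: "affine_open X V" "x \<in> V" using x affine_cover by blast
    have oV: "openin (topo X) V" "V \<noteq> {}" using V affine_open_openin by auto
    have "\<eta> \<in> V" using \<eta>(2) oV by blast
    have 1: "z \<in> basic_open X V s" if "y \<in> basic_open X V s" "s \<in> carrier (sec X V)"
      "\<And>U. openin (topo X) U \<Longrightarrow> U \<noteq> {} \<Longrightarrow> z \<in> U" for y z s
      using that openin_basic_open[OF V(1)] by blast
    have "s \<in> point_ideal X V x \<longleftrightarrow> s \<in> point_ideal X V \<eta>" for s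
    proof (cases "s \<in> carrier (sec X V)")
      case True
      then show ?thesis using 1[of \<eta> s x] 1[of x s \<eta>] xo \<eta>(2) V(2) \<open>\<eta> \<in> V\<close>
        by (auto simp: basic_open_def)
    qed (auto simp: point_ideal_def)
    then show ?thesis using point_ideal_inj[OF V \<open>\<eta> \<in> V\<close>] by blast
  qed
  have "generic_point X = \<eta>" unfolding generic_point_def generic_of_def cl
  proof (rule the_equality)
    show "\<eta> \<in> topspace (topo X) \<and> (\<forall>U. openin (topo X) U \<and> U \<noteq> {} \<longrightarrow> \<eta> \<in> U)" using \<eta> by blast
  qed (use uniq in blast)
  then show "generic_point X \<in> U"
    and "\<And>x. x \<in> topspace (topo X) \<Longrightarrow>
      (\<And>U. openin (topo X) U \<Longrightarrow> U \<noteq> {} \<Longrightarrow> x \<in> U) \<Longrightarrow> x = generic_point X"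
    using \<eta>(2)[OF assms] uniq by (metis, metis)
qed

text \<open>By locality it suffices that \<open>s\<close> vanishes near each point. There
  \<open>s\<close> is a fraction \<open>a / h^n\<close> over an affine open set, and
  \<open>a\<close> dies in the localization at a nonzero \<open>g\<close> whose basic open set lies
  in \<open>W\<close>; in a domain this forces \<open>a = 0\<close>.\<close>

lemma res_zero_imp_zero:
  assumes U: "openin (topo X) U" and W: "openin (topo X) W" "W \<noteq> {}" "W \<subseteq> U"
    and s: "s \<in> carrier (sec X U)" and s0: "res X U W s = \<zero>\<^bsub>sec X W\<^esub>"
  shows "s = \<zero>\<^bsub>sec X U\<^esub>"
proof -
  have loc: "\<exists>D. openin (topo X) D \<and> x \<in> D \<and> D \<subseteq> U \<and> res X U D s = \<zero>\<^bsub>sec X D\<^esub>" if x: "x \<in> U" for x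
  proof -
    obtain V where V: "affine_open X V" "x \<in> V" using x U affine_cover openin_subset by blast
    have oV: "openin (topo X) V" "V \<noteq> {}" using V affine_open_openin by auto
    interpret DV: domain "sec X V" using sec_domain oV by blast
    obtain h where h: "h \<in> carrier (sec X V)" "x \<in> basic_open X V h" "basic_open X V h \<subseteq> U"
      using basic_open_basis[OF V(1) U x V(2)] by blast
    define D where "D = basic_open X V h"
    have oD: "openin (topo X) D" "D \<noteq> {}" "D \<subseteq> V" "D \<subseteq> U"
      using openin_basic_open[OF V(1) h(1)] h basic_open_subset unfolding D_def by auto
    interpret DD: domain "sec X D" using sec_domain oD by blast
    note rVD = res_hom[OF oV(1) oD(1,3)]
    have sD: "res X U D s \<in> carrier (sec X D)" using res_closed U oD s by blast
    have L: "is_localization_away (sec X V) h (sec X D) (res X V D)"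
      unfolding D_def by (rule localization_basic_open[OF V(1) h(1)])
    then obtain a n where a: "a \<in> carrier (sec X V)"
      "res X U D s \<otimes>\<^bsub>sec X D\<^esub> res X V D h [^]\<^bsub>sec X D\<^esub> (n::nat) = res X V D a"
      using sD unfolding is_localization_away_def by blast
    have hU: "res X V D h \<in> Units (sec X D)" using L unfolding is_localization_away_def by blast
    \<comment> \<open>Irreducibility carries the vanishing from \<open>W\<close> to the possibly
      distant set \<open>D\<close>: a basic open set \<open>G\<close> of \<open>V\<close> fits
      inside both.\<close>
    have "D \<inter> W \<noteq> {}" using opens_meet oD W by blast
    then obtain y where y: "y \<in> D" "y \<in> W" by blast
    have oDW: "openin (topo X) (D \<inter> W)" using oD W by blast
    obtain g where g: "g \<in> carrier (sec X V)" "y \<in> basic_open X V g" "basic_open X V g \<subseteq> D \<inter> W"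
      using basic_open_basis[OF V(1) oDW, of y] y oD by blast
    define G where "G = basic_open X V g"
    have oG: "openin (topo X) G" "G \<noteq> {}" "G \<subseteq> V" "G \<subseteq> D" "G \<subseteq> W" "G \<subseteq> U"
      using openin_basic_open[OF V(1) g(1)] g basic_open_subset oD unfolding G_def by auto
    interpret DG: domain "sec X G" using sec_domain oG by blast
    interpret DW: domain "sec X W" using sec_domain W by blast
    note rDG = res_hom[OF oD(1) oG(1,4)]
    have sG: "res X D G (res X U D s) = \<zero>\<^bsub>sec X G\<^esub>"
    proof -
      have "res X D G (res X U D s) = res X W G (res X U W s)"
        using res_res[OF U oD(1) oG(1) oG(4) oD(4) s] res_res[OF U W(1) oG(1) oG(5) W(3) s] by simp
      also have "\<dots> = \<zero>\<^bsub>sec X G\<^esub>" unfolding s0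
        using ring_hom_zero[OF res_hom[OF W(1) oG(1,5)] DW.ring_axioms DG.ring_axioms] .
      finally show ?thesis .
    qed
    have hD: "res X V D h [^]\<^bsub>sec X D\<^esub> n \<in> carrier (sec X D)" using hU by blast
    have "res X V G a = res X D G (res X V D a)"
      using res_res[OF oV(1) oD(1) oG(1) oG(4) oD(3) a(1)] by simp
    also have "\<dots> = \<zero>\<^bsub>sec X G\<^esub>" unfolding a(2)[symmetric] ring_hom_mult[OF rDG sD hD] sG
      using ring_hom_closed[OF rDG hD] by simp
    finally have aG: "res X V G a = \<zero>\<^bsub>sec X G\<^esub>" .
    have "is_localization_away (sec X V) g (sec X G) (res X V G)"
      unfolding G_def by (rule localization_basic_open[OF V(1) g(1)])
    then obtain m where m: "a \<otimes>\<^bsub>sec X V\<^esub> g [^]\<^bsub>sec X V\<^esub> (m::nat) = \<zero>\<^bsub>sec X V\<^esub>"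
      using a(1) aG unfolding is_localization_away_def by blast
    have "g \<noteq> \<zero>\<^bsub>sec X V\<^esub>" using g(2) zero_in_point_ideal[OF V(1), of y] oD y by (auto simp: basic_open_def)
    then have "g [^]\<^bsub>sec X V\<^esub> m \<noteq> \<zero>\<^bsub>sec X V\<^esub>" using g(1)
      by (induction m) (auto simp: DV.integral_iff)
    then have "a = \<zero>\<^bsub>sec X V\<^esub>" using m a(1) g(1) DV.integral_iff by auto
    then have "res X U D s \<otimes>\<^bsub>sec X D\<^esub> res X V D h [^]\<^bsub>sec X D\<^esub> n = \<zero>\<^bsub>sec X D\<^esub>"
      using a(2) ring_hom_zero[OF rVD DV.ring_axioms DD.ring_axioms] by simp
    moreover have "res X V D h [^]\<^bsub>sec X D\<^esub> n \<in> Units (sec X D)" using hU by (rule DD.Units_pow_closed)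
    then have "res X V D h [^]\<^bsub>sec X D\<^esub> n \<noteq> \<zero>\<^bsub>sec X D\<^esub>"
      using DD.Units_l_inv_ex DD.one_not_zero DD.r_null by metis
    ultimately have "res X U D s = \<zero>\<^bsub>sec X D\<^esub>" using DD.integral sD hD by blast
    moreover have "x \<in> D" using h(2) unfolding D_def .
    ultimately show ?thesis using oD by blast
  qed
  define \<U> where "\<U> = {D. openin (topo X) D \<and> D \<subseteq> U \<and> D \<noteq> {} \<and> res X U D s = \<zero>\<^bsub>sec X D\<^esub>}"
  have Un: "\<Union>\<U> = U"
  proof
    show "U \<subseteq> \<Union>\<U>"
    proof
      fix x assume "x \<in> U"
      then obtain D where "openin (topo X) D" "x \<in> D" "D \<subseteq> U" "res X U D s = \<zero>\<^bsub>sec X D\<^esub>"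
        using loc by blast
      then have "D \<in> \<U>" unfolding \<U>_def by auto
      then show "x \<in> \<Union>\<U>" using \<open>x \<in> D\<close> by (rule UnionI)
    qed
  qed (auto simp: \<U>_def)
  interpret DU: domain "sec X U" using sec_domain U W by blast
  have z: "res X U D \<zero>\<^bsub>sec X U\<^esub> = \<zero>\<^bsub>sec X D\<^esub>" if "D \<in> \<U>" for D
  proof -
    have D: "openin (topo X) D" "D \<subseteq> U" "D \<noteq> {}" using that unfolding \<U>_def by auto
    interpret DD: domain "sec X D" using sec_domain D by blast
    show ?thesis using ring_hom_zero[OF res_hom[OF U D(1,2)] DU.ring_axioms DD.ring_axioms] .
  qed
  show ?thesis
  proof (rule locality[of \<U>, unfolded Un])
    fix D assume D: "D \<in> \<U>"
    then show "openin (topo X) D" by (simp add: \<U>_def)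
    show "res X U D s = res X U D \<zero>\<^bsub>sec X U\<^esub>" using D z by (simp add: \<U>_def)
  qed (use s in auto)
qed

lemma res_inj:
  assumes U: "openin (topo X) U" and W: "openin (topo X) W" "W \<noteq> {}" "W \<subseteq> U"
    and s: "s \<in> carrier (sec X U)" "t \<in> carrier (sec X U)" and eq: "res X U W s = res X U W t"
  shows "s = t"
proof -
  interpret DU: domain "sec X U" using sec_domain U W by blast
  interpret DW: domain "sec X W" using sec_domain W by blast
  interpret h: ring_hom_ring "sec X U" "sec X W" "res X U W"
    by (rule ring_hom_ringI2[OF DU.ring_axioms DW.ring_axioms res_hom[OF U W(1,3)]])
  have "s \<ominus>\<^bsub>sec X U\<^esub> t = \<zero>\<^bsub>sec X U\<^esub>"
  proof (rule res_zero_imp_zero[OF U W])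
    show "res X U W (s \<ominus>\<^bsub>sec X U\<^esub> t) = \<zero>\<^bsub>sec X W\<^esub>"
      using s eq h.hom_closed[OF s(2)] by (simp add: a_minus_def DW.r_neg)
  qed (use s in simp)
  then show ?thesis using s by simp
qed

end

section \<open>Sections and local rings in the function field\<close>

context integral_scheme_space
begin

abbreviation mm :: "'x \<Rightarrow> ('x, 'a) germ set" ("\<mm>") where
  "\<mm> x \<equiv> max_ideal (local_ring_at X x)"

lemma generic_in_topspace: "generic_point X \<in> topspace (topo X)"
  using generic_point_in(1)[OF openin_topspace topspace_nonempty] .

section \<open>The generic stalk is a field\<close>

lemma germ_generic_eq_iff:
  assumes "openin (topo X) U" "U \<noteq> {}" "s \<in> carrier (sec X U)" "t \<in> carrier (sec X U)"
  shows "germ_of X (generic_point X) U s = germ_of X (generic_point X) U t \<longleftrightarrow> s = t"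
proof
  assume e: "germ_of X (generic_point X) U s = germ_of X (generic_point X) U t"
  have g: "generic_point X \<in> U" using generic_point_in(1) assms by blast
  obtain W where W: "openin (topo X) W" "generic_point X \<in> W" "W \<subseteq> U \<inter> U" "res X U W s = res X U W t"
    using e germ_of_eq_iff[OF assms(1) g assms(3) assms(1) g assms(4)] by blast
  have "W \<noteq> {}" "W \<subseteq> U" using W by auto
  then show "s = t" using res_inj[OF assms(1) W(1) _ _ assms(3,4) W(4)] by blast
qed simp

lemma funfield_cring: "cring (funfield X)"
  using stalk_local[OF generic_in_topspace] by (simp add: funfield_def local_ring_def)

lemma generic_germ_hom:
  assumes "openin (topo X) U" "U \<noteq> {}"
  shows "germ_of X (generic_point X) U \<in> ring_hom (sec X U) (funfield X)"
  unfolding funfield_def using germ_hom assms generic_point_in(1) by blast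

lemma generic_germ_ring_hom:
  assumes "openin (topo X) U" "U \<noteq> {}"
  shows "ring_hom_ring (sec X U) (funfield X) (germ_of X (generic_point X) U)"
  using ring_hom_ringI2[OF _ _ generic_germ_hom[OF assms]] funfield_cring sec_cring[OF assms(1)]
  by (simp add: cring_def)

text \<open>The basic open set of a nonzero section contains the point whose prime is zero, so it is
  nonempty and contains the generic point as well.\<close>

lemma point_ideal_generic:
  assumes "affine_open X V" "V \<noteq> {}"
  shows "point_ideal X V (generic_point X) = {\<zero>\<^bsub>sec X V\<^esub>}"
proof -
  have oV: "openin (topo X) V" using affine_open_openin assms by blast
  interpret DV: domain "sec X V" using sec_domain oV assms by blast
  have gV: "generic_point X \<in> V" using generic_point_in(1) oV assms by blast
  obtain x where x: "x \<in> V" "point_ideal X V x = {\<zero>\<^bsub>sec X V\<^esub>}"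
    using prime_is_point_ideal[OF assms(1) DV.zeroprimeideal] by blast
  have "a \<notin> point_ideal X V (generic_point X)" if a: "a \<in> carrier (sec X V)" "a \<noteq> \<zero>\<^bsub>sec X V\<^esub>" for a
  proof -
    have "x \<in> basic_open X V a" using x a by (simp add: basic_open_def)
    then have "generic_point X \<in> basic_open X V a"
      using generic_point_in(1)[OF openin_basic_open[OF assms(1) a(1)]] by blast
    then show ?thesis by (simp add: basic_open_def)
  qed
  moreover have "point_ideal X V (generic_point X) \<subseteq> carrier (sec X V)" by (auto simp: point_ideal_def)
  ultimately show ?thesis using zero_in_point_ideal[OF assms(1) gV] by blast
qed

text \<open>Nonzero sections over an affine open set become units, because the prime of the generic
  point is zero. Any other germ is a quotient of such sections and is a unit as soon as its
  numerator is nonzero.\<close>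

lemma funfield_field: "field (funfield X)"
proof -
  interpret C: cring "funfield X" by (rule funfield_cring)
  let ?g = "generic_point X"
  obtain V where V: "affine_open X V" "?g \<in> V" using affine_cover[OF generic_in_topspace] by blast
  have oV: "openin (topo X) V" "V \<noteq> {}" using V affine_open_openin by auto
  interpret DV: domain "sec X V" using sec_domain oV by blast
  interpret hV: ring_hom_ring "sec X V" "funfield X" "germ_of X ?g V"
    by (rule generic_germ_ring_hom[OF oV])
  have unit: "germ_of X ?g V a \<in> Units (funfield X)" if "a \<in> carrier (sec X V)" "a \<noteq> \<zero>\<^bsub>sec X V\<^esub>" for a
  proof -
    have "a \<notin> point_ideal X V ?g" using that point_ideal_generic[OF V(1) oV(2)] by blast
    then show ?thesis using that(1) hV.hom_closed[OF that(1)]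
      by (auto simp: point_ideal_def max_ideal_def funfield_def)
  qed
  have "k \<in> Units (funfield X)" if k: "k \<in> carrier (funfield X)" "k \<noteq> \<zero>\<^bsub>funfield X\<^esub>" for k
  proof -
    obtain U s where U: "openin (topo X) U" "?g \<in> U" "s \<in> carrier (sec X U)" "k = germ_of X ?g U s"
      using stalk_carrierE k(1) unfolding funfield_def by metis
    obtain h where h: "h \<in> carrier (sec X V)" "?g \<in> basic_open X V h" "basic_open X V h \<subseteq> U"
      using basic_open_basis[OF V(1) U(1,2) V(2)] by blast
    define D where "D = basic_open X V h"
    have oD: "openin (topo X) D" "?g \<in> D" "D \<subseteq> V" "D \<subseteq> U"
      using openin_basic_open[OF V(1) h(1)] h basic_open_subset unfolding D_def by auto
    then have "D \<noteq> {}" by blast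
    interpret DD: domain "sec X D" using sec_domain oD(1) \<open>D \<noteq> {}\<close> by blast
    interpret hD: ring_hom_ring "sec X D" "funfield X" "germ_of X ?g D"
      by (rule generic_germ_ring_hom[OF oD(1) \<open>D \<noteq> {}\<close>])
    have sD: "res X U D s \<in> carrier (sec X D)" using res_closed[OF U(1) oD(1,4) U(3)] .
    have hcD: "res X V D h \<in> carrier (sec X D)" using res_closed[OF oV(1) oD(1,3) h(1)] .
    have "is_localization_away (sec X V) h (sec X D) (res X V D)"
      unfolding D_def by (rule localization_basic_open[OF V(1) h(1)])
    then obtain a n where a: "a \<in> carrier (sec X V)"
      "res X U D s \<otimes>\<^bsub>sec X D\<^esub> res X V D h [^]\<^bsub>sec X D\<^esub> (n::nat) = res X V D a"
      using sD unfolding is_localization_away_def by blast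
    have kD: "k = germ_of X ?g D (res X U D s)"
      unfolding U(4) by (rule germ_of_res[OF U(1) oD(1,4,2) U(3), symmetric])
    have res: "germ_of X ?g D (res X V D b) = germ_of X ?g V b" if "b \<in> carrier (sec X V)" for b
      by (rule germ_of_res[OF oV(1) oD(1,3,2) that])
    have eq: "k \<otimes>\<^bsub>funfield X\<^esub> germ_of X ?g V h [^]\<^bsub>funfield X\<^esub> n = germ_of X ?g V a"
      using arg_cong[OF a(2), of "germ_of X ?g D"] sD hcD
      by (simp add: hD.hom_nat_pow res h(1) a(1) flip: kD)
    have "h \<noteq> \<zero>\<^bsub>sec X V\<^esub>" using h(2) zero_in_point_ideal[OF V] by (auto simp: basic_open_def)
    then have hu: "germ_of X ?g V h [^]\<^bsub>funfield X\<^esub> n \<in> Units (funfield X)"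
      using unit h(1) C.Units_pow_closed by blast
    show ?thesis
    proof (cases "a = \<zero>\<^bsub>sec X V\<^esub>")
      case True
      then have e0: "k \<otimes>\<^bsub>funfield X\<^esub> germ_of X ?g V h [^]\<^bsub>funfield X\<^esub> n = \<zero>\<^bsub>funfield X\<^esub>" using eq by simp
      obtain u where u: "u \<in> carrier (funfield X)"
        "germ_of X ?g V h [^]\<^bsub>funfield X\<^esub> n \<otimes>\<^bsub>funfield X\<^esub> u = \<one>\<^bsub>funfield X\<^esub>"
        using C.Units_r_inv_ex[OF hu] by blast
      have "k = k \<otimes>\<^bsub>funfield X\<^esub> germ_of X ?g V h [^]\<^bsub>funfield X\<^esub> n \<otimes>\<^bsub>funfield X\<^esub> u"
        using k(1) u hu C.Units_closed[OF hu] by (simp add: C.m_assoc)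
      then show ?thesis using e0 u k by simp
    next
      case False
      then have "k \<otimes>\<^bsub>funfield X\<^esub> germ_of X ?g V h [^]\<^bsub>funfield X\<^esub> n \<in> Units (funfield X)"
        using eq unit a(1) by simp
      then show ?thesis using C.unit_factor k(1) C.Units_closed[OF hu] by blast
    qed
  qed
  \<comment> \<open>The stalk is not the zero ring: generic germs separate sections, and 1 differs
    from 0 over \<open>V\<close>.\<close>
  moreover have "\<zero>\<^bsub>funfield X\<^esub> \<notin> Units (funfield X)"
  proof
    assume "\<zero>\<^bsub>funfield X\<^esub> \<in> Units (funfield X)"
    then obtain u where "u \<in> carrier (funfield X)" "\<zero>\<^bsub>funfield X\<^esub> \<otimes>\<^bsub>funfield X\<^esub> u = \<one>\<^bsub>funfield X\<^esub>"
      using C.Units_r_inv_ex by blast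
    then have "germ_of X ?g V \<zero>\<^bsub>sec X V\<^esub> = germ_of X ?g V \<one>\<^bsub>sec X V\<^esub>" by simp
    then show False using germ_generic_eq_iff[OF oV, of "\<zero>\<^bsub>sec X V\<^esub>" "\<one>\<^bsub>sec X V\<^esub>"] DV.one_not_zero by simp
  qed
  moreover have "Units (funfield X) \<subseteq> carrier (funfield X)" using C.Units_closed by blast
  ultimately show ?thesis by (intro C.cring_fieldI) blast
qed

end

sublocale integral_scheme_space \<subseteq> K: field "funfield X"
  by (rule funfield_field)

context integral_scheme_space
begin

section \<open>Sections and local rings as subrings of the function field\<close>

lemma sec_in_subring:
  assumes "openin (topo X) U" "U \<noteq> {}"
  shows "subring (sec_in X U) (funfield X)"
proof -
  interpret h: ring_hom_ring "sec X U" "funfield X" "germ_of X (generic_point X) U"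
    by (rule generic_germ_ring_hom[OF assms])
  show ?thesis unfolding sec_in_def using h.img_is_subring[OF h.R.carrier_is_subring] .
qed

lemma sec_in_mono:
  assumes "openin (topo X) U" "openin (topo X) W" "W \<noteq> {}" "W \<subseteq> U"
  shows "sec_in X U \<subseteq> sec_in X W"
proof
  fix k assume "k \<in> sec_in X U"
  then obtain s where s: "s \<in> carrier (sec X U)" "k = germ_of X (generic_point X) U s"
    unfolding sec_in_def by blast
  have "generic_point X \<in> W" using generic_point_in(1) assms by blast
  then have "k = germ_of X (generic_point X) W (res X U W s)" using germ_of_res assms s by metis
  then show "k \<in> sec_in X W" unfolding sec_in_def using res_closed[OF assms(1,2,4) s(1)] by blast
qed

text \<open>Sections with the same generic germ agree on overlaps, since overlaps are nonempty and
  generic germs are injective there. The sheaf condition thus becomes a condition on membership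
  only.\<close>

lemma sec_in_sheaf:
  assumes \<U>: "\<And>U. U \<in> \<U> \<Longrightarrow> openin (topo X) U \<and> U \<noteq> {}" "\<U> \<noteq> {}"
    and k: "\<And>U. U \<in> \<U> \<Longrightarrow> k \<in> sec_in X U"
  shows "k \<in> sec_in X (\<Union>\<U>)"
proof -
  let ?g = "generic_point X"
  have "\<forall>U\<in>\<U>. \<exists>s\<in>carrier (sec X U). k = germ_of X ?g U s" using k unfolding sec_in_def by blast
  then obtain \<sigma> where \<sigma>: "\<And>U. U \<in> \<U> \<Longrightarrow> \<sigma> U \<in> carrier (sec X U) \<and> k = germ_of X ?g U (\<sigma> U)" by metis
  have "\<exists>s\<in>carrier (sec X (\<Union>\<U>)). \<forall>U\<in>\<U>. res X (\<Union>\<U>) U s = \<sigma> U"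
  proof (rule gluing)
    fix U V assume UV: "U \<in> \<U>" "V \<in> \<U>"
    have o: "openin (topo X) U" "openin (topo X) V" "openin (topo X) (U \<inter> V)"
      using \<U> UV by auto
    have ne: "U \<inter> V \<noteq> {}" using \<U>(1) UV opens_meet by blast
    have g: "?g \<in> U \<inter> V" using generic_point_in(1)[OF o(3) ne] .
    have "germ_of X ?g (U \<inter> V) (res X U (U \<inter> V) (\<sigma> U)) = k"
      using germ_of_res[OF o(1,3) _ g] \<sigma>[OF UV(1)] by auto
    moreover have "germ_of X ?g (U \<inter> V) (res X V (U \<inter> V) (\<sigma> V)) = k"
      using germ_of_res[OF o(2,3) _ g] \<sigma>[OF UV(2)] by auto
    ultimately show "res X U (U \<inter> V) (\<sigma> U) = res X V (U \<inter> V) (\<sigma> V)"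
      using germ_generic_eq_iff[OF o(3) ne] res_closed[OF o(1,3)] res_closed[OF o(2,3)] \<sigma> UV
      by (metis Int_lower1 Int_lower2)
  qed (use \<U> \<sigma> in auto)
  then obtain s where s: "s \<in> carrier (sec X (\<Union>\<U>))" "\<And>U. U \<in> \<U> \<Longrightarrow> res X (\<Union>\<U>) U s = \<sigma> U" by blast
  obtain U where U: "U \<in> \<U>" using \<U>(2) by blast
  have o: "openin (topo X) U" "openin (topo X) (\<Union>\<U>)" "U \<subseteq> \<Union>\<U>" "?g \<in> U"
    using \<U>(1) U generic_point_in(1) by (auto intro!: openin_Union)
  have "germ_of X ?g (\<Union>\<U>) s = k" using germ_of_res[OF o(2,1,3,4) s(1)] s(2)[OF U] \<sigma>[OF U] by simp
  then show ?thesis unfolding sec_in_def using s(1) by blast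
qed

lemma sec_in_carrier: "openin (topo X) U \<Longrightarrow> U \<noteq> {} \<Longrightarrow> k \<in> sec_in X U \<Longrightarrow> k \<in> carrier (funfield X)"
  using sec_in_subring subringE(1) by blast

lemma funfield_elem:
  assumes "k \<in> carrier (funfield X)"
  obtains U where "openin (topo X) U" "generic_point X \<in> U" "k \<in> sec_in X U"
proof -
  obtain U s where "openin (topo X) U" "generic_point X \<in> U" "s \<in> carrier (sec X U)"
    "k = germ_of X (generic_point X) U s"
    using assms stalk_carrierE unfolding funfield_def by metis
  then show ?thesis using that unfolding sec_in_def by blast
qed

lemma local_atI: "openin (topo X) U \<Longrightarrow> x \<in> U \<Longrightarrow> k \<in> sec_in X U \<Longrightarrow> k \<in> local_at X x"
  unfolding local_at_def by blast

lemma local_atE: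
  assumes "k \<in> local_at X x"
  obtains U where "openin (topo X) U" "x \<in> U" "k \<in> sec_in X U"
  using assms unfolding local_at_def by blast

lemma local_at_subring:
  assumes "x \<in> topspace (topo X)"
  shows "subring (local_at X x) (funfield X)"
proof -
  have two: "\<exists>W. openin (topo X) W \<and> x \<in> W \<and> a \<in> sec_in X W \<and> b \<in> sec_in X W"
    if ab: "a \<in> local_at X x" "b \<in> local_at X x" for a b
  proof -
    obtain U where U: "openin (topo X) U" "x \<in> U" "a \<in> sec_in X U" using ab local_atE by blast
    obtain V where V: "openin (topo X) V" "x \<in> V" "b \<in> sec_in X V" using ab local_atE by blast
    have o: "openin (topo X) (U \<inter> V)" "U \<inter> V \<noteq> {}" "x \<in> U \<inter> V" using U V by auto
    then show ?thesis using sec_in_mono[OF U(1) o(1,2)] sec_in_mono[OF V(1) o(1,2)] U V by blast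
  qed
  show ?thesis
  proof (rule K.subringI)
    show "local_at X x \<subseteq> carrier (funfield X)" using sec_in_carrier by (auto elim!: local_atE)
    show "\<one>\<^bsub>funfield X\<^esub> \<in> local_at X x"
      using local_atI[OF openin_topspace assms] subringE(3)[OF sec_in_subring[OF openin_topspace topspace_nonempty]]
      by blast
    fix a b assume a: "a \<in> local_at X x"
    then obtain U where U: "openin (topo X) U" "x \<in> U" "a \<in> sec_in X U" using local_atE by blast
    then show "\<ominus>\<^bsub>funfield X\<^esub> a \<in> local_at X x"
      using local_atI[OF U(1,2)] subringE(5)[OF sec_in_subring[OF U(1)]] by blast
    assume b: "b \<in> local_at X x"
    then obtain W where W: "openin (topo X) W" "x \<in> W" "a \<in> sec_in X W" "b \<in> sec_in X W"
      using two a by blast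
    then show "a \<otimes>\<^bsub>funfield X\<^esub> b \<in> local_at X x" "a \<oplus>\<^bsub>funfield X\<^esub> b \<in> local_at X x"
      using local_atI[OF W(1,2)] subringE(6,7)[OF sec_in_subring[OF W(1)]] by blast+
  qed
qed

lemma local_at_generic: "local_at X (generic_point X) = carrier (funfield X)"
proof
  show "local_at X (generic_point X) \<subseteq> carrier (funfield X)"
    using subringE(1)[OF local_at_subring[OF generic_in_topspace]] .
  show "carrier (funfield X) \<subseteq> local_at X (generic_point X)"
    using funfield_elem local_atI by blast
qed

lemma mem_max_ideal:
  "a \<in> \<mm> x \<longleftrightarrow> a \<in> local_at X x \<and> \<not> (\<exists>b\<in>local_at X x. a \<otimes>\<^bsub>funfield X\<^esub> b = \<one>\<^bsub>funfield X\<^esub>)"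
  if "x \<in> topspace (topo X)"
proof -
  have "b \<otimes>\<^bsub>funfield X\<^esub> a = a \<otimes>\<^bsub>funfield X\<^esub> b" if "a \<in> local_at X x" "b \<in> local_at X x" for b
    using that subringE(1)[OF local_at_subring[OF \<open>x \<in> topspace (topo X)\<close>]] K.m_comm by blast
  then show ?thesis by (auto simp: max_ideal_def local_ring_at_def Units_def)
qed

lemma max_idealD: "a \<in> \<mm> x \<Longrightarrow> a \<in> local_at X x"
  by (simp add: max_ideal_def local_ring_at_def)

text \<open>Joins the two descriptions of vanishing at \<open>x\<close>, one in the stalk at
  \<open>x\<close> and one inside the function field. The middle term is the absence of an inverse
  of \<open>s\<close> over any neighbourhood of \<open>x\<close>, which is compared with each side
  in turn.\<close>

lemma mem_point_ideal_iff:
  assumes V: "openin (topo X) V" "x \<in> V" and s: "s \<in> carrier (sec X V)"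
  shows "s \<in> point_ideal X V x \<longleftrightarrow> germ_of X (generic_point X) V s \<in> \<mm> x"
proof -
  let ?g = "generic_point X"
  have x: "x \<in> topspace (topo X)" using V openin_subset by blast
  have sL: "germ_of X ?g V s \<in> local_at X x" using local_atI[OF V] s unfolding sec_in_def by blast
  have C: "cring (stalk X x)" using stalk_local[OF x] by (simp add: local_ring_def)
  interpret S: cring "stalk X x" by (rule C)
  have "s \<in> point_ideal X V x \<longleftrightarrow> germ_of X x V s \<notin> Units (stalk X x)"
    using s stalk_carrierI[OF V s] by (simp add: point_ideal_def max_ideal_def)
  also have "\<dots> \<longleftrightarrow> \<not> (\<exists>b\<in>carrier (stalk X x). germ_of X x V s \<otimes>\<^bsub>stalk X x\<^esub> b = \<one>\<^bsub>stalk X x\<^esub>)"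
    using stalk_carrierI[OF V s] S.m_comm by (auto simp: Units_def)
  also have "(\<exists>b\<in>carrier (stalk X x). germ_of X x V s \<otimes>\<^bsub>stalk X x\<^esub> b = \<one>\<^bsub>stalk X x\<^esub>)
     \<longleftrightarrow> (\<exists>W t. openin (topo X) W \<and> x \<in> W \<and> W \<subseteq> V \<and> t \<in> carrier (sec X W) \<and>
            res X V W s \<otimes>\<^bsub>sec X W\<^esub> t = \<one>\<^bsub>sec X W\<^esub>)" (is "?A \<longleftrightarrow> ?B")
  proof
    assume ?A
    then obtain b where b: "b \<in> carrier (stalk X x)" "germ_of X x V s \<otimes>\<^bsub>stalk X x\<^esub> b = \<one>\<^bsub>stalk X x\<^esub>" by blast
    obtain U t where U: "openin (topo X) U" "x \<in> U" "t \<in> carrier (sec X U)" "b = germ_of X x U t"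
      using stalk_carrierE[OF b(1)] by blast
    have o: "openin (topo X) (U \<inter> V)" "x \<in> U \<inter> V" "U \<inter> V \<subseteq> U" "U \<inter> V \<subseteq> V" using U V by auto
    interpret W: cring "sec X (U \<inter> V)" using sec_cring o by blast
    have c: "res X V (U \<inter> V) s \<in> carrier (sec X (U \<inter> V))" "res X U (U \<inter> V) t \<in> carrier (sec X (U \<inter> V))"
      using res_closed[OF V(1) o(1,4) s] res_closed[OF U(1) o(1,3) U(3)] by auto
    have "germ_of X x (U \<inter> V) (res X V (U \<inter> V) s \<otimes>\<^bsub>sec X (U \<inter> V)\<^esub> res X U (U \<inter> V) t)
       = germ_of X x (U \<inter> V) \<one>\<^bsub>sec X (U \<inter> V)\<^esub>"
      using b(2) germ_of_res[OF V(1) o(1,4,2) s] germ_of_res[OF U(1) o(1,3,2) U(3)]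
      by (simp add: stalk_mult[OF o(1,2) c, symmetric] stalk_one[OF o(1,2), symmetric] U(4))
    then obtain W where W: "openin (topo X) W" "x \<in> W" "W \<subseteq> (U \<inter> V) \<inter> (U \<inter> V)"
      "res X (U \<inter> V) W (res X V (U \<inter> V) s \<otimes>\<^bsub>sec X (U \<inter> V)\<^esub> res X U (U \<inter> V) t)
        = res X (U \<inter> V) W \<one>\<^bsub>sec X (U \<inter> V)\<^esub>"
      using c germ_of_eq_iff[OF o(1,2) _ o(1,2)] by (metis W.m_closed W.one_closed)
    have WUV: "W \<subseteq> U \<inter> V" using W by blast
    note h = res_hom[OF o(1) W(1) WUV]
    have "res X V W s \<otimes>\<^bsub>sec X W\<^esub> res X (U \<inter> V) W (res X U (U \<inter> V) t) = \<one>\<^bsub>sec X W\<^esub>"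
      using W(4) by (simp add: ring_hom_mult[OF h c] ring_hom_one[OF h] res_res[OF V(1) o(1) W(1) WUV o(4) s])
    then show ?B using W(1,2) WUV res_closed[OF o(1) W(1) WUV c(2)] by blast
  next
    assume ?B
    then obtain W t where W: "openin (topo X) W" "x \<in> W" "W \<subseteq> V" "t \<in> carrier (sec X W)"
      "res X V W s \<otimes>\<^bsub>sec X W\<^esub> t = \<one>\<^bsub>sec X W\<^esub>" by blast
    have "germ_of X x V s \<otimes>\<^bsub>stalk X x\<^esub> germ_of X x W t = \<one>\<^bsub>stalk X x\<^esub>"
      unfolding germ_of_res[OF V(1) W(1,3,2) s, symmetric]
        stalk_mult[OF W(1,2) res_closed[OF V(1) W(1,3) s] W(4)] W(5) stalk_one[OF W(1,2)] ..
    then show ?A using stalk_carrierI[OF W(1,2,4)] by blast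
  qed
  also have "?B \<longleftrightarrow> (\<exists>b\<in>local_at X x. germ_of X ?g V s \<otimes>\<^bsub>funfield X\<^esub> b = \<one>\<^bsub>funfield X\<^esub>)" (is "_ \<longleftrightarrow> ?C")
  proof
    assume ?B
    then obtain W t where W: "openin (topo X) W" "x \<in> W" "W \<subseteq> V" "t \<in> carrier (sec X W)"
      "res X V W s \<otimes>\<^bsub>sec X W\<^esub> t = \<one>\<^bsub>sec X W\<^esub>" by blast
    have g: "?g \<in> W" using generic_point_in(1) W(1,2) by blast
    have "germ_of X ?g V s \<otimes>\<^bsub>funfield X\<^esub> germ_of X ?g W t = \<one>\<^bsub>funfield X\<^esub>"
      unfolding funfield_def germ_of_res[OF V(1) W(1,3) g s, symmetric]
        stalk_mult[OF W(1) g res_closed[OF V(1) W(1,3) s] W(4)] W(5) stalk_one[OF W(1) g] ..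
    then show ?C using local_atI[OF W(1,2)] W(4) unfolding sec_in_def by blast
  next
    assume ?C
    then obtain U t where U: "openin (topo X) U" "x \<in> U" "t \<in> carrier (sec X U)"
      and e: "germ_of X ?g V s \<otimes>\<^bsub>funfield X\<^esub> germ_of X ?g U t = \<one>\<^bsub>funfield X\<^esub>"
      unfolding local_at_def sec_in_def by blast
    have o: "openin (topo X) (U \<inter> V)" "x \<in> U \<inter> V" "U \<inter> V \<subseteq> U" "U \<inter> V \<subseteq> V" "U \<inter> V \<noteq> {}" using U V by auto
    have g: "?g \<in> U \<inter> V" using generic_point_in(1) o(1,5) by blast
    interpret W: cring "sec X (U \<inter> V)" using sec_cring o by blast
    have c: "res X V (U \<inter> V) s \<in> carrier (sec X (U \<inter> V))" "res X U (U \<inter> V) t \<in> carrier (sec X (U \<inter> V))"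
      using res_closed[OF V(1) o(1,4) s] res_closed[OF U(1) o(1,3) U(3)] by auto
    have "germ_of X ?g (U \<inter> V) (res X V (U \<inter> V) s \<otimes>\<^bsub>sec X (U \<inter> V)\<^esub> res X U (U \<inter> V) t)
       = germ_of X ?g (U \<inter> V) \<one>\<^bsub>sec X (U \<inter> V)\<^esub>"
      using e germ_of_res[OF V(1) o(1,4) g s] germ_of_res[OF U(1) o(1,3) g U(3)]
      by (simp add: stalk_mult[OF o(1) g c, symmetric] stalk_one[OF o(1) g, symmetric] funfield_def)
    then have "res X V (U \<inter> V) s \<otimes>\<^bsub>sec X (U \<inter> V)\<^esub> res X U (U \<inter> V) t = \<one>\<^bsub>sec X (U \<inter> V)\<^esub>"
      using germ_generic_eq_iff[OF o(1,5)] c by simp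
    then show ?B using o(1,2,4) c(2) by blast
  qed
  finally show ?thesis using mem_max_ideal[OF x] sL by blast
qed

end

section \<open>Affine opens inside the function field\<close>

context integral_scheme_space
begin

abbreviation "K \<equiv> funfield X"

lemma local_at_carrier: "x \<in> topspace (topo X) \<Longrightarrow> a \<in> local_at X x \<Longrightarrow> a \<in> carrier K"
  using subringE(1)[OF local_at_subring] by (rule subsetD)

lemmas local_at_zero = subringE(2)[OF local_at_subring]
  and local_at_one = subringE(3)[OF local_at_subring]
  and local_at_minus = subringE(5)[OF local_at_subring]
  and local_at_mult = subringE(6)[OF local_at_subring]
  and local_at_add = subringE(7)[OF local_at_subring]

lemma subring_pow_closed:
  assumes "subring R K" "a \<in> R"
  shows "a [^]\<^bsub>K\<^esub> (n::nat) \<in> R"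
  using assms by (induction n) (auto intro: subringE(3,6))

section \<open>Maximal ideals of the local rings inside the function field\<close>

lemma local_at_unit:
  assumes "x \<in> topspace (topo X)" "a \<in> local_at X x" "a \<notin> \<mm> x"
  obtains b where "b \<in> local_at X x" "a \<otimes>\<^bsub>K\<^esub> b = \<one>\<^bsub>K\<^esub>"
  using assms by (auto simp: mem_max_ideal)

lemma one_notin_max_ideal:
  assumes "x \<in> topspace (topo X)" shows "\<one>\<^bsub>K\<^esub> \<notin> \<mm> x"
proof -
  have "\<one>\<^bsub>K\<^esub> \<in> local_at X x" "\<one>\<^bsub>K\<^esub> \<otimes>\<^bsub>K\<^esub> \<one>\<^bsub>K\<^esub> = \<one>\<^bsub>K\<^esub>" using local_at_one[OF assms] by auto
  then show ?thesis unfolding mem_max_ideal[OF assms] by blast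
qed

lemma zero_in_max_ideal:
  assumes "x \<in> topspace (topo X)" shows "\<zero>\<^bsub>K\<^esub> \<in> \<mm> x"
  using local_at_zero[OF assms] local_at_carrier[OF assms] unfolding mem_max_ideal[OF assms] by auto

lemma max_ideal_mult:
  assumes x: "x \<in> topspace (topo X)" and ab: "a \<in> \<mm> x" "b \<in> local_at X x"
  shows "b \<otimes>\<^bsub>K\<^esub> a \<in> \<mm> x"
proof -
  have a: "a \<in> local_at X x" using ab(1) by (rule max_idealD)
  have c: "a \<in> carrier K" "b \<in> carrier K" using a ab local_at_carrier[OF x] by auto
  have False if u: "u \<in> local_at X x" "b \<otimes>\<^bsub>K\<^esub> a \<otimes>\<^bsub>K\<^esub> u = \<one>\<^bsub>K\<^esub>" for u
  proof -
    have uc: "u \<in> carrier K" using u local_at_carrier[OF x] by auto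
    have "a \<otimes>\<^bsub>K\<^esub> (b \<otimes>\<^bsub>K\<^esub> u) = \<one>\<^bsub>K\<^esub>" using u(2) c uc by (simp add: K.m_ac)
    moreover have "b \<otimes>\<^bsub>K\<^esub> u \<in> local_at X x" using local_at_mult[OF x ab(2) u(1)] .
    ultimately show False using ab(1) unfolding mem_max_ideal[OF x] by blast
  qed
  then show ?thesis using local_at_mult[OF x ab(2) a] unfolding mem_max_ideal[OF x] by blast
qed

lemma max_ideal_prime:
  assumes x: "x \<in> topspace (topo X)" and ab: "a \<in> local_at X x" "b \<in> local_at X x" "a \<otimes>\<^bsub>K\<^esub> b \<in> \<mm> x"
    and a: "a \<notin> \<mm> x"
  shows "b \<in> \<mm> x"
proof -
  obtain u where u: "u \<in> local_at X x" "a \<otimes>\<^bsub>K\<^esub> u = \<one>\<^bsub>K\<^esub>" using local_at_unit[OF x ab(1) a] by blast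
  have c: "a \<in> carrier K" "b \<in> carrier K" "u \<in> carrier K" using ab u local_at_carrier[OF x] by auto
  have "u \<otimes>\<^bsub>K\<^esub> (a \<otimes>\<^bsub>K\<^esub> b) = (a \<otimes>\<^bsub>K\<^esub> u) \<otimes>\<^bsub>K\<^esub> b" using c by (simp add: K.m_ac)
  then have "u \<otimes>\<^bsub>K\<^esub> (a \<otimes>\<^bsub>K\<^esub> b) = b" using c u(2) by simp
  then show ?thesis using max_ideal_mult[OF x ab(3) u(1)] by simp
qed

text \<open>Carries localization at \<open>h\<close> over to the function field, where no
  restriction maps remain. Fractions at a point and the extension of Cartier maps to smaller open
  sets are both derived from this form.\<close>

lemma affine_basis:
  assumes V: "affine_open X V" "x \<in> V" and W: "openin (topo X) W" "x \<in> W"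
  obtains h D u where "h \<in> sec_in X V" "h \<notin> \<mm> x" "openin (topo X) D" "x \<in> D" "D \<subseteq> W" "D \<subseteq> V"
    "u \<in> sec_in X D" "h \<otimes>\<^bsub>K\<^esub> u = \<one>\<^bsub>K\<^esub>"
    "\<And>k. k \<in> sec_in X D \<Longrightarrow> \<exists>n::nat. k \<otimes>\<^bsub>K\<^esub> h [^]\<^bsub>K\<^esub> n \<in> sec_in X V"
proof -
  let ?g = "generic_point X"
  obtain h where h: "h \<in> carrier (sec X V)" "x \<in> basic_open X V h" "basic_open X V h \<subseteq> W"
    using basic_open_basis[OF V(1) W V(2)] by blast
  define D where "D = basic_open X V h"
  have oV: "openin (topo X) V" "V \<noteq> {}" using V affine_open_openin by auto
  have oD: "openin (topo X) D" "x \<in> D" "D \<subseteq> V" "D \<subseteq> W" "D \<noteq> {}"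
    using openin_basic_open[OF V(1) h(1)] h basic_open_subset unfolding D_def by auto
  have g: "?g \<in> D" using generic_point_in(1)[OF oD(1,5)] .
  interpret hV: ring_hom_ring "sec X V" K "germ_of X ?g V" by (rule generic_germ_ring_hom[OF oV])
  interpret hD: ring_hom_ring "sec X D" K "germ_of X ?g D" by (rule generic_germ_ring_hom[OF oD(1,5)])
  have L: "is_localization_away (sec X V) h (sec X D) (res X V D)"
    unfolding D_def by (rule localization_basic_open[OF V(1) h(1)])
  have res: "germ_of X ?g D (res X V D b) = germ_of X ?g V b" if "b \<in> carrier (sec X V)" for b
    by (rule germ_of_res[OF oV(1) oD(1,3) g that])
  have hc: "res X V D h \<in> carrier (sec X D)" using res_closed[OF oV(1) oD(1,3) h(1)] .
  have "res X V D h \<in> Units (sec X D)" using L unfolding is_localization_away_def by blast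
  then obtain u where u: "u \<in> carrier (sec X D)" "res X V D h \<otimes>\<^bsub>sec X D\<^esub> u = \<one>\<^bsub>sec X D\<^esub>"
    using hD.R.Units_r_inv_ex by blast
  show ?thesis
  proof (rule that[of "germ_of X ?g V h" D "germ_of X ?g D u"])
    show "germ_of X ?g V h \<in> sec_in X V" "germ_of X ?g D u \<in> sec_in X D"
      using h(1) u(1) unfolding sec_in_def by auto
    show "germ_of X ?g V h \<notin> \<mm> x"
      using h(2) mem_point_ideal_iff[OF oV(1) V(2) h(1)] by (simp add: basic_open_def)
    show "germ_of X ?g V h \<otimes>\<^bsub>K\<^esub> germ_of X ?g D u = \<one>\<^bsub>K\<^esub>"
      using arg_cong[OF u(2), of "germ_of X ?g D"] u(1) hc by (simp add: res h(1))
    fix k assume "k \<in> sec_in X D"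
    then obtain b where b: "b \<in> carrier (sec X D)" "k = germ_of X ?g D b" unfolding sec_in_def by blast
    obtain a n where a: "a \<in> carrier (sec X V)" "b \<otimes>\<^bsub>sec X D\<^esub> res X V D h [^]\<^bsub>sec X D\<^esub> (n::nat) = res X V D a"
      using L b(1) unfolding is_localization_away_def by blast
    have "k \<otimes>\<^bsub>K\<^esub> germ_of X ?g V h [^]\<^bsub>K\<^esub> n = germ_of X ?g V a"
      using arg_cong[OF a(2), of "germ_of X ?g D"] b(1) hc
      by (simp add: hD.hom_nat_pow res h(1) a(1) flip: b(2))
    then show "\<exists>n::nat. k \<otimes>\<^bsub>K\<^esub> germ_of X ?g V h [^]\<^bsub>K\<^esub> n \<in> sec_in X V" using a(1) unfolding sec_in_def by auto
  qed (use oD in auto)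
qed

section \<open>Fractions and primes over an affine open set\<close>

lemma affine_sec_in_subring: "affine_open X V \<Longrightarrow> x \<in> V \<Longrightarrow> subring (sec_in X V) K"
  using sec_in_subring affine_open_openin by blast

lemma affine_sec_in_local: "affine_open X V \<Longrightarrow> x \<in> V \<Longrightarrow> a \<in> sec_in X V \<Longrightarrow> a \<in> local_at X x"
  using local_atI affine_open_openin by blast

lemma affine_topspace: "affine_open X V \<Longrightarrow> x \<in> V \<Longrightarrow> x \<in> topspace (topo X)"
  using affine_open_openin openin_subset by blast

lemma max_ideal_pow_notin:
  assumes "x \<in> topspace (topo X)" "a \<in> local_at X x" "a \<notin> \<mm> x"
  shows "a [^]\<^bsub>K\<^esub> (n::nat) \<notin> \<mm> x"
proof (induction n)
  case 0
  then show ?case using one_notin_max_ideal[OF assms(1)] by simp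
next
  case (Suc n)
  then show ?case
    using max_ideal_prime[OF assms(1) subring_pow_closed[OF local_at_subring[OF assms(1)] assms(2)] assms(2)] assms(3)
    by auto
qed

text \<open>A neighbourhood on which \<open>k\<close> is regular shrinks to the basic open set of
  some \<open>h\<close>. The power of \<open>h\<close> that clears the denominator stays outside the
  maximal ideal by primality.\<close>

lemma affine_fraction:
  assumes V: "affine_open X V" "x \<in> V" and k: "k \<in> local_at X x"
  obtains s where "s \<in> sec_in X V" "s \<notin> \<mm> x" "k \<otimes>\<^bsub>K\<^esub> s \<in> sec_in X V"
proof -
  have x: "x \<in> topspace (topo X)" using affine_topspace V .
  obtain W where W: "openin (topo X) W" "x \<in> W" "k \<in> sec_in X W" using k local_atE by blast
  obtain h D where h: "h \<in> sec_in X V" "h \<notin> \<mm> x" and D: "openin (topo X) D" "x \<in> D" "D \<subseteq> W"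
    and kD: "\<And>k. k \<in> sec_in X D \<Longrightarrow> \<exists>n::nat. k \<otimes>\<^bsub>K\<^esub> h [^]\<^bsub>K\<^esub> n \<in> sec_in X V"
    using affine_basis[OF V W(1,2)] by metis
  have "D \<noteq> {}" using D by blast
  then have "k \<in> sec_in X D" using sec_in_mono[OF W(1) D(1) _ D(3)] W(3) by blast
  then obtain n :: nat where n: "k \<otimes>\<^bsub>K\<^esub> h [^]\<^bsub>K\<^esub> n \<in> sec_in X V" using kD by blast
  then show ?thesis
    using that[OF _ _ n] max_ideal_pow_notin[OF x affine_sec_in_local[OF V h(1)] h(2)]
      subring_pow_closed[OF affine_sec_in_subring[OF V] h(1)] by blast
qed

lemma sec_in_max_ideal:
  assumes "affine_open X V" "x \<in> V"
  shows "sec_in X V \<inter> \<mm> x = germ_of X (generic_point X) V ` point_ideal X V x"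
  using mem_point_ideal_iff[OF affine_open_openin[OF assms(1)] assms(2)]
  by (auto simp: sec_in_def point_ideal_def)

text \<open>Sums of non-units are non-units because \<open>point_ideal\<close> is an ideal of the
  sections over \<open>V\<close>. Denominators outside \<open>\<mm> x\<close> bring both summands
  into these sections, and primality cancels them afterwards.\<close>

lemma max_ideal_add:
  assumes x: "x \<in> topspace (topo X)" and ab: "a \<in> \<mm> x" "b \<in> \<mm> x"
  shows "a \<oplus>\<^bsub>K\<^esub> b \<in> \<mm> x"
proof -
  obtain V where V: "affine_open X V" "x \<in> V" using affine_cover x by blast
  have oV: "openin (topo X) V" "V \<noteq> {}" using V affine_open_openin by auto
  interpret hV: ring_hom_ring "sec X V" K "germ_of X (generic_point X) V" by (rule generic_germ_ring_hom[OF oV])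
  interpret P: primeideal "point_ideal X V x" "sec X V" by (rule point_ideal_prime[OF V])
  have add: "c \<oplus>\<^bsub>K\<^esub> d \<in> \<mm> x" if cd: "c \<in> sec_in X V" "c \<in> \<mm> x" "d \<in> sec_in X V" "d \<in> \<mm> x" for c d
  proof -
    obtain c' d' where c': "c' \<in> point_ideal X V x" "c = germ_of X (generic_point X) V c'"
      "d' \<in> point_ideal X V x" "d = germ_of X (generic_point X) V d'"
      using IntI[OF cd(1,2)] IntI[OF cd(3,4)] unfolding sec_in_max_ideal[OF V] by (elim imageE) simp
    have "c \<oplus>\<^bsub>K\<^esub> d = germ_of X (generic_point X) V (c' \<oplus>\<^bsub>sec X V\<^esub> d')"
      using c' P.a_subset by (simp add: subset_iff)
    also have "\<dots> \<in> sec_in X V \<inter> \<mm> x"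
      unfolding sec_in_max_ideal[OF V] by (rule imageI[OF P.a_closed[OF c'(1,3)]])
    finally show ?thesis by blast
  qed
  note L = max_idealD[OF ab(1)] max_idealD[OF ab(2)]
  note sub = subringE[OF affine_sec_in_subring[OF V]] and loc = affine_sec_in_local[OF V]
  obtain s where s: "s \<in> sec_in X V" "s \<notin> \<mm> x" "a \<otimes>\<^bsub>K\<^esub> s \<in> sec_in X V" using affine_fraction[OF V L(1)] .
  obtain t where t: "t \<in> sec_in X V" "t \<notin> \<mm> x" "b \<otimes>\<^bsub>K\<^esub> t \<in> sec_in X V" using affine_fraction[OF V L(2)] .
  have sL: "s \<in> local_at X x" "t \<in> local_at X x" using s t loc by auto
  have c: "a \<in> carrier K" "b \<in> carrier K" "s \<in> carrier K" "t \<in> carrier K"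
    using L sL local_at_carrier[OF x] by auto
  have st: "s \<otimes>\<^bsub>K\<^esub> t \<in> local_at X x" "s \<otimes>\<^bsub>K\<^esub> t \<notin> \<mm> x"
    using sub(6) s t loc max_ideal_prime[OF x sL] by auto
  have m: "t \<otimes>\<^bsub>K\<^esub> (s \<otimes>\<^bsub>K\<^esub> a) \<in> \<mm> x" "s \<otimes>\<^bsub>K\<^esub> (t \<otimes>\<^bsub>K\<^esub> b) \<in> \<mm> x"
    using max_ideal_mult[OF x] ab sL by auto
  have "t \<otimes>\<^bsub>K\<^esub> (s \<otimes>\<^bsub>K\<^esub> a) \<in> sec_in X V" "s \<otimes>\<^bsub>K\<^esub> (t \<otimes>\<^bsub>K\<^esub> b) \<in> sec_in X V"
    using sub(6) s t K.m_comm c by auto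
  then have "t \<otimes>\<^bsub>K\<^esub> (s \<otimes>\<^bsub>K\<^esub> a) \<oplus>\<^bsub>K\<^esub> s \<otimes>\<^bsub>K\<^esub> (t \<otimes>\<^bsub>K\<^esub> b) \<in> \<mm> x" using add m by blast
  moreover have "t \<otimes>\<^bsub>K\<^esub> (s \<otimes>\<^bsub>K\<^esub> a) \<oplus>\<^bsub>K\<^esub> s \<otimes>\<^bsub>K\<^esub> (t \<otimes>\<^bsub>K\<^esub> b) = (s \<otimes>\<^bsub>K\<^esub> t) \<otimes>\<^bsub>K\<^esub> (a \<oplus>\<^bsub>K\<^esub> b)"
    using c by (simp add: K.r_distr K.m_ac)
  ultimately show ?thesis
    using max_ideal_prime[OF x st(1) local_at_add[OF x L] _ st(2)] by simp
qed

lemma affine_point_unique: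
  assumes "affine_open X V" "x \<in> V" "y \<in> V" "sec_in X V \<inter> \<mm> x = sec_in X V \<inter> \<mm> y"
  shows "x = y"
proof (rule point_ideal_inj[OF assms(1-3)])
  have inj: "inj_on (germ_of X (generic_point X) V) (carrier (sec X V))"
    using germ_generic_eq_iff[OF affine_open_openin[OF assms(1)]] assms(2) by (auto intro!: inj_onI)
  show "point_ideal X V x = point_ideal X V y"
    using assms(4) sec_in_max_ideal[OF assms(1)] assms(2,3) inj_on_image_eq_iff[OF inj]
    by (simp add: point_ideal_def)
qed

text \<open>Both the center of a valuation and the splitting prime arise as subsets of the function
  field; this lemma turns such a subset into a point.\<close>

lemma affine_prime_point:
  assumes V: "affine_open X V" "V \<noteq> {}"
    and Q: "Q \<subseteq> sec_in X V" "\<zero>\<^bsub>K\<^esub> \<in> Q" "\<one>\<^bsub>K\<^esub> \<notin> Q"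
      "\<And>a b. a \<in> Q \<Longrightarrow> b \<in> Q \<Longrightarrow> a \<oplus>\<^bsub>K\<^esub> b \<in> Q"
      "\<And>a b. a \<in> Q \<Longrightarrow> b \<in> sec_in X V \<Longrightarrow> b \<otimes>\<^bsub>K\<^esub> a \<in> Q"
      "\<And>a b. a \<in> sec_in X V \<Longrightarrow> b \<in> sec_in X V \<Longrightarrow> a \<otimes>\<^bsub>K\<^esub> b \<in> Q \<Longrightarrow> a \<in> Q \<or> b \<in> Q"
  obtains z where "z \<in> V" "sec_in X V \<inter> \<mm> z = Q"
proof -
  let ?\<gamma> = "germ_of X (generic_point X) V"
  have oV: "openin (topo X) V" "V \<noteq> {}" using V affine_open_openin by auto
  interpret hV: ring_hom_ring "sec X V" K ?\<gamma> by (rule generic_germ_ring_hom[OF oV])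
  note cr = sec_cring[OF oV(1)]
  define P where "P = {s \<in> carrier (sec X V). ?\<gamma> s \<in> Q}"
  have A: "?\<gamma> s \<in> sec_in X V" if "s \<in> carrier (sec X V)" for s using that unfolding sec_in_def by blast
  have mult: "b \<otimes>\<^bsub>sec X V\<^esub> a \<in> P" if "a \<in> P" "b \<in> carrier (sec X V)" for a b
    using that Q(5)[of "?\<gamma> a" "?\<gamma> b"] A by (auto simp: P_def)
  have neg: "\<ominus>\<^bsub>sec X V\<^esub> a \<in> P" if "a \<in> P" for a
  proof -
    have ac: "a \<in> carrier (sec X V)" using that by (simp add: P_def)
    have "(\<ominus>\<^bsub>sec X V\<^esub> \<one>\<^bsub>sec X V\<^esub>) \<otimes>\<^bsub>sec X V\<^esub> a \<in> P" by (rule mult[OF that]) simp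
    then show ?thesis using ac hV.R.l_minus by simp
  qed
  have "primeideal P (sec X V)"
  proof (rule primeidealI[OF _ cr])
    show "ideal P (sec X V)"
    proof (rule idealI[OF hV.R.ring_axioms])
      show "subgroup P (add_monoid (sec X V))"
        using neg Q(2,4) by (intro hV.R.add.subgroupI) (auto simp: P_def a_inv_def)
    qed (use mult in \<open>auto simp: P_def cring.cring_simprules(14)[OF cr]\<close>)
    have "\<one>\<^bsub>sec X V\<^esub> \<notin> P" using Q(3) by (simp add: P_def)
    then show "carrier (sec X V) \<noteq> P" using hV.R.one_closed by blast
    show "a \<in> P \<or> b \<in> P" if "a \<in> carrier (sec X V)" "b \<in> carrier (sec X V)" "a \<otimes>\<^bsub>sec X V\<^esub> b \<in> P" for a b
      using that Q(6)[of "?\<gamma> a" "?\<gamma> b"] A by (auto simp: P_def)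
  qed
  then obtain z where z: "z \<in> V" "point_ideal X V z = P" using prime_is_point_ideal[OF V(1)] by blast
  have "?\<gamma> ` P = Q" using Q(1) unfolding P_def sec_in_def by blast
  then show ?thesis using that[OF z(1)] sec_in_max_ideal[OF V(1) z(1)] z(2) by simp
qed

section \<open>Specialization and generization\<close>

lemma local_at_generization:
  assumes "z \<in> topo X closure_of {x}"
  shows "local_at X z \<subseteq> local_at X x"
proof
  fix k assume "k \<in> local_at X z"
  then obtain U where U: "openin (topo X) U" "z \<in> U" "k \<in> sec_in X U" using local_atE by blast
  have "x \<in> U" using assms U(1,2) by (auto simp: in_closure_of)
  then show "k \<in> local_at X x" using local_atI U by blast
qed

text \<open>An inverse of \<open>a\<close> in the local ring at \<open>z\<close> would also be an
  inverse at the generization \<open>x\<close>.\<close>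

lemma max_ideal_specialization:
  assumes z: "z \<in> topo X closure_of {x}" and x: "x \<in> topspace (topo X)"
    and a: "a \<in> \<mm> x" "a \<in> local_at X z"
  shows "a \<in> \<mm> z"
proof -
  have "z \<in> topspace (topo X)" using z by (simp add: in_closure_of)
  then show ?thesis
    using a local_at_generization[OF z] mem_max_ideal[OF x, of a] mem_max_ideal[of z a] by blast
qed

lemma max_ideal_generic: "\<mm> (generic_point X) = {\<zero>\<^bsub>K\<^esub>}"
proof -
  have "a = \<zero>\<^bsub>K\<^esub>" if a: "a \<in> \<mm> (generic_point X)" for a
  proof (rule ccontr)
    assume "a \<noteq> \<zero>\<^bsub>K\<^esub>"
    moreover have "a \<in> carrier K" using max_idealD[OF a] local_at_generic by blast
    ultimately have "a \<in> Units K" using K.field_Units by blast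
    then obtain b where "b \<in> carrier K" "a \<otimes>\<^bsub>K\<^esub> b = \<one>\<^bsub>K\<^esub>" using K.Units_r_inv_ex by blast
    then show False using a unfolding mem_max_ideal[OF generic_in_topspace] local_at_generic by blast
  qed
  then show ?thesis using zero_in_max_ideal[OF generic_in_topspace] by blast
qed

end

section \<open>Valuations and centers\<close>

lemma E_quot_one:
  assumes "v (\<psi> k) = 0" shows "E_quot p e k \<psi> v = v k / ereal (real p ^ e - 1)"
  using assms by (simp add: E_quot_def)

context integral_scheme_space
begin

section \<open>Valuations of the function field and uniqueness of the center\<close>

lemma valuation_one:
  assumes "is_valuation K v" shows "v \<one>\<^bsub>K\<^esub> = 0"
proof -
  have fin: "\<bar>v \<one>\<^bsub>K\<^esub>\<bar> \<noteq> \<infinity>" using assms K.one_not_zero by (auto simp: is_valuation_def)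
  have "v (\<one>\<^bsub>K\<^esub> \<otimes>\<^bsub>K\<^esub> \<one>\<^bsub>K\<^esub>) = v \<one>\<^bsub>K\<^esub> + v \<one>\<^bsub>K\<^esub>"
    using assms K.one_closed unfolding is_valuation_def by blast
  then have "v \<one>\<^bsub>K\<^esub> = v \<one>\<^bsub>K\<^esub> + v \<one>\<^bsub>K\<^esub>" by simp
  then show ?thesis using fin by (cases "v \<one>\<^bsub>K\<^esub>") auto
qed

lemma valuation_mult:
  "is_valuation K v \<Longrightarrow> a \<in> carrier K \<Longrightarrow> b \<in> carrier K \<Longrightarrow> v (a \<otimes>\<^bsub>K\<^esub> b) = v a + v b"
  by (simp add: is_valuation_def)

lemma valuation_add:
  assumes "is_valuation K v" "a \<in> carrier K" "b \<in> carrier K"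
  shows "min (v a) (v b) \<le> v (a \<oplus>\<^bsub>K\<^esub> b)"
  using assms by (simp add: is_valuation_def)

lemma dominates_local:
  "val_dominates K (local_at X x) v \<longleftrightarrow> (\<forall>a\<in>local_at X x. 0 \<le> v a) \<and> (\<forall>a\<in>\<mm> x. 0 < v a)"
  by (simp add: val_dominates_def local_ring_at_def)

text \<open>A unit and its inverse both have nonnegative value, and the two values add up to
  0.\<close>

lemma dominates_pos_iff:
  assumes v: "is_valuation K v" "val_dominates K (local_at X x) v" and x: "x \<in> topspace (topo X)"
    and a: "a \<in> local_at X x"
  shows "0 < v a \<longleftrightarrow> a \<in> \<mm> x"
proof
  show "a \<in> \<mm> x \<Longrightarrow> 0 < v a" using v(2) by (simp add: dominates_local)
  assume pos: "0 < v a"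
  show "a \<in> \<mm> x"
  proof (rule ccontr)
    assume "a \<notin> \<mm> x"
    then obtain b where b: "b \<in> local_at X x" "a \<otimes>\<^bsub>K\<^esub> b = \<one>\<^bsub>K\<^esub>" using local_at_unit[OF x a] by blast
    have "v a + v b = 0"
      using valuation_mult[OF v(1) local_at_carrier[OF x a] local_at_carrier[OF x b(1)]] b(2) valuation_one[OF v(1)] by simp
    moreover have "0 \<le> v b" using v(2) b(1) by (simp add: dominates_local)
    ultimately show False using pos by (cases "v a"; cases "v b") auto
  qed
qed

text \<open>One half of the valuative criterion. By separatedness the sections over
  \<open>U \<inter> V\<close> are sums of products of sections over \<open>U\<close> and
  \<open>V\<close>, so \<open>v\<close> is nonnegative on them. Those of positive value form a
  prime, hence a point \<open>z\<close> of \<open>U \<inter> V\<close>, which must be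
  \<open>x\<close> when seen in \<open>U\<close> and \<open>y\<close> when seen in
  \<open>V\<close>.\<close>

lemma center_unique:
  assumes sep: "separated_scheme X" and v: "is_valuation K v"
    and x: "x \<in> topspace (topo X)" "val_dominates K (local_at X x) v"
    and y: "y \<in> topspace (topo X)" "val_dominates K (local_at X y) v"
  shows "x = y"
proof -
  let ?g = "generic_point X"
  obtain U where U: "affine_open X U" "x \<in> U" using affine_cover x by blast
  obtain V where V: "affine_open X V" "y \<in> V" using affine_cover y by blast
  let ?W = "U \<inter> V"
  note oU = affine_open_openin[OF U(1)] and oV = affine_open_openin[OF V(1)]
  have ne: "U \<noteq> {}" "V \<noteq> {}" using U V by auto
  have neW: "?W \<noteq> {}" using opens_meet[OF oU ne(1) oV ne(2)] .
  have W: "affine_open X ?W" using sep U V by (auto simp: separated_scheme_def diagonal_closed_on_def)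
  note oW = affine_open_openin[OF W]
  have g: "?g \<in> ?W" using generic_point_in(1)[OF oW neW] .
  have sub: "?W \<subseteq> U" "?W \<subseteq> V" by auto
  have AW: "sec_in X U \<subseteq> sec_in X ?W" "sec_in X V \<subseteq> sec_in X ?W"
    using sec_in_mono[OF oU oW neW sub(1)] sec_in_mono[OF oV oW neW sub(2)] by auto
  interpret hW: ring_hom_ring "sec X ?W" K "germ_of X ?g ?W" by (rule generic_germ_ring_hom[OF oW neW])
  \<comment> \<open>Membership in the carrier is proved along with the bound, because the
    ultrametric inequality is available only for elements of the carrier.\<close>
  have nonneg: "0 \<le> v (germ_of X ?g ?W (\<Oplus>\<^bsub>sec X ?W\<^esub> i\<in>{..<n}. f i)) \<and> (\<Oplus>\<^bsub>sec X ?W\<^esub> i\<in>{..<n}. f i) \<in> carrier (sec X ?W)"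
    if "\<forall>i<n. f i \<in> carrier (sec X ?W) \<and> 0 \<le> v (germ_of X ?g ?W (f i))" for f and n :: nat
    using that
  proof (induction n)
    case 0
    then show ?case using v by (simp add: is_valuation_def)
  next
    case (Suc n)
    have 1: "(\<Oplus>\<^bsub>sec X ?W\<^esub> i\<in>{..<Suc n}. f i) = f n \<oplus>\<^bsub>sec X ?W\<^esub> (\<Oplus>\<^bsub>sec X ?W\<^esub> i\<in>{..<n}. f i)"
      unfolding lessThan_Suc using Suc.prems by (subst hW.R.finsum_insert) auto
    have 2: "f n \<in> carrier (sec X ?W)" "0 \<le> v (germ_of X ?g ?W (f n))" using Suc.prems by auto
    have 3: "0 \<le> v (germ_of X ?g ?W (\<Oplus>\<^bsub>sec X ?W\<^esub> i\<in>{..<n}. f i))"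
      "(\<Oplus>\<^bsub>sec X ?W\<^esub> i\<in>{..<n}. f i) \<in> carrier (sec X ?W)" using Suc by auto
    show ?case unfolding 1
      using order_trans[OF _ valuation_add[OF v hW.hom_closed[OF 2(1)] hW.hom_closed[OF 3(2)]], of 0] 2 3
      by (simp add: min_def split: if_splits)
  qed
  have vW: "0 \<le> v a" if a: "a \<in> sec_in X ?W" for a
  proof -
    obtain c where c: "c \<in> carrier (sec X ?W)" "a = germ_of X ?g ?W c" using a unfolding sec_in_def by blast
    have "diagonal_closed_on X U V" using sep U(1) V(1) by (simp add: separated_scheme_def)
    then obtain n :: nat and s t where st: "\<forall>i<n. s i \<in> carrier (sec X U) \<and> t i \<in> carrier (sec X V)"
      "c = (\<Oplus>\<^bsub>sec X ?W\<^esub> i\<in>{..<n}. res X U ?W (s i) \<otimes>\<^bsub>sec X ?W\<^esub> res X V ?W (t i))"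
      using c(1) unfolding diagonal_closed_on_def by blast
    have "res X U ?W (s i) \<otimes>\<^bsub>sec X ?W\<^esub> res X V ?W (t i) \<in> carrier (sec X ?W)
      \<and> 0 \<le> v (germ_of X ?g ?W (res X U ?W (s i) \<otimes>\<^bsub>sec X ?W\<^esub> res X V ?W (t i)))" if i: "i < n" for i
    proof -
      have r: "res X U ?W (s i) \<in> carrier (sec X ?W)" "res X V ?W (t i) \<in> carrier (sec X ?W)"
        using st(1) i res_closed[OF oU oW sub(1)] res_closed[OF oV oW sub(2)] by auto
      have e: "germ_of X ?g ?W (res X U ?W (s i)) = germ_of X ?g U (s i)"
        "germ_of X ?g ?W (res X V ?W (t i)) = germ_of X ?g V (t i)"
        using st(1) i germ_of_res[OF oU oW sub(1) g] germ_of_res[OF oV oW sub(2) g] by auto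
      have "germ_of X ?g U (s i) \<in> local_at X x" "germ_of X ?g V (t i) \<in> local_at X y"
        using st(1) i affine_sec_in_local[OF U] affine_sec_in_local[OF V] unfolding sec_in_def by auto
      then have "0 \<le> v (germ_of X ?g U (s i))" "0 \<le> v (germ_of X ?g V (t i))"
        using x(2) y(2) by (auto simp: dominates_local)
      then show ?thesis
        using r valuation_mult[OF v hW.hom_closed[OF r(1)] hW.hom_closed[OF r(2)]] by (simp add: e)
    qed
    then show ?thesis using nonneg[of n] st(2) c(2) by simp
  qed
  define Q where "Q = {a \<in> sec_in X ?W. 0 < v a}"
  note sW = subringE[OF sec_in_subring[OF oW neW]]
  note cW = sec_in_carrier[OF oW neW]
  obtain z where z: "z \<in> ?W" "sec_in X ?W \<inter> \<mm> z = Q"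
  proof (rule affine_prime_point[OF W neW, of Q])
    show "Q \<subseteq> sec_in X ?W" "\<zero>\<^bsub>K\<^esub> \<in> Q" "\<one>\<^bsub>K\<^esub> \<notin> Q"
      using sW(2,3) v valuation_one[OF v] by (auto simp: Q_def is_valuation_def)
    show "a \<oplus>\<^bsub>K\<^esub> b \<in> Q" if "a \<in> Q" "b \<in> Q" for a b
      using that sW(7) order.strict_trans2[OF _ valuation_add[OF v, of a b], of 0] cW by (auto simp: Q_def)
    show "b \<otimes>\<^bsub>K\<^esub> a \<in> Q" if "a \<in> Q" "b \<in> sec_in X ?W" for a b
      using that sW(6) valuation_mult[OF v, of b a] cW vW[of b]
      by (auto simp: Q_def intro: add_nonneg_pos)
    show "a \<in> Q \<or> b \<in> Q" if "a \<in> sec_in X ?W" "b \<in> sec_in X ?W" "a \<otimes>\<^bsub>K\<^esub> b \<in> Q" for a b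
    proof (rule ccontr)
      assume "\<not> (a \<in> Q \<or> b \<in> Q)"
      then have "v a = 0" "v b = 0" using that(1,2) vW[of a] vW[of b] by (auto simp: Q_def)
      then show False using that(3) valuation_mult[OF v cW[OF that(1)] cW[OF that(2)]] by (simp add: Q_def)
    qed
  qed
  \<comment> \<open>On sections over \<open>U\<close>, vanishing at \<open>z\<close> means positive
    value by the choice of \<open>z\<close>, and vanishing at \<open>x\<close> means the same
    because \<open>v\<close> dominates the local ring at \<open>x\<close>.\<close>
  have "z = x"
  proof (rule affine_point_unique[OF U(1)])
    show "sec_in X U \<inter> \<mm> z = sec_in X U \<inter> \<mm> x"
    proof (rule Set.set_eqI)
      fix a
      have "a \<in> \<mm> z \<longleftrightarrow> a \<in> \<mm> x" if a: "a \<in> sec_in X U"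
        using z(2) AW(1) a dominates_pos_iff[OF v x(2,1) affine_sec_in_local[OF U a]]
        unfolding Q_def by blast
      then show "a \<in> sec_in X U \<inter> \<mm> z \<longleftrightarrow> a \<in> sec_in X U \<inter> \<mm> x" by blast
    qed
  qed (use z U in auto)
  moreover have "z = y"
  proof (rule affine_point_unique[OF V(1)])
    show "sec_in X V \<inter> \<mm> z = sec_in X V \<inter> \<mm> y"
    proof (rule Set.set_eqI)
      fix a
      have "a \<in> \<mm> z \<longleftrightarrow> a \<in> \<mm> y" if a: "a \<in> sec_in X V"
        using z(2) AW(2) a dominates_pos_iff[OF v y(2,1) affine_sec_in_local[OF V a]]
        unfolding Q_def by blast
      then show "a \<in> sec_in X V \<inter> \<mm> z \<longleftrightarrow> a \<in> sec_in X V \<inter> \<mm> y" by blast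
    qed
  qed (use z V in auto)
  ultimately show ?thesis by simp
qed

lemma center_eq:
  assumes "separated_scheme X" "is_valuation K v"
    and "x \<in> topspace (topo X)" "val_dominates K (local_at X x) v"
  shows "center K (topspace (topo X)) (local_at X) v = x"
  unfolding center_def using assms center_unique by (intro the_equality) blast+

section \<open>A lower bound for the log discrepancy\<close>

lemma p_linear_zero:
  assumes "p_linear K p e \<psi>" shows "\<psi> \<zero>\<^bsub>K\<^esub> = \<zero>\<^bsub>K\<^esub>"
proof -
  have c: "\<psi> \<zero>\<^bsub>K\<^esub> \<in> carrier K" and "\<psi> (\<zero>\<^bsub>K\<^esub> \<oplus>\<^bsub>K\<^esub> \<zero>\<^bsub>K\<^esub>) = \<psi> \<zero>\<^bsub>K\<^esub> \<oplus>\<^bsub>K\<^esub> \<psi> \<zero>\<^bsub>K\<^esub>"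
    using assms K.zero_closed unfolding p_linear_def by blast+
  then have "\<psi> \<zero>\<^bsub>K\<^esub> \<oplus>\<^bsub>K\<^esub> \<psi> \<zero>\<^bsub>K\<^esub> = \<psi> \<zero>\<^bsub>K\<^esub>" by simp
  then show ?thesis using c by (simp add: K.add.r_cancel_one)
qed

lemma map_stalk_p_linear:
  "\<psi> \<in> map_stalk X (full_cartier X p) x e \<Longrightarrow> p_linear K p e \<psi>"
  by (auto simp: map_stalk_def full_cartier_def)

text \<open>Only one term of the supremum is used, the first iterate of \<open>\<psi>\<close> at
  \<open>k\<close>. Since \<open>v (\<psi> k) = v 1 = 0\<close>, this term is
  \<open>v k / (p^e - 1)\<close>. The element \<open>k\<close> is admissible because a map with
  \<open>\<psi> k = 1\<close> cannot have \<open>k = 0\<close>.\<close>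

lemma A_val_ge:
  assumes "separated_scheme X" and v: "is_valuation K v"
    and x: "x \<in> topspace (topo X)" "val_dominates K (local_at X x) v"
    and e: "e \<ge> 1" and \<psi>: "\<psi> \<in> map_stalk X (full_cartier X p) x e"
    and k: "k \<in> local_at X x" "\<psi> k = \<one>\<^bsub>K\<^esub>"
  shows "v k / ereal (real p ^ e - 1) \<le> A_val X p (full_cartier X p) v"
proof -
  have kc: "k \<in> carrier K" using local_at_carrier x(1) k(1) by blast
  have "k \<noteq> \<zero>\<^bsub>K\<^esub>" using k(2) p_linear_zero[OF map_stalk_p_linear[OF \<psi>]] K.one_not_zero by metis
  then have "k \<in> carrier K - {\<zero>\<^bsub>K\<^esub>}" using kc by blast
  have "v k / ereal (real p ^ e - 1) = E_quot p (1 * e) k (\<psi> ^^ 1) v"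
    using valuation_one[OF v] k(2) by (simp add: E_quot_one)
  also have "\<dots> \<le> (SUP f\<in>carrier K - {\<zero>\<^bsub>K\<^esub>}. E_quot p (1 * e) f (\<psi> ^^ 1) v)"
    by (rule SUP_upper) fact
  also have "\<dots> \<le> A_map K p e \<psi> v"
    unfolding A_map_def by (rule SUP_upper) simp
  also have "\<dots> \<le> (SUP \<psi>\<in>{\<psi> \<in> map_stalk X (full_cartier X p) x e. \<exists>f\<in>carrier K. \<psi> f \<noteq> \<zero>\<^bsub>K\<^esub>}. A_map K p e \<psi> v)"
  proof (rule SUP_upper)
    have "\<psi> k \<noteq> \<zero>\<^bsub>K\<^esub>" using k(2) by simp
    then show "\<psi> \<in> {\<psi> \<in> map_stalk X (full_cartier X p) x e. \<exists>f\<in>carrier K. \<psi> f \<noteq> \<zero>\<^bsub>K\<^esub>}"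
      using \<psi> kc by blast
  qed
  also have "\<dots> \<le> A_val X p (full_cartier X p) v"
    unfolding A_val_def A_gen_def center_eq[OF assms(1) v x] using e by (intro SUP_upper) simp
  finally show ?thesis .
qed

end

section \<open>Divisorial valuations\<close>

lemma openin_preim:
  "scheme_morphism Y X f \<Longrightarrow> openin (topo X) V \<Longrightarrow> openin (topo Y) (preim Y f V)"
  by (auto simp: scheme_morphism_def preim_def intro: openin_continuous_map_preimage)

text \<open>\<open>stalk_map\<close> applies the comorphism to all representatives at once; its
  compatibility with restriction collapses the set of results to a singleton.\<close>

lemma stalk_map_germ:
  assumes RX: "ringed_space X" and RY: "ringed_space Y" and f: "scheme_morphism Y X f"
    and y: "y \<in> topspace (topo Y)" and x: "pt f y = x"
    and U: "openin (topo X) U" "x \<in> U" "s \<in> carrier (sec X U)"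
  shows "stalk_map Y f y (germ_of X x U s) = germ_of Y y (preim Y f U) (comor f U s)"
proof -
  interpret X: ringed_space X by fact
  interpret Y: ringed_space Y by fact
  have com: "comor f V \<in> ring_hom (sec X V) (sec Y (preim Y f V))" if "openin (topo X) V" for V
    using f that by (simp add: scheme_morphism_def)
  have cr: "germ_of Y y (preim Y f V) (comor f V t) = germ_of Y y (preim Y f W) (comor f W (res X V W t))"
    if V: "openin (topo X) V" "t \<in> carrier (sec X V)" and W: "openin (topo X) W" "W \<subseteq> V" "x \<in> W" for V W t
  proof -
    have "comor f W (res X V W t) = res Y (preim Y f V) (preim Y f W) (comor f V t)"
      using f V W by (simp add: scheme_morphism_def)
    moreover have "preim Y f W \<subseteq> preim Y f V" "y \<in> preim Y f W" using W x y by (auto simp: preim_def)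
    ultimately show ?thesis
      using Y.germ_of_res[OF openin_preim[OF f V(1)] openin_preim[OF f W(1)] _ _ ring_hom_closed[OF com[OF V(1)] V(2)]]
      by simp
  qed
  have "germ_of Y y (preim Y f V) (comor f V t) = germ_of Y y (preim Y f U) (comor f U s)"
    if "(V, t) \<in> germ_of X x U s" for V t
  proof -
    have V: "openin (topo X) V" "x \<in> V" "t \<in> carrier (sec X V)" "germ_of X x U s = germ_of X x V t"
      using that X.mem_germ_of[OF U] by blast+
    obtain W where W: "openin (topo X) W" "x \<in> W" "W \<subseteq> U \<inter> V" "res X U W s = res X V W t"
      using V(4) X.germ_of_eq_iff[OF U V(1-3)] by blast
    then show ?thesis using cr[OF U(1,3) W(1) _ W(2)] cr[OF V(1,3) W(1) _ W(2)] by simp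
  qed
  then have const: "(\<lambda>(V, s). germ_of Y y (preim Y f V) (comor f V s)) q = germ_of Y y (preim Y f U) (comor f U s)"
    if "q \<in> germ_of X x U s" for q using that by (cases q) simp
  have "(U, s) \<in> germ_of X x U s" using X.mem_germ_of[OF U] U by blast
  then have "(\<lambda>(V, s). germ_of Y y (preim Y f V) (comor f V s)) ` germ_of X x U s
    = {germ_of Y y (preim Y f U) (comor f U s)}"
    using image_cong[OF refl const, of "germ_of X x U s"] by (simp only: image_constant)
  then show ?thesis unfolding stalk_map_def by simp
qed

section \<open>Transport of \<open>ord_E\<close> to the function field of the base\<close>

context integral_scheme_space
begin

lemma funfield_common:
  assumes "a \<in> carrier K" "b \<in> carrier K"
  obtains U s t where "openin (topo X) U" "generic_point X \<in> U" "s \<in> carrier (sec X U)" "t \<in> carrier (sec X U)"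
    "a = germ_of X (generic_point X) U s" "b = germ_of X (generic_point X) U t"
proof -
  obtain U where U: "openin (topo X) U" "generic_point X \<in> U" "a \<in> sec_in X U" using funfield_elem assms(1) .
  obtain V where V: "openin (topo X) V" "generic_point X \<in> V" "b \<in> sec_in X V" using funfield_elem assms(2) .
  have o: "openin (topo X) (U \<inter> V)" "U \<inter> V \<noteq> {}" "generic_point X \<in> U \<inter> V" using U V by auto
  have "a \<in> sec_in X (U \<inter> V)" "b \<in> sec_in X (U \<inter> V)"
    using sec_in_mono[OF U(1) o(1,2)] sec_in_mono[OF V(1) o(1,2)] U V by auto
  then show ?thesis using that o unfolding sec_in_def by blast
qed

text \<open>Birationality is phrased as bijectivity of a map of germs. The ring operations are
  checked by bringing two elements to a common neighbourhood, where the comorphism is a ring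
  homomorphism.\<close>

lemma birational_funfield_hom:
  assumes Y: "integral_scheme_space Y" and f: "birational_morphism Y X f"
  shows "stalk_map Y f (generic_point Y) \<in> ring_hom K (funfield Y)"
proof -
  interpret Y: integral_scheme_space Y by fact
  have mor: "scheme_morphism Y X f" and gen: "pt f (generic_point Y) = generic_point X"
    using f by (auto simp: birational_morphism_def)
  let ?\<phi> = "stalk_map Y f (generic_point Y)"
  note st = stalk_map_germ[OF ringed_space_axioms Y.ringed_space_axioms mor Y.generic_in_topspace gen]
  have hom: "comor f U \<in> ring_hom (sec X U) (sec Y (preim Y f U))"
    and hY: "germ_of Y (generic_point Y) (preim Y f U) \<in> ring_hom (sec Y (preim Y f U)) (funfield Y)"
    if "openin (topo X) U" "generic_point X \<in> U" for U
  proof -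
    show "comor f U \<in> ring_hom (sec X U) (sec Y (preim Y f U))" using mor that by (simp add: scheme_morphism_def)
    have "generic_point Y \<in> preim Y f U" using gen that Y.generic_in_topspace by (simp add: preim_def)
    then show "germ_of Y (generic_point Y) (preim Y f U) \<in> ring_hom (sec Y (preim Y f U)) (funfield Y)"
      using Y.generic_germ_hom[OF openin_preim[OF mor that(1)]] by blast
  qed
  show ?thesis
  proof (rule ring_hom_memI)
    fix a b assume ab: "a \<in> carrier K" "b \<in> carrier K"
    obtain U s t where U: "openin (topo X) U" "generic_point X \<in> U" "s \<in> carrier (sec X U)" "t \<in> carrier (sec X U)"
      "a = germ_of X (generic_point X) U s" "b = germ_of X (generic_point X) U t" using funfield_common[OF ab] .
    have ne: "U \<noteq> {}" using U(2) by blast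
    note hs = hom[OF U(1,2)] and hg = hY[OF U(1,2)]
    interpret hX: ring_hom_ring "sec X U" K "germ_of X (generic_point X) U"
      by (rule generic_germ_ring_hom[OF U(1) ne])
    note cl = ring_hom_closed[OF hs U(3)] ring_hom_closed[OF hs U(4)]
    show "?\<phi> a \<in> carrier (funfield Y)" unfolding U st[OF U(1-3)] by (rule ring_hom_closed[OF hg cl(1)])
    have "?\<phi> (germ_of X (generic_point X) U (s \<otimes>\<^bsub>sec X U\<^esub> t))
      = ?\<phi> (germ_of X (generic_point X) U s) \<otimes>\<^bsub>funfield Y\<^esub> ?\<phi> (germ_of X (generic_point X) U t)"
      unfolding st[OF U(1-3)] st[OF U(1,2,4)] st[OF U(1,2) hX.R.m_closed[OF U(3,4)]]
        ring_hom_mult[OF hs U(3,4)] ring_hom_mult[OF hg cl] ..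
    then show "?\<phi> (a \<otimes>\<^bsub>K\<^esub> b) = ?\<phi> a \<otimes>\<^bsub>funfield Y\<^esub> ?\<phi> b" using U by simp
    have "?\<phi> (germ_of X (generic_point X) U (s \<oplus>\<^bsub>sec X U\<^esub> t))
      = ?\<phi> (germ_of X (generic_point X) U s) \<oplus>\<^bsub>funfield Y\<^esub> ?\<phi> (germ_of X (generic_point X) U t)"
      unfolding st[OF U(1-3)] st[OF U(1,2,4)] st[OF U(1,2) hX.R.a_closed[OF U(3,4)]]
        ring_hom_add[OF hs U(3,4)] ring_hom_add[OF hg cl] ..
    then show "?\<phi> (a \<oplus>\<^bsub>K\<^esub> b) = ?\<phi> a \<oplus>\<^bsub>funfield Y\<^esub> ?\<phi> b" using U by simp
  next
    let ?T = "topspace (topo X)"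
    note g = openin_topspace[of "topo X"] generic_in_topspace
    have "?\<phi> (germ_of X (generic_point X) ?T \<one>\<^bsub>sec X ?T\<^esub>) = \<one>\<^bsub>funfield Y\<^esub>"
      using st[OF g] sec_cring[OF g(1)]
      by (simp add: ring_hom_one[OF hom[OF g]] ring_hom_one[OF hY[OF g]] cring.cring_simprules)
    then show "?\<phi> \<one>\<^bsub>K\<^esub> = \<one>\<^bsub>funfield Y\<^esub>"
      using ring_hom_one[OF generic_germ_hom[OF g(1) topspace_nonempty]] by simp
  qed
qed

text \<open>The center is the image of the generic point of \<open>E\<close>. The valuation ring of
  \<open>w\<close> is the local ring of \<open>Y\<close> at that generic point, and the map of
  stalks is local, so it sends the maximal ideal at \<open>x\<close> to elements of positive
  value.\<close>

lemma is_ord_dominates: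
  assumes Y: "integral_scheme_space Y" and f: "birational_morphism Y X f" and ord: "is_ord X Y f E v"
  obtains x where "is_valuation K v" "x \<in> topspace (topo X)" "val_dominates K (local_at X x) v"
    "\<exists>k\<in>carrier K. v k = 1"
proof -
  interpret Y: integral_scheme_space Y by fact
  have mor: "scheme_morphism Y X f" and gen: "pt f (generic_point Y) = generic_point X"
    and bij: "bij_betw (stalk_map Y f (generic_point Y)) (carrier K) (carrier (funfield Y))"
    using f by (auto simp: birational_morphism_def)
  define \<phi> where "\<phi> = stalk_map Y f (generic_point Y)"
  define y where "y = generic_of Y E"
  obtain w where w: "is_ord_along Y E w" and vw: "\<And>g. g \<in> carrier K \<Longrightarrow> v g = w (\<phi> g)"
    using ord unfolding is_ord_def \<phi>_def by blast
  have wv: "is_valuation (funfield Y) w" and wy: "{g \<in> carrier (funfield Y). 0 \<le> w g} = local_at Y y"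
    and w1: "\<exists>g\<in>carrier (funfield Y). w g = 1"
    using w by (auto simp: is_ord_along_def y_def)
  interpret \<phi>: ring_hom_ring K "funfield Y" \<phi>
    using ring_hom_ringI2[OF K.ring_axioms Y.K.ring_axioms] birational_funfield_hom[OF Y f] unfolding \<phi>_def .
  \<comment> \<open>As \<open>y\<close> comes from a definite description, it has to be shown to be
    a point. \<open>local_at\<close> is empty away from the space, while here it contains 0, whose
    value is \<open>\<infinity>\<close>.\<close>
  have "\<zero>\<^bsub>funfield Y\<^esub> \<in> local_at Y y" unfolding wy[symmetric] using wv by (simp add: is_valuation_def)
  then have y: "y \<in> topspace (topo Y)" using Y.local_atE openin_subset by blast
  define x where "x = pt f y"
  have x: "x \<in> topspace (topo X)"
    using mor y by (auto simp: x_def scheme_morphism_def continuous_map_def)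
  have vval: "is_valuation K v"
  proof -
    have "\<bar>w (\<phi> a)\<bar> \<noteq> \<infinity>" if a: "a \<in> carrier K" "a \<noteq> \<zero>\<^bsub>K\<^esub>" for a
    proof -
      have "\<phi> a \<noteq> \<phi> \<zero>\<^bsub>K\<^esub>" using a bij unfolding \<phi>_def bij_betw_def
        by (metis K.zero_closed inj_onD)
      then show ?thesis using wv a by (auto simp: is_valuation_def)
    qed
    then show ?thesis using wv by (auto simp: is_valuation_def vw)
  qed
  have loc: "\<phi> g \<in> local_at Y y \<and> (g \<in> \<mm> x \<longrightarrow> \<phi> g \<in> Y.mm y)" if g: "g \<in> local_at X x" for g
  proof -
    obtain U s where U: "openin (topo X) U" "x \<in> U" "s \<in> carrier (sec X U)" "g = germ_of X (generic_point X) U s"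
      using g unfolding local_at_def sec_in_def by blast
    have gU: "generic_point X \<in> U" using generic_point_in(1) U by blast
    have oP: "openin (topo Y) (preim Y f U)" using openin_preim[OF mor U(1)] .
    have yP: "y \<in> preim Y f U" using y U(2) by (simp add: preim_def x_def)
    have c: "comor f U s \<in> carrier (sec Y (preim Y f U))"
      using ring_hom_closed[OF _ U(3)] mor U(1) by (auto simp: scheme_morphism_def)
    have \<phi>g: "\<phi> g = germ_of Y (generic_point Y) (preim Y f U) (comor f U s)"
      unfolding U(4) \<phi>_def
      by (rule stalk_map_germ[OF ringed_space_axioms Y.ringed_space_axioms mor Y.generic_in_topspace gen U(1) gU U(3)])
    have "\<phi> g \<in> Y.mm y" if "g \<in> \<mm> x"
    proof -
      have "germ_of X x U s \<in> max_ideal (stalk X x)"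
        using that mem_point_ideal_iff[OF U(1-3)] U(4) by (simp add: point_ideal_def)
      then have "stalk_map Y f y (germ_of X x U s) \<in> max_ideal (stalk Y y)"
        using mor y by (simp add: scheme_morphism_def x_def)
      then have "germ_of Y y (preim Y f U) (comor f U s) \<in> max_ideal (stalk Y y)"
        using stalk_map_germ[OF ringed_space_axioms Y.ringed_space_axioms mor y x_def[symmetric] U(1-3)] by simp
      then show ?thesis using Y.mem_point_ideal_iff[OF oP yP c] c \<phi>g by (simp add: point_ideal_def)
    qed
    then show ?thesis using Y.local_atI[OF oP yP] c \<phi>g unfolding sec_in_def by blast
  qed
  \<comment> \<open>An element of value 0 has an inverse of value 0, which again lies in the
    valuation ring; so it cannot be a non-unit.\<close>
  have wpos: "0 < w b" if b: "b \<in> Y.mm y" for b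
  proof (rule ccontr)
    assume np: "\<not> 0 < w b"
    have bL: "b \<in> local_at Y y" using Y.max_idealD[OF b] .
    then have bc: "b \<in> carrier (funfield Y)" "0 \<le> w b" using wy by auto
    then have w0: "w b = 0" using np by simp
    then have "b \<noteq> \<zero>\<^bsub>funfield Y\<^esub>" using wv by (auto simp: is_valuation_def)
    then obtain c where c: "c \<in> carrier (funfield Y)" "b \<otimes>\<^bsub>funfield Y\<^esub> c = \<one>\<^bsub>funfield Y\<^esub>"
      using bc(1) Y.K.field_Units Y.K.Units_r_inv_ex by (metis Diff_iff singletonD)
    have "0 = w b + w c" using Y.valuation_mult[OF wv bc(1) c(1)] c(2) Y.valuation_one[OF wv] by simp
    then have "w c = 0" using w0 by simp
    then have "c \<in> local_at Y y" using c(1) unfolding wy[symmetric] by simp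
    then show False using b c(2) Y.mem_max_ideal[OF y, of b] by blast
  qed
  have "val_dominates K (local_at X x) v"
    unfolding dominates_local
  proof (intro conjI ballI)
    fix a assume a: "a \<in> local_at X x"
    have "\<phi> a \<in> {g \<in> carrier (funfield Y). 0 \<le> w g}" unfolding wy using loc[OF a] by (rule conjunct1)
    then show "0 \<le> v a" using vw[OF local_at_carrier[OF x a]] by simp
  next
    fix a assume a: "a \<in> \<mm> x"
    have aL: "a \<in> local_at X x" using max_idealD[OF a] .
    show "0 < v a" using wpos loc[OF aL] a vw[OF local_at_carrier[OF x aL]] by simp
  qed
  moreover have "\<exists>k\<in>carrier K. v k = 1"
  proof -
    obtain g where g: "g \<in> carrier (funfield Y)" "w g = 1" using w1 by blast
    then obtain k where "k \<in> carrier K" "\<phi> k = g" using bij unfolding \<phi>_def bij_betw_def by (metis imageE)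
    then show ?thesis using vw g by auto
  qed
  ultimately show ?thesis using that vval x by blast
qed

section \<open>F-pure implies log canonical, F-regular implies klt\<close>

lemma F_pure_log_canonical:
  assumes sep: "separated_scheme X" and p: "p \<ge> 2" and pure: "F_pure X p"
    and Y: "integral_scheme_space Y" and f: "birational_morphism Y X f" and ord: "is_ord X Y f E v"
  shows "0 \<le> A_val X p (full_cartier X p) v"
proof -
  obtain x where v: "is_valuation K v" and x: "x \<in> topspace (topo X)" "val_dominates K (local_at X x) v"
    using is_ord_dominates[OF Y f ord] by metis
  obtain e \<psi> where e: "e \<ge> 1" and \<psi>: "\<psi> \<in> map_stalk X (full_cartier X p) x e" "\<psi> ` local_at X x = local_at X x"
    using pure x(1) unfolding F_pure_def by blast
  have "\<one>\<^bsub>K\<^esub> \<in> \<psi> ` local_at X x" using \<psi>(2) local_at_one[OF x(1)] by simp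
  then obtain k where k: "k \<in> local_at X x" "\<psi> k = \<one>\<^bsub>K\<^esub>" by (metis imageE)
  have "1 < real p ^ e" using p e by (intro one_less_power) auto
  then have "0 \<le> v k / ereal (real p ^ e - 1)"
    using k(1) x(2) by (cases "v k") (auto simp: dominates_local)
  then show ?thesis using A_val_ge[OF sep v x e \<psi>(1) k] by (rule order_trans)
qed

lemma F_regular_klt:
  assumes sep: "separated_scheme X" and p: "p \<ge> 2" and reg: "F_regular X p"
    and Y: "integral_scheme_space Y" and f: "birational_morphism Y X f" and ord: "is_ord X Y f E v"
  shows "0 < A_val X p (full_cartier X p) v"
proof -
  obtain x where v: "is_valuation K v" and x: "x \<in> topspace (topo X)" "val_dominates K (local_at X x) v"
    and one: "\<exists>k\<in>carrier K. v k = 1"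
    using is_ord_dominates[OF Y f ord] by metis
  \<comment> \<open>An element \<open>k\<close> with \<open>v k = 1\<close> need not be regular at
    \<open>x\<close>. Writing it as a fraction over an affine neighbourhood of \<open>x\<close>
    helps: its denominator \<open>s\<close> is regular at \<open>x\<close>, so
    \<open>v s \<ge> 0\<close>, and the numerator \<open>k * s\<close> is regular with positive
    value.\<close>
  obtain a where a: "a \<in> local_at X x" "0 < v a" "a \<noteq> \<zero>\<^bsub>K\<^esub>"
  proof -
    obtain k where k: "k \<in> carrier K" "v k = 1" using one by blast
    obtain V where V: "affine_open X V" "x \<in> V" using affine_cover x(1) by blast
    note oV = affine_open_openin[OF V(1)]
    have gV: "generic_point X \<in> V" using generic_point_in(1) oV V by blast
    have "k \<in> local_at X (generic_point X)" using k(1) local_at_generic by simp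
    then obtain s where s: "s \<in> sec_in X V" "s \<notin> \<mm> (generic_point X)" "k \<otimes>\<^bsub>K\<^esub> s \<in> sec_in X V"
      using affine_fraction[OF V(1) gV] by metis
    have sL: "s \<in> local_at X x" "k \<otimes>\<^bsub>K\<^esub> s \<in> local_at X x" using s affine_sec_in_local[OF V] by auto
    then have sc: "s \<in> carrier K" using local_at_carrier[OF x(1)] by blast
    have "v (k \<otimes>\<^bsub>K\<^esub> s) = 1 + v s" using valuation_mult[OF v k(1) sc] k(2) by simp
    moreover have "0 \<le> v s" using x(2) sL by (simp add: dominates_local)
    ultimately have "0 < v (k \<otimes>\<^bsub>K\<^esub> s)" by (simp add: add_pos_nonneg)
    moreover have "k \<noteq> \<zero>\<^bsub>K\<^esub>" using k(2) v by (auto simp: is_valuation_def)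
    then have "k \<otimes>\<^bsub>K\<^esub> s \<noteq> \<zero>\<^bsub>K\<^esub>" using s(2) k(1) sc by (auto simp: max_ideal_generic K.integral_iff)
    ultimately show ?thesis using that sL(2) by blast
  qed
  obtain e \<psi> where e: "e \<ge> 1" and \<psi>: "\<psi> \<in> map_stalk X (full_cartier X p) x e" "\<psi> a = \<one>\<^bsub>K\<^esub>"
    using reg x(1) a(1,3) unfolding F_regular_def by blast
  have "1 < real p ^ e" using p e by (intro one_less_power) auto
  then have "0 < v a / ereal (real p ^ e - 1)"
    using a(2) by (cases "v a") auto
  then show ?thesis using A_val_ge[OF sep v x e \<psi>(1) a(1) \<psi>(2)] by (rule less_le_trans)
qed

end

section \<open>Maps that are linear over a power of Frobenius\<close>

text \<open>Allows finite generation to be expressed through closure under addition, without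
  explicit sums.\<close>

lemma (in abelian_monoid) finsum_mem_submonoid:
  assumes "finite B" "M \<subseteq> carrier G" "\<zero> \<in> M" "\<And>a b. a \<in> M \<Longrightarrow> b \<in> M \<Longrightarrow> a \<oplus> b \<in> M"
    and "\<And>b. b \<in> B \<Longrightarrow> f b \<in> M"
  shows "finsum G f B \<in> M"
  using assms(1,5)
proof (induction B rule: finite_induct)
  case empty
  then show ?case using assms(3) by simp
next
  case (insert b B)
  have "finsum G f (insert b B) = f b \<oplus> finsum G f B"
    using insert assms(2) by (intro finsum_insert) auto
  then show ?case using insert assms(4) by simp
qed

locale F_finite_integral_scheme = integral_scheme_space X for X :: "('x, 'a) rspace" +
  fixes p :: nat
  assumes p_ge: "p \<ge> 2" and F_finite: "F_finite X p"
begin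

lemma preim_frobenius: "openin (topo X) U \<Longrightarrow> preim X (frobenius X p) U = U"
  using openin_subset by (auto simp: preim_def frobenius_def)

text \<open>Additivity of \<open>p\<close>-th powers is contained in \<open>F_finite\<close>: as a
  morphism of schemes, Frobenius acts on sections by ring homomorphisms.\<close>

lemma frobenius_add:
  assumes "a \<in> carrier K" "b \<in> carrier K"
  shows "(a \<oplus>\<^bsub>K\<^esub> b) [^]\<^bsub>K\<^esub> p = a [^]\<^bsub>K\<^esub> p \<oplus>\<^bsub>K\<^esub> b [^]\<^bsub>K\<^esub> p"
proof -
  obtain U s t where U: "openin (topo X) U" "generic_point X \<in> U" "s \<in> carrier (sec X U)" "t \<in> carrier (sec X U)"
    "a = germ_of X (generic_point X) U s" "b = germ_of X (generic_point X) U t" using funfield_common[OF assms] .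
  have ne: "U \<noteq> {}" using U(2) by blast
  interpret h: ring_hom_ring "sec X U" K "germ_of X (generic_point X) U"
    by (rule generic_germ_ring_hom[OF U(1) ne])
  have "comor (frobenius X p) U \<in> ring_hom (sec X U) (sec X (preim X (frobenius X p) U))"
    using F_finite U(1) by (simp add: F_finite_def finite_morphism_def scheme_morphism_def)
  then have "(\<lambda>s. s [^]\<^bsub>sec X U\<^esub> p) \<in> ring_hom (sec X U) (sec X U)"
    unfolding preim_frobenius[OF U(1)] by (simp add: frobenius_def)
  from ring_hom_add[OF this U(3,4)]
  have "germ_of X (generic_point X) U ((s \<oplus>\<^bsub>sec X U\<^esub> t) [^]\<^bsub>sec X U\<^esub> p)
    = germ_of X (generic_point X) U (s [^]\<^bsub>sec X U\<^esub> p \<oplus>\<^bsub>sec X U\<^esub> t [^]\<^bsub>sec X U\<^esub> p)" by simp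
  then show ?thesis using U(3,4) by (simp add: U(5,6) h.hom_nat_pow)
qed

text \<open>Derived from additivity, so that even \<open>p\<close> needs no separate case.\<close>

lemma frobenius_uminus:
  assumes a: "a \<in> carrier K"
  shows "(\<ominus>\<^bsub>K\<^esub> a) [^]\<^bsub>K\<^esub> p = \<ominus>\<^bsub>K\<^esub> (a [^]\<^bsub>K\<^esub> p)"
proof -
  have "(\<ominus>\<^bsub>K\<^esub> a) [^]\<^bsub>K\<^esub> p \<oplus>\<^bsub>K\<^esub> a [^]\<^bsub>K\<^esub> p = (\<ominus>\<^bsub>K\<^esub> a \<oplus>\<^bsub>K\<^esub> a) [^]\<^bsub>K\<^esub> p"
    using frobenius_add[of "\<ominus>\<^bsub>K\<^esub> a" a] a by simp
  also have "\<dots> = \<zero>\<^bsub>K\<^esub>" using a p_ge by (simp add: K.l_neg K.nat_pow_zero)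
  finally show ?thesis using a K.minus_equality[of "(\<ominus>\<^bsub>K\<^esub> a) [^]\<^bsub>K\<^esub> p" "a [^]\<^bsub>K\<^esub> p"] by simp
qed

lemma frobenius_minus:
  assumes "a \<in> carrier K" "b \<in> carrier K"
  shows "(a \<ominus>\<^bsub>K\<^esub> b) [^]\<^bsub>K\<^esub> p = a [^]\<^bsub>K\<^esub> p \<ominus>\<^bsub>K\<^esub> b [^]\<^bsub>K\<^esub> p"
  using frobenius_add[of a "\<ominus>\<^bsub>K\<^esub> b"] frobenius_uminus assms by (simp add: K.minus_eq)

lemma field_inverse:
  assumes "a \<in> carrier K" "a \<noteq> \<zero>\<^bsub>K\<^esub>"
  obtains b where "b \<in> carrier K" "a \<otimes>\<^bsub>K\<^esub> b = \<one>\<^bsub>K\<^esub>"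
  using assms K.field_Units K.Units_r_inv_ex by (metis Diff_iff singletonD)

text \<open>A splitting of Frobenius on the function field: the projection onto the line of \<open>p\<close>-th powers
  along a \<open>K\<^sup>p\<close>-subspace which is maximal among those not containing 1.\<close>

definition frobenius_subspace :: "('x, 'a) germ set \<Rightarrow> bool" where
  "frobenius_subspace M \<longleftrightarrow> M \<subseteq> carrier K \<and> \<zero>\<^bsub>K\<^esub> \<in> M \<and>
     (\<forall>a\<in>M. \<forall>b\<in>M. a \<oplus>\<^bsub>K\<^esub> b \<in> M) \<and> (\<forall>c\<in>carrier K. \<forall>a\<in>M. c [^]\<^bsub>K\<^esub> p \<otimes>\<^bsub>K\<^esub> a \<in> M)"

lemma frobenius_subspaceD:
  assumes "frobenius_subspace M"
  shows "M \<subseteq> carrier K" "\<zero>\<^bsub>K\<^esub> \<in> M" "\<And>a b. a \<in> M \<Longrightarrow> b \<in> M \<Longrightarrow> a \<oplus>\<^bsub>K\<^esub> b \<in> M"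
    "\<And>c a. c \<in> carrier K \<Longrightarrow> a \<in> M \<Longrightarrow> c [^]\<^bsub>K\<^esub> p \<otimes>\<^bsub>K\<^esub> a \<in> M"
    "\<And>a. a \<in> M \<Longrightarrow> \<ominus>\<^bsub>K\<^esub> a \<in> M"
    "\<And>a b. a \<in> M \<Longrightarrow> b \<in> M \<Longrightarrow> a \<ominus>\<^bsub>K\<^esub> b \<in> M"
proof -
  show 1: "M \<subseteq> carrier K" "\<zero>\<^bsub>K\<^esub> \<in> M" "\<And>a b. a \<in> M \<Longrightarrow> b \<in> M \<Longrightarrow> a \<oplus>\<^bsub>K\<^esub> b \<in> M"
    "\<And>c a. c \<in> carrier K \<Longrightarrow> a \<in> M \<Longrightarrow> c [^]\<^bsub>K\<^esub> p \<otimes>\<^bsub>K\<^esub> a \<in> M"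
    using assms unfolding frobenius_subspace_def by blast+
  \<comment> \<open>Negation is scaling by the \<open>p\<close>-th power of -1.\<close>
  show 2: "\<ominus>\<^bsub>K\<^esub> a \<in> M" if a: "a \<in> M" for a
  proof -
    have ac: "a \<in> carrier K" using 1(1) a by blast
    have "(\<ominus>\<^bsub>K\<^esub> \<one>\<^bsub>K\<^esub>) [^]\<^bsub>K\<^esub> p \<otimes>\<^bsub>K\<^esub> a \<in> M" using 1(4) a by simp
    moreover have "(\<ominus>\<^bsub>K\<^esub> \<one>\<^bsub>K\<^esub>) [^]\<^bsub>K\<^esub> p \<otimes>\<^bsub>K\<^esub> a = \<ominus>\<^bsub>K\<^esub> a"
      using ac by (simp add: frobenius_uminus K.l_minus)
    ultimately show ?thesis by simp
  qed
  show "a \<ominus>\<^bsub>K\<^esub> b \<in> M" if "a \<in> M" "b \<in> M" for a b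
    unfolding K.minus_eq using that 1(3) 2 by blast
qed

text \<open>Zorn's lemma, with the zero subspace as a starting point. The union of a chain is closed
  under addition because any two of its elements lie in a common member.\<close>

lemma maximal_frobenius_subspace:
  obtains M where "frobenius_subspace M" "\<one>\<^bsub>K\<^esub> \<notin> M"
    "\<forall>N. frobenius_subspace N \<longrightarrow> \<one>\<^bsub>K\<^esub> \<notin> N \<longrightarrow> M \<subseteq> N \<longrightarrow> N = M"
proof -
  define \<A> where "\<A> = {M. frobenius_subspace M \<and> \<one>\<^bsub>K\<^esub> \<notin> M}"
  have "\<exists>M\<in>\<A>. \<forall>N\<in>\<A>. M \<subseteq> N \<longrightarrow> N = M"
  proof (rule subset_Zorn_nonempty)
    have "{\<zero>\<^bsub>K\<^esub>} \<in> \<A>" using K.one_not_zero by (simp add: \<A>_def frobenius_subspace_def)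
    then show "\<A> \<noteq> {}" by blast
    fix \<C> assume ne: "\<C> \<noteq> {}" and ch: "subset.chain \<A> \<C>"
    have sub: "\<And>M. M \<in> \<C> \<Longrightarrow> frobenius_subspace M \<and> \<one>\<^bsub>K\<^esub> \<notin> M"
      using ch by (auto simp: subset_chain_def \<A>_def)
    have "frobenius_subspace (\<Union>\<C>)"
      unfolding frobenius_subspace_def
    proof (intro conjI ballI)
      show "\<Union>\<C> \<subseteq> carrier K" using sub frobenius_subspaceD(1) by blast
      show "\<zero>\<^bsub>K\<^esub> \<in> \<Union>\<C>" using sub ne frobenius_subspaceD(2) by blast
      show "c [^]\<^bsub>K\<^esub> p \<otimes>\<^bsub>K\<^esub> a \<in> \<Union>\<C>" if "c \<in> carrier K" "a \<in> \<Union>\<C>" for c a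
        using that sub frobenius_subspaceD(4) by blast
      fix a b assume "a \<in> \<Union>\<C>" "b \<in> \<Union>\<C>"
      then obtain M N where MN: "M \<in> \<C>" "a \<in> M" "N \<in> \<C>" "b \<in> N" by blast
      then have "M \<subseteq> N \<or> N \<subseteq> M" using ch by (auto simp: subset_chain_def)
      then obtain L where "L \<in> \<C>" "a \<in> L" "b \<in> L" using MN by blast
      then show "a \<oplus>\<^bsub>K\<^esub> b \<in> \<Union>\<C>" using sub frobenius_subspaceD(3) by blast
    qed
    then show "\<Union>\<C> \<in> \<A>" using sub by (auto simp: \<A>_def)
  qed
  then obtain M where M: "M \<in> \<A>" "\<And>N. N \<in> \<A> \<Longrightarrow> M \<subseteq> N \<Longrightarrow> N = M" by blast
  show ?thesis by (rule that[of M]) (use M in \<open>auto simp: \<A>_def\<close>)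
qed

text \<open>Maximality makes \<open>M\<close> a complement of the line of \<open>p\<close>-th
  powers. Adjoining an element \<open>y\<close> outside \<open>M\<close> brings in 1, which
  expresses \<open>y\<close> as a \<open>p\<close>-th power modulo \<open>M\<close>. That power is
  unique, since a nonzero \<open>p\<close>-th power in \<open>M\<close> could be scaled to 1. The
  splitting takes the \<open>p\<close>-th root of the component on the line.\<close>

lemma frobenius_splitting_exists:
  obtains \<psi> where "p_linear K p 1 \<psi>" "\<psi> \<one>\<^bsub>K\<^esub> = \<one>\<^bsub>K\<^esub>"
proof -
  obtain M where M: "frobenius_subspace M" and one: "\<one>\<^bsub>K\<^esub> \<notin> M"
    and max: "\<forall>N. frobenius_subspace N \<longrightarrow> \<one>\<^bsub>K\<^esub> \<notin> N \<longrightarrow> M \<subseteq> N \<longrightarrow> N = M"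
    using maximal_frobenius_subspace .
  note MD = frobenius_subspaceD[OF M]
  have Mc: "m \<in> carrier K" if "m \<in> M" for m using MD(1) that by blast
  have ex: "\<exists>c\<in>carrier K. y \<ominus>\<^bsub>K\<^esub> c [^]\<^bsub>K\<^esub> p \<in> M" if y: "y \<in> carrier K" for y
  proof (cases "y \<in> M")
    case True
    then have "y \<ominus>\<^bsub>K\<^esub> \<zero>\<^bsub>K\<^esub> [^]\<^bsub>K\<^esub> p \<in> M" using p_ge y by (simp add: K.nat_pow_zero K.minus_eq)
    then show ?thesis by blast
  next
    case False
    define N where "N = {m \<oplus>\<^bsub>K\<^esub> c [^]\<^bsub>K\<^esub> p \<otimes>\<^bsub>K\<^esub> y | m c. m \<in> M \<and> c \<in> carrier K}"
    have NI: "m \<oplus>\<^bsub>K\<^esub> c [^]\<^bsub>K\<^esub> p \<otimes>\<^bsub>K\<^esub> y \<in> N" if "m \<in> M" "c \<in> carrier K" for m c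
      using that unfolding N_def by blast
    have "frobenius_subspace N"
      unfolding frobenius_subspace_def
    proof (intro conjI ballI)
      show "N \<subseteq> carrier K" using Mc y by (auto simp: N_def)
      show "\<zero>\<^bsub>K\<^esub> \<in> N" using NI[OF MD(2) K.zero_closed] y p_ge by (simp add: K.nat_pow_zero)
      fix a assume "a \<in> N"
      then obtain m c where mc: "m \<in> M" "c \<in> carrier K" "a = m \<oplus>\<^bsub>K\<^esub> c [^]\<^bsub>K\<^esub> p \<otimes>\<^bsub>K\<^esub> y" unfolding N_def by blast
      { fix b assume "b \<in> N"
        then obtain n d where nd: "n \<in> M" "d \<in> carrier K" "b = n \<oplus>\<^bsub>K\<^esub> d [^]\<^bsub>K\<^esub> p \<otimes>\<^bsub>K\<^esub> y" unfolding N_def by blast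
        have "a \<oplus>\<^bsub>K\<^esub> b = (m \<oplus>\<^bsub>K\<^esub> n) \<oplus>\<^bsub>K\<^esub> (c \<oplus>\<^bsub>K\<^esub> d) [^]\<^bsub>K\<^esub> p \<otimes>\<^bsub>K\<^esub> y"
          using mc nd Mc y by (simp add: frobenius_add K.l_distr K.a_ac)
        then show "a \<oplus>\<^bsub>K\<^esub> b \<in> N" using NI[OF MD(3)[OF mc(1) nd(1)]] mc nd by simp }
      fix d assume d: "d \<in> carrier K"
      have "d [^]\<^bsub>K\<^esub> p \<otimes>\<^bsub>K\<^esub> a = d [^]\<^bsub>K\<^esub> p \<otimes>\<^bsub>K\<^esub> m \<oplus>\<^bsub>K\<^esub> (d \<otimes>\<^bsub>K\<^esub> c) [^]\<^bsub>K\<^esub> p \<otimes>\<^bsub>K\<^esub> y"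
        using mc Mc y d by (simp add: K.r_distr K.nat_pow_distrib K.m_assoc)
      then show "d [^]\<^bsub>K\<^esub> p \<otimes>\<^bsub>K\<^esub> a \<in> N" using NI[OF MD(4)[OF d mc(1)]] mc d by simp
    qed
    moreover have "M \<subseteq> N"
    proof
      fix m assume m: "m \<in> M"
      show "m \<in> N" using NI[OF m K.zero_closed] y p_ge Mc[OF m] by (simp add: K.nat_pow_zero)
    qed
    moreover have "y \<in> N" using NI[OF MD(2) K.one_closed] y by simp
    then have "N \<noteq> M" using False by blast
    ultimately have "\<one>\<^bsub>K\<^esub> \<in> N" using max by blast
    then obtain m c where mc: "m \<in> M" "c \<in> carrier K" "\<one>\<^bsub>K\<^esub> = m \<oplus>\<^bsub>K\<^esub> c [^]\<^bsub>K\<^esub> p \<otimes>\<^bsub>K\<^esub> y" unfolding N_def by blast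
    have "c \<noteq> \<zero>\<^bsub>K\<^esub>"
    proof
      assume "c = \<zero>\<^bsub>K\<^esub>"
      then have "\<one>\<^bsub>K\<^esub> = m" using mc(3) y p_ge Mc[OF mc(1)] by (simp add: K.nat_pow_zero)
      then show False using one mc(1) by simp
    qed
    \<comment> \<open>Multiplying \<open>1 = m + c^p y\<close> by \<open>d^p\<close>, where
      \<open>d\<close> inverts \<open>c\<close>, gives \<open>d^p = d^p m + y\<close>; so
      \<open>y\<close> is congruent to \<open>d^p\<close> modulo \<open>M\<close>.\<close>
    then obtain d where d: "d \<in> carrier K" "c \<otimes>\<^bsub>K\<^esub> d = \<one>\<^bsub>K\<^esub>" using field_inverse mc(2) by blast
    have dc: "d [^]\<^bsub>K\<^esub> p \<otimes>\<^bsub>K\<^esub> (c [^]\<^bsub>K\<^esub> p \<otimes>\<^bsub>K\<^esub> y) = y"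
    proof -
      have "d [^]\<^bsub>K\<^esub> p \<otimes>\<^bsub>K\<^esub> (c [^]\<^bsub>K\<^esub> p \<otimes>\<^bsub>K\<^esub> y) = (c \<otimes>\<^bsub>K\<^esub> d) [^]\<^bsub>K\<^esub> p \<otimes>\<^bsub>K\<^esub> y"
        using mc(2) d(1) y by (simp add: K.nat_pow_distrib K.m_ac)
      then show ?thesis using d(2) y by simp
    qed
    have dp: "d [^]\<^bsub>K\<^esub> p = d [^]\<^bsub>K\<^esub> p \<otimes>\<^bsub>K\<^esub> m \<oplus>\<^bsub>K\<^esub> y"
    proof -
      have "d [^]\<^bsub>K\<^esub> p = d [^]\<^bsub>K\<^esub> p \<otimes>\<^bsub>K\<^esub> (m \<oplus>\<^bsub>K\<^esub> c [^]\<^bsub>K\<^esub> p \<otimes>\<^bsub>K\<^esub> y)"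
        unfolding mc(3)[symmetric] using d(1) by simp
      also have "\<dots> = d [^]\<^bsub>K\<^esub> p \<otimes>\<^bsub>K\<^esub> m \<oplus>\<^bsub>K\<^esub> y"
        using mc(1,2) d(1) Mc y dc by (simp add: K.r_distr)
      finally show ?thesis .
    qed
    have sub: "y \<ominus>\<^bsub>K\<^esub> (t \<oplus>\<^bsub>K\<^esub> y) = \<ominus>\<^bsub>K\<^esub> t" if "t \<in> carrier K" for t
      using that y by algebra
    have "y \<ominus>\<^bsub>K\<^esub> d [^]\<^bsub>K\<^esub> p = \<ominus>\<^bsub>K\<^esub> (d [^]\<^bsub>K\<^esub> p \<otimes>\<^bsub>K\<^esub> m)"
      using arg_cong[OF dp, of "\<lambda>k. y \<ominus>\<^bsub>K\<^esub> k"] sub d(1) Mc[OF mc(1)] by simp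
    then have "y \<ominus>\<^bsub>K\<^esub> d [^]\<^bsub>K\<^esub> p \<in> M" using MD(5)[OF MD(4)[OF d(1) mc(1)]] by (rule ssubst)
    then show ?thesis using d(1) by (rule bexI)
  qed
  have uniq: "c = d" if c: "c \<in> carrier K" "d \<in> carrier K" "y \<in> carrier K"
    and m: "y \<ominus>\<^bsub>K\<^esub> c [^]\<^bsub>K\<^esub> p \<in> M" "y \<ominus>\<^bsub>K\<^esub> d [^]\<^bsub>K\<^esub> p \<in> M" for c d y
  proof (rule ccontr)
    assume "c \<noteq> d"
    then have "c \<ominus>\<^bsub>K\<^esub> d \<noteq> \<zero>\<^bsub>K\<^esub>" using c by simp
    then obtain u where u: "u \<in> carrier K" "(c \<ominus>\<^bsub>K\<^esub> d) \<otimes>\<^bsub>K\<^esub> u = \<one>\<^bsub>K\<^esub>"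
      using field_inverse c by (metis K.minus_closed)
    have sub: "(y \<ominus>\<^bsub>K\<^esub> b) \<ominus>\<^bsub>K\<^esub> (y \<ominus>\<^bsub>K\<^esub> a) = a \<ominus>\<^bsub>K\<^esub> b" if "a \<in> carrier K" "b \<in> carrier K" for a b
      using that c(3) by algebra
    have "(y \<ominus>\<^bsub>K\<^esub> d [^]\<^bsub>K\<^esub> p) \<ominus>\<^bsub>K\<^esub> (y \<ominus>\<^bsub>K\<^esub> c [^]\<^bsub>K\<^esub> p) = (c \<ominus>\<^bsub>K\<^esub> d) [^]\<^bsub>K\<^esub> p"
      unfolding frobenius_minus[OF c(1,2)] using c by (intro sub) auto
    then have "(c \<ominus>\<^bsub>K\<^esub> d) [^]\<^bsub>K\<^esub> p \<in> M" using MD(6)[OF m(2,1)] by simp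
    then have "u [^]\<^bsub>K\<^esub> p \<otimes>\<^bsub>K\<^esub> (c \<ominus>\<^bsub>K\<^esub> d) [^]\<^bsub>K\<^esub> p \<in> M" using MD(4) u by blast
    moreover have "u [^]\<^bsub>K\<^esub> p \<otimes>\<^bsub>K\<^esub> (c \<ominus>\<^bsub>K\<^esub> d) [^]\<^bsub>K\<^esub> p = ((c \<ominus>\<^bsub>K\<^esub> d) \<otimes>\<^bsub>K\<^esub> u) [^]\<^bsub>K\<^esub> p"
      using c u(1) K.nat_pow_distrib[of "c \<ominus>\<^bsub>K\<^esub> d" u p]
        K.m_comm[of "u [^]\<^bsub>K\<^esub> p" "(c \<ominus>\<^bsub>K\<^esub> d) [^]\<^bsub>K\<^esub> p"] by simp
    ultimately show False using one u(2) by simp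
  qed
  obtain \<psi> where \<psi>: "\<And>y. y \<in> carrier K \<Longrightarrow> \<psi> y \<in> carrier K \<and> y \<ominus>\<^bsub>K\<^esub> \<psi> y [^]\<^bsub>K\<^esub> p \<in> M"
    using ex by metis
  \<comment> \<open>Additivity and linearity both come from \<open>uniq\<close>: the
    \<open>p\<close>-th powers of the two sides are congruent to the same element modulo
    \<open>M\<close>.\<close>
  have "p_linear K p 1 \<psi>"
    unfolding p_linear_def
  proof (intro conjI ballI)
    show "\<psi> f \<in> carrier K" if "f \<in> carrier K" for f using \<psi> that by blast
    fix f g assume fg: "f \<in> carrier K" "g \<in> carrier K"
    note cl = \<psi>[OF fg(1)] \<psi>[OF fg(2)]
    have sub: "(f \<oplus>\<^bsub>K\<^esub> g) \<ominus>\<^bsub>K\<^esub> (a \<oplus>\<^bsub>K\<^esub> b) = (f \<ominus>\<^bsub>K\<^esub> a) \<oplus>\<^bsub>K\<^esub> (g \<ominus>\<^bsub>K\<^esub> b)"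
      if "a \<in> carrier K" "b \<in> carrier K" for a b using that fg by algebra
    have "(f \<oplus>\<^bsub>K\<^esub> g) \<ominus>\<^bsub>K\<^esub> (\<psi> f \<oplus>\<^bsub>K\<^esub> \<psi> g) [^]\<^bsub>K\<^esub> p
      = (f \<ominus>\<^bsub>K\<^esub> \<psi> f [^]\<^bsub>K\<^esub> p) \<oplus>\<^bsub>K\<^esub> (g \<ominus>\<^bsub>K\<^esub> \<psi> g [^]\<^bsub>K\<^esub> p)"
      using cl by (simp add: frobenius_add sub)
    then have "(f \<oplus>\<^bsub>K\<^esub> g) \<ominus>\<^bsub>K\<^esub> (\<psi> f \<oplus>\<^bsub>K\<^esub> \<psi> g) [^]\<^bsub>K\<^esub> p \<in> M" using MD(3) cl by simp
    then show "\<psi> (f \<oplus>\<^bsub>K\<^esub> g) = \<psi> f \<oplus>\<^bsub>K\<^esub> \<psi> g"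
      using uniq[of "\<psi> (f \<oplus>\<^bsub>K\<^esub> g)" "\<psi> f \<oplus>\<^bsub>K\<^esub> \<psi> g" "f \<oplus>\<^bsub>K\<^esub> g"] \<psi>[of "f \<oplus>\<^bsub>K\<^esub> g"] fg cl by simp
    have "f [^]\<^bsub>K\<^esub> p \<otimes>\<^bsub>K\<^esub> g \<ominus>\<^bsub>K\<^esub> (f \<otimes>\<^bsub>K\<^esub> \<psi> g) [^]\<^bsub>K\<^esub> p = f [^]\<^bsub>K\<^esub> p \<otimes>\<^bsub>K\<^esub> (g \<ominus>\<^bsub>K\<^esub> \<psi> g [^]\<^bsub>K\<^esub> p)"
      using fg cl by (simp add: K.minus_eq K.nat_pow_distrib K.r_distr K.r_minus)
    then have "f [^]\<^bsub>K\<^esub> p \<otimes>\<^bsub>K\<^esub> g \<ominus>\<^bsub>K\<^esub> (f \<otimes>\<^bsub>K\<^esub> \<psi> g) [^]\<^bsub>K\<^esub> p \<in> M" using MD(4)[OF fg(1)] cl by simp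
    then show "\<psi> (f [^]\<^bsub>K\<^esub> (p ^ 1) \<otimes>\<^bsub>K\<^esub> g) = f \<otimes>\<^bsub>K\<^esub> \<psi> g"
      using uniq[of "\<psi> (f [^]\<^bsub>K\<^esub> p \<otimes>\<^bsub>K\<^esub> g)" "f \<otimes>\<^bsub>K\<^esub> \<psi> g" "f [^]\<^bsub>K\<^esub> p \<otimes>\<^bsub>K\<^esub> g"]
        \<psi>[of "f [^]\<^bsub>K\<^esub> p \<otimes>\<^bsub>K\<^esub> g"] fg cl by simp
  qed
  moreover have "\<one>\<^bsub>K\<^esub> \<ominus>\<^bsub>K\<^esub> \<one>\<^bsub>K\<^esub> [^]\<^bsub>K\<^esub> p \<in> M" using MD(2) by (simp add: K.minus_eq K.r_neg)
  then have "\<psi> \<one>\<^bsub>K\<^esub> = \<one>\<^bsub>K\<^esub>" using uniq[of "\<psi> \<one>\<^bsub>K\<^esub>" "\<one>\<^bsub>K\<^esub>" "\<one>\<^bsub>K\<^esub>"] \<psi>[OF K.one_closed] by simp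
  ultimately show ?thesis using that by blast
qed

section \<open>Finite generation over \<open>p\<close>-th powers and common denominators\<close>

text \<open>The finiteness of Frobenius, phrased without choosing a presentation.\<close>

lemma frobenius_generators:
  assumes "x \<in> topspace (topo X)"
  obtains V B where "affine_open X V" "x \<in> V" "finite B" "B \<subseteq> sec_in X V"
    "\<And>M. \<lbrakk>M \<subseteq> carrier K; \<zero>\<^bsub>K\<^esub> \<in> M; \<And>a b. a \<in> M \<Longrightarrow> b \<in> M \<Longrightarrow> a \<oplus>\<^bsub>K\<^esub> b \<in> M;
        \<And>u b. u \<in> sec_in X V \<Longrightarrow> b \<in> B \<Longrightarrow> u [^]\<^bsub>K\<^esub> p \<otimes>\<^bsub>K\<^esub> b \<in> M\<rbrakk> \<Longrightarrow> sec_in X V \<subseteq> M"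
proof -
  let ?F = "frobenius X p"
  \<comment> \<open>The predicate takes the target open set as a separate argument, so that the
    preimage of \<open>V\<close> under Frobenius can be replaced by \<open>V\<close> as a
    whole.\<close>
  define \<Phi> where "\<Phi> = (\<lambda>V W B. \<forall>s\<in>carrier (sec X W). \<exists>c. (\<forall>b\<in>B. c b \<in> carrier (sec X V)) \<and>
        s = (\<Oplus>\<^bsub>sec X W\<^esub> b\<in>B. comor ?F V (c b) \<otimes>\<^bsub>sec X W\<^esub> b))"
  have "\<exists>V. affine_open X V \<and> x \<in> V \<and> affine_open X (preim X ?F V) \<and>
    (\<exists>B\<subseteq>carrier (sec X (preim X ?F V)). finite B \<and> \<Phi> V (preim X ?F V) B)"
    using F_finite assms unfolding F_finite_def finite_morphism_def \<Phi>_def by (elim conjE bspec)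
  then obtain V B where V: "affine_open X V" "x \<in> V"
    and "B \<subseteq> carrier (sec X (preim X ?F V))" and B: "finite B" and "\<Phi> V (preim X ?F V) B"
    by blast
  then have B: "B \<subseteq> carrier (sec X V)" "finite B" and "\<Phi> V V B"
    using preim_frobenius[OF affine_open_openin[OF V(1)]] by simp_all
  note gen = this(3)[unfolded \<Phi>_def, rule_format]
  have oV: "openin (topo X) V" "V \<noteq> {}" using V affine_open_openin by auto
  let ?\<gamma> = "germ_of X (generic_point X) V"
  interpret h: ring_hom_ring "sec X V" K ?\<gamma> by (rule generic_germ_ring_hom[OF oV])
  show ?thesis
  proof (rule that[OF V, of "?\<gamma> ` B"])
    show "finite (?\<gamma> ` B)" "?\<gamma> ` B \<subseteq> sec_in X V" using B by (auto simp: sec_in_def)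
    fix M assume M: "M \<subseteq> carrier K" "\<zero>\<^bsub>K\<^esub> \<in> M" "\<And>a b. a \<in> M \<Longrightarrow> b \<in> M \<Longrightarrow> a \<oplus>\<^bsub>K\<^esub> b \<in> M"
      "\<And>u b. u \<in> sec_in X V \<Longrightarrow> b \<in> ?\<gamma> ` B \<Longrightarrow> u [^]\<^bsub>K\<^esub> p \<otimes>\<^bsub>K\<^esub> b \<in> M"
    define N where "N = {t \<in> carrier (sec X V). ?\<gamma> t \<in> M}"
    have "s \<in> N" if s: "s \<in> carrier (sec X V)" for s
    proof -
      obtain c where c: "\<forall>b\<in>B. c b \<in> carrier (sec X V)"
        "s = (\<Oplus>\<^bsub>sec X V\<^esub> b\<in>B. comor ?F V (c b) \<otimes>\<^bsub>sec X V\<^esub> b)" using gen[OF s] by blast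
      show ?thesis unfolding c(2)
      proof (rule h.R.finsum_mem_submonoid[OF B(2)])
        show "N \<subseteq> carrier (sec X V)" "\<zero>\<^bsub>sec X V\<^esub> \<in> N" using M(2) by (auto simp: N_def)
        show "a \<oplus>\<^bsub>sec X V\<^esub> b \<in> N" if "a \<in> N" "b \<in> N" for a b using that M(3) by (simp add: N_def)
        fix b assume b: "b \<in> B"
        have cb: "c b \<in> carrier (sec X V)" "b \<in> carrier (sec X V)" using c(1) b B by auto
        have "?\<gamma> (c b) [^]\<^bsub>K\<^esub> p \<otimes>\<^bsub>K\<^esub> ?\<gamma> b \<in> M" using M(4) cb b by (simp add: sec_in_def)
        then show "comor ?F V (c b) \<otimes>\<^bsub>sec X V\<^esub> b \<in> N"
          using cb by (simp add: N_def frobenius_def h.hom_nat_pow)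
      qed
    qed
    then show "sec_in X V \<subseteq> M" unfolding N_def sec_in_def by blast
  qed
qed

text \<open>Finiteness is available for a single Frobenius only, so higher powers are reached by
  induction on \<open>e\<close>. For \<open>e = 0\<close> the map is multiplication by
  \<open>\<psi> 1\<close>, and a denominator of that one value is enough. Linearity of
  \<open>\<psi>\<close> is asked for on sections alone, because the induction replaces
  \<open>\<psi>\<close> by maps built from sections.\<close>

lemma common_denominator:
  assumes V: "affine_open X V" "V \<noteq> {}" and B: "finite B" "B \<subseteq> sec_in X V"
    and gen: "\<And>M. \<lbrakk>M \<subseteq> carrier K; \<zero>\<^bsub>K\<^esub> \<in> M; \<And>a b. a \<in> M \<Longrightarrow> b \<in> M \<Longrightarrow> a \<oplus>\<^bsub>K\<^esub> b \<in> M;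
        \<And>u b. u \<in> sec_in X V \<Longrightarrow> b \<in> B \<Longrightarrow> u [^]\<^bsub>K\<^esub> p \<otimes>\<^bsub>K\<^esub> b \<in> M\<rbrakk> \<Longrightarrow> sec_in X V \<subseteq> M"
    and S: "S \<subseteq> sec_in X V" "\<one>\<^bsub>K\<^esub> \<in> S" "\<And>s t. s \<in> S \<Longrightarrow> t \<in> S \<Longrightarrow> s \<otimes>\<^bsub>K\<^esub> t \<in> S"
    and \<psi>: "\<And>a. a \<in> sec_in X V \<Longrightarrow> \<psi> a \<in> carrier K"
      "\<And>a b. a \<in> sec_in X V \<Longrightarrow> b \<in> sec_in X V \<Longrightarrow> \<psi> (a \<oplus>\<^bsub>K\<^esub> b) = \<psi> a \<oplus>\<^bsub>K\<^esub> \<psi> b"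
      "\<And>a b. a \<in> sec_in X V \<Longrightarrow> b \<in> sec_in X V \<Longrightarrow> \<psi> (a [^]\<^bsub>K\<^esub> (p ^ e) \<otimes>\<^bsub>K\<^esub> b) = a \<otimes>\<^bsub>K\<^esub> \<psi> b"
      "\<And>a. a \<in> sec_in X V \<Longrightarrow> \<exists>s\<in>S. s \<otimes>\<^bsub>K\<^esub> \<psi> a \<in> sec_in X V"
  shows "\<exists>s\<in>S. \<forall>a\<in>sec_in X V. s \<otimes>\<^bsub>K\<^esub> \<psi> a \<in> sec_in X V"
  using \<psi>
proof (induction e arbitrary: \<psi>)
  have oV: "openin (topo X) V" using V affine_open_openin by auto
  note sub = subringE[OF sec_in_subring[OF oV V(2)]]
  have cK: "a \<in> carrier K" if "a \<in> sec_in X V" for a using sub(1) that by blast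
  {
    case 0
    have eq: "\<psi> a = a \<otimes>\<^bsub>K\<^esub> \<psi> \<one>\<^bsub>K\<^esub>" if "a \<in> sec_in X V" for a
      using 0(3)[OF that sub(3)] cK[OF that] by simp
    obtain s where s: "s \<in> S" "s \<otimes>\<^bsub>K\<^esub> \<psi> \<one>\<^bsub>K\<^esub> \<in> sec_in X V" using 0(4)[OF sub(3)] by blast
    have "s \<otimes>\<^bsub>K\<^esub> \<psi> a \<in> sec_in X V" if a: "a \<in> sec_in X V" for a
    proof -
      have c: "s \<in> carrier K" "\<psi> \<one>\<^bsub>K\<^esub> \<in> carrier K" using S(1) s(1) cK 0(1)[OF sub(3)] by auto
      have "s \<otimes>\<^bsub>K\<^esub> \<psi> a = a \<otimes>\<^bsub>K\<^esub> (s \<otimes>\<^bsub>K\<^esub> \<psi> \<one>\<^bsub>K\<^esub>)"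
        unfolding eq[OF a] using cK[OF a] c by (simp add: K.m_ac)
      then show ?thesis using sub(6)[OF a s(2)] by simp
    qed
    then show ?case using s(1) by blast
  next
    case (Suc e)
    have pA: "u [^]\<^bsub>K\<^esub> (n::nat) \<in> sec_in X V" if "u \<in> sec_in X V" for u n
      using subring_pow_closed[OF sec_in_subring[OF oV V(2)] that] .
    \<comment> \<open>The induction hypothesis is applied to
      \<open>u \<mapsto> \<psi> (u^p * b)\<close>: if \<open>\<psi>\<close> is linear over
      \<open>p^(e+1)\<close>-th powers, this map is linear over \<open>p^e\<close>-th
      powers.\<close>
    have one_gen: "\<exists>s\<in>S. \<forall>u\<in>sec_in X V. s \<otimes>\<^bsub>K\<^esub> \<psi> (u [^]\<^bsub>K\<^esub> p \<otimes>\<^bsub>K\<^esub> b) \<in> sec_in X V" if b: "b \<in> B" for b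
    proof (rule Suc.IH)
      have bA: "b \<in> sec_in X V" using b B by blast
      fix a u assume a: "a \<in> sec_in X V"
      show "\<psi> (a [^]\<^bsub>K\<^esub> p \<otimes>\<^bsub>K\<^esub> b) \<in> carrier K" using Suc.prems(1) sub(6) pA a bA by blast
      show "\<exists>s\<in>S. s \<otimes>\<^bsub>K\<^esub> \<psi> (a [^]\<^bsub>K\<^esub> p \<otimes>\<^bsub>K\<^esub> b) \<in> sec_in X V" using Suc.prems(4) sub(6) pA a bA by blast
      assume u: "u \<in> sec_in X V"
      have "(a \<oplus>\<^bsub>K\<^esub> u) [^]\<^bsub>K\<^esub> p \<otimes>\<^bsub>K\<^esub> b = a [^]\<^bsub>K\<^esub> p \<otimes>\<^bsub>K\<^esub> b \<oplus>\<^bsub>K\<^esub> u [^]\<^bsub>K\<^esub> p \<otimes>\<^bsub>K\<^esub> b"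
        using a u bA cK by (simp add: frobenius_add K.l_distr)
      then show "\<psi> ((a \<oplus>\<^bsub>K\<^esub> u) [^]\<^bsub>K\<^esub> p \<otimes>\<^bsub>K\<^esub> b) = \<psi> (a [^]\<^bsub>K\<^esub> p \<otimes>\<^bsub>K\<^esub> b) \<oplus>\<^bsub>K\<^esub> \<psi> (u [^]\<^bsub>K\<^esub> p \<otimes>\<^bsub>K\<^esub> b)"
        using Suc.prems(2)[of "a [^]\<^bsub>K\<^esub> p \<otimes>\<^bsub>K\<^esub> b" "u [^]\<^bsub>K\<^esub> p \<otimes>\<^bsub>K\<^esub> b"] sub(6) pA a u bA by simp
      have "(a [^]\<^bsub>K\<^esub> (p ^ e) \<otimes>\<^bsub>K\<^esub> u) [^]\<^bsub>K\<^esub> p \<otimes>\<^bsub>K\<^esub> b = a [^]\<^bsub>K\<^esub> (p ^ Suc e) \<otimes>\<^bsub>K\<^esub> (u [^]\<^bsub>K\<^esub> p \<otimes>\<^bsub>K\<^esub> b)"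
        using a u bA cK by (simp add: K.nat_pow_distrib K.nat_pow_pow K.m_assoc mult.commute)
      then show "\<psi> ((a [^]\<^bsub>K\<^esub> (p ^ e) \<otimes>\<^bsub>K\<^esub> u) [^]\<^bsub>K\<^esub> p \<otimes>\<^bsub>K\<^esub> b) = a \<otimes>\<^bsub>K\<^esub> \<psi> (u [^]\<^bsub>K\<^esub> p \<otimes>\<^bsub>K\<^esub> b)"
        using Suc.prems(3)[OF a, of "u [^]\<^bsub>K\<^esub> p \<otimes>\<^bsub>K\<^esub> b"] sub(6) pA u bA by simp
    qed
    \<comment> \<open>The denominators found for the single generators are multiplied; the
      additional factors are sections and do no harm.\<close>
    have "\<exists>s\<in>S. \<forall>b\<in>B'. \<forall>u\<in>sec_in X V. s \<otimes>\<^bsub>K\<^esub> \<psi> (u [^]\<^bsub>K\<^esub> p \<otimes>\<^bsub>K\<^esub> b) \<in> sec_in X V"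
      if "B' \<subseteq> B" for B'
      using finite_subset[OF that B(1)] that
    proof (induction B' rule: finite_induct)
      case empty
      then show ?case using S(2) by blast
    next
      case (insert b B')
      obtain s where s: "s \<in> S" "\<forall>b\<in>B'. \<forall>u\<in>sec_in X V. s \<otimes>\<^bsub>K\<^esub> \<psi> (u [^]\<^bsub>K\<^esub> p \<otimes>\<^bsub>K\<^esub> b) \<in> sec_in X V"
        using insert by auto
      obtain t where t: "t \<in> S" "\<forall>u\<in>sec_in X V. t \<otimes>\<^bsub>K\<^esub> \<psi> (u [^]\<^bsub>K\<^esub> p \<otimes>\<^bsub>K\<^esub> b) \<in> sec_in X V"
        using one_gen[of b] insert.prems by auto
      have st: "s \<in> sec_in X V" "t \<in> sec_in X V" using s t S(1) by auto
      have "(s \<otimes>\<^bsub>K\<^esub> t) \<otimes>\<^bsub>K\<^esub> \<psi> (u [^]\<^bsub>K\<^esub> p \<otimes>\<^bsub>K\<^esub> c) \<in> sec_in X V" if c: "c \<in> insert b B'" "u \<in> sec_in X V" for c u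
      proof -
        have "u [^]\<^bsub>K\<^esub> p \<otimes>\<^bsub>K\<^esub> c \<in> sec_in X V" 
          using sub(6)[OF pA[OF c(2)]] c(1) insert.prems B(2) by (meson subset_iff)
        then have k: "\<psi> (u [^]\<^bsub>K\<^esub> p \<otimes>\<^bsub>K\<^esub> c) \<in> carrier K" using Suc.prems(1) by blast
        have stK: "s \<in> carrier K" "t \<in> carrier K" using st cK by auto
        have e: "(s \<otimes>\<^bsub>K\<^esub> t) \<otimes>\<^bsub>K\<^esub> \<psi> (u [^]\<^bsub>K\<^esub> p \<otimes>\<^bsub>K\<^esub> c) = t \<otimes>\<^bsub>K\<^esub> (s \<otimes>\<^bsub>K\<^esub> \<psi> (u [^]\<^bsub>K\<^esub> p \<otimes>\<^bsub>K\<^esub> c))"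
          "(s \<otimes>\<^bsub>K\<^esub> t) \<otimes>\<^bsub>K\<^esub> \<psi> (u [^]\<^bsub>K\<^esub> p \<otimes>\<^bsub>K\<^esub> c) = s \<otimes>\<^bsub>K\<^esub> (t \<otimes>\<^bsub>K\<^esub> \<psi> (u [^]\<^bsub>K\<^esub> p \<otimes>\<^bsub>K\<^esub> c))"
          using K.m_assoc[OF stK k] K.m_assoc[OF stK(2,1) k] K.m_comm[OF stK] by simp_all
        show ?thesis
        proof (cases "c = b")
          case True
          then show ?thesis unfolding e(2) using sub(6)[OF st(1)] t(2) c by blast
        next
          case False
          then show ?thesis unfolding e(1) using sub(6)[OF st(2)] s(2) c by blast
        qed
      qed
      then show ?case using S(3)[OF s(1) t(1)] by blast
    qed
    from this[OF subset_refl] obtain s where s1: "s \<in> S"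
      and s2: "\<forall>b\<in>B. \<forall>u\<in>sec_in X V. s \<otimes>\<^bsub>K\<^esub> \<psi> (u [^]\<^bsub>K\<^esub> p \<otimes>\<^bsub>K\<^esub> b) \<in> sec_in X V"
      by (rule bexE)
    note s = s1 s2[rule_format]
    have sc: "s \<in> carrier K" using s(1) S(1) cK by blast
    \<comment> \<open>The sections on which \<open>s\<close> works form an additive set containing
      all \<open>u^p * b\<close>, so \<open>gen\<close> shows that it is everything.\<close>
    define M where "M = {a \<in> sec_in X V. s \<otimes>\<^bsub>K\<^esub> \<psi> a \<in> sec_in X V}"
    have "sec_in X V \<subseteq> M"
    proof (rule gen)
      show "M \<subseteq> carrier K" using cK by (auto simp: M_def)
      have z: "\<psi> \<zero>\<^bsub>K\<^esub> \<in> carrier K" using Suc.prems(1) sub(2) by blast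
      have "\<psi> (\<zero>\<^bsub>K\<^esub> [^]\<^bsub>K\<^esub> (p ^ Suc e) \<otimes>\<^bsub>K\<^esub> \<zero>\<^bsub>K\<^esub>) = \<zero>\<^bsub>K\<^esub> \<otimes>\<^bsub>K\<^esub> \<psi> \<zero>\<^bsub>K\<^esub>" by (rule Suc.prems(3)[OF sub(2,2)])
      then have "\<psi> \<zero>\<^bsub>K\<^esub> = \<zero>\<^bsub>K\<^esub>" using z by simp
      then show "\<zero>\<^bsub>K\<^esub> \<in> M" using sub(2) sc by (simp add: M_def)
      show "a \<oplus>\<^bsub>K\<^esub> b \<in> M" if "a \<in> M" "b \<in> M" for a b
        using that sub(7) Suc.prems(1,2) sc by (simp add: M_def K.r_distr)
      show "u [^]\<^bsub>K\<^esub> p \<otimes>\<^bsub>K\<^esub> b \<in> M" if "u \<in> sec_in X V" "b \<in> B" for u b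
        using that s(2) sub(6) pA B(2) by (auto simp: M_def)
    qed
    then show ?case using s(1) unfolding M_def by blast
  }
qed

end

section \<open>Cartier algebras\<close>

context F_finite_integral_scheme
begin

abbreviation cartier_stalk :: "'x \<Rightarrow> nat \<Rightarrow> (('x, 'a) germ \<Rightarrow> ('x, 'a) germ) set" ("\<C>") where
  "\<C> x e \<equiv> map_stalk X (full_cartier X p) x e"

lemma cartier_stalkI:
  assumes "openin (topo X) U" "x \<in> U" "p_linear K p e \<psi>"
    and "\<And>V k. openin (topo X) V \<Longrightarrow> V \<noteq> {} \<Longrightarrow> V \<subseteq> U \<Longrightarrow> k \<in> sec_in X V \<Longrightarrow> \<psi> k \<in> sec_in X V"
  shows "\<psi> \<in> \<C> x e"
proof -
  have "\<psi> \<in> full_cartier X p U e" using assms(3,4) by (auto simp: full_cartier_def)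
  then show ?thesis using assms(1,2) unfolding map_stalk_def by blast
qed

lemma cartier_stalkE:
  assumes "\<psi> \<in> \<C> x e"
  obtains U where "openin (topo X) U" "x \<in> U" "\<psi> \<in> full_cartier X p U e"
  using assms unfolding map_stalk_def by blast

lemma full_cartier_sec_in:
  "\<psi> \<in> full_cartier X p U e \<Longrightarrow> openin (topo X) V \<Longrightarrow> V \<noteq> {} \<Longrightarrow> V \<subseteq> U \<Longrightarrow> k \<in> sec_in X V \<Longrightarrow> \<psi> k \<in> sec_in X V"
  unfolding full_cartier_def by blast

section \<open>Operations on \<open>p^(-e)\<close>-linear maps and on Cartier stalks\<close>

lemma p_linear_closed: "p_linear K p e \<psi> \<Longrightarrow> k \<in> carrier K \<Longrightarrow> \<psi> k \<in> carrier K"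
  and p_linear_add: "p_linear K p e \<psi> \<Longrightarrow> k \<in> carrier K \<Longrightarrow> l \<in> carrier K \<Longrightarrow> \<psi> (k \<oplus>\<^bsub>K\<^esub> l) = \<psi> k \<oplus>\<^bsub>K\<^esub> \<psi> l"
  and p_linear_pow: "p_linear K p e \<psi> \<Longrightarrow> k \<in> carrier K \<Longrightarrow> l \<in> carrier K \<Longrightarrow> \<psi> (k [^]\<^bsub>K\<^esub> (p ^ e) \<otimes>\<^bsub>K\<^esub> l) = k \<otimes>\<^bsub>K\<^esub> \<psi> l"
  by (simp_all add: p_linear_def)

lemma cartier_local:
  assumes "\<psi> \<in> \<C> x e" "k \<in> local_at X x"
  shows "\<psi> k \<in> local_at X x"
proof -
  obtain U where U: "openin (topo X) U" "x \<in> U"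
    "\<psi> \<in> full_cartier X p U e"
    by (rule cartier_stalkE[OF assms(1)])
  obtain W where W: "openin (topo X) W" "x \<in> W" "k \<in> sec_in X W" by (rule local_atE[OF assms(2)])
  have o: "openin (topo X) (U \<inter> W)" "U \<inter> W \<noteq> {}" "x \<in> U \<inter> W" using U(1,2) W by auto
  have "k \<in> sec_in X (U \<inter> W)" using sec_in_mono[OF W(1) o(1,2)] W(3) by blast
  then have "\<psi> k \<in> sec_in X (U \<inter> W)" by (intro full_cartier_sec_in[OF U(3) o(1,2)]) auto
  then show ?thesis by (rule local_atI[OF o(1,3)])
qed

lemma p_linear_premult:
  assumes "p_linear K p e \<psi>" "a \<in> carrier K"
  shows "p_linear K p e (\<lambda>k. \<psi> (a \<otimes>\<^bsub>K\<^esub> k))"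
  unfolding p_linear_def
proof (intro conjI ballI)
  fix f g assume f: "f \<in> carrier K"
  show "\<psi> (a \<otimes>\<^bsub>K\<^esub> f) \<in> carrier K" using assms f p_linear_closed by simp
  assume g: "g \<in> carrier K"
  show "\<psi> (a \<otimes>\<^bsub>K\<^esub> (f \<oplus>\<^bsub>K\<^esub> g)) = \<psi> (a \<otimes>\<^bsub>K\<^esub> f) \<oplus>\<^bsub>K\<^esub> \<psi> (a \<otimes>\<^bsub>K\<^esub> g)"
    using assms f g p_linear_add[OF assms(1)] by (simp add: K.r_distr)
  have "a \<otimes>\<^bsub>K\<^esub> (f [^]\<^bsub>K\<^esub> (p ^ e) \<otimes>\<^bsub>K\<^esub> g) = f [^]\<^bsub>K\<^esub> (p ^ e) \<otimes>\<^bsub>K\<^esub> (a \<otimes>\<^bsub>K\<^esub> g)"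
    using assms(2) f g by (simp add: K.m_lcomm)
  then show "\<psi> (a \<otimes>\<^bsub>K\<^esub> (f [^]\<^bsub>K\<^esub> (p ^ e) \<otimes>\<^bsub>K\<^esub> g)) = f \<otimes>\<^bsub>K\<^esub> \<psi> (a \<otimes>\<^bsub>K\<^esub> g)"
    using p_linear_pow[OF assms(1) f] assms(2) g by simp
qed

lemma p_linear_postmult:
  assumes "p_linear K p e \<psi>" "a \<in> carrier K"
  shows "p_linear K p e (\<lambda>k. a \<otimes>\<^bsub>K\<^esub> \<psi> k)"
  using assms by (auto simp: p_linear_def K.r_distr K.m_lcomm)

lemma p_linear_comp:
  assumes "p_linear K p e \<psi>" "p_linear K p d \<phi>"
  shows "p_linear K p (e + d) (\<lambda>k. \<phi> (\<psi> k))"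
  unfolding p_linear_def
proof (intro conjI ballI)
  fix f g assume f: "f \<in> carrier K"
  show "\<phi> (\<psi> f) \<in> carrier K" using assms f p_linear_closed by blast
  assume g: "g \<in> carrier K"
  show "\<phi> (\<psi> (f \<oplus>\<^bsub>K\<^esub> g)) = \<phi> (\<psi> f) \<oplus>\<^bsub>K\<^esub> \<phi> (\<psi> g)"
    using p_linear_add[OF assms(1) f g] p_linear_add[OF assms(2)] p_linear_closed[OF assms(1)] f g by simp
  have "f [^]\<^bsub>K\<^esub> (p ^ (e + d)) = (f [^]\<^bsub>K\<^esub> (p ^ d)) [^]\<^bsub>K\<^esub> (p ^ e)"
    using f by (simp add: K.nat_pow_pow power_add mult.commute)
  then show "\<phi> (\<psi> (f [^]\<^bsub>K\<^esub> (p ^ (e + d)) \<otimes>\<^bsub>K\<^esub> g)) = f \<otimes>\<^bsub>K\<^esub> \<phi> (\<psi> g)"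
    using p_linear_pow[OF assms(1)] p_linear_pow[OF assms(2)] p_linear_closed[OF assms(1)] f g by simp
qed

lemma cartier_premult:
  assumes x: "x \<in> topspace (topo X)" and \<psi>: "\<psi> \<in> \<C> x e" and a: "a \<in> local_at X x"
  shows "(\<lambda>k. \<psi> (a \<otimes>\<^bsub>K\<^esub> k)) \<in> \<C> x e"
proof -
  obtain U where U: "openin (topo X) U" "x \<in> U"
    "\<psi> \<in> full_cartier X p U e"
    by (rule cartier_stalkE[OF \<psi>])
  obtain W where W: "openin (topo X) W" "x \<in> W" "a \<in> sec_in X W" by (rule local_atE[OF a])
  show ?thesis
  proof (rule cartier_stalkI[of "U \<inter> W"])
    show "openin (topo X) (U \<inter> W)" "x \<in> U \<inter> W" using U(1,2) W by auto
    show "p_linear K p e (\<lambda>k. \<psi> (a \<otimes>\<^bsub>K\<^esub> k))"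
      using p_linear_premult[OF map_stalk_p_linear[OF \<psi>] local_at_carrier[OF x a]] .
    fix V k assume V: "openin (topo X) V" "V \<noteq> {}" "V \<subseteq> U \<inter> W" and k: "k \<in> sec_in X V"
    have "V \<subseteq> U" "V \<subseteq> W" using V(3) by auto
    then have "a \<in> sec_in X V" using sec_in_mono[OF W(1) V(1,2)] W(3) by blast
    then have "a \<otimes>\<^bsub>K\<^esub> k \<in> sec_in X V" using subringE(6)[OF sec_in_subring[OF V(1,2)]] k by blast
    then show "\<psi> (a \<otimes>\<^bsub>K\<^esub> k) \<in> sec_in X V" by (rule full_cartier_sec_in[OF U(3) V(1,2) \<open>V \<subseteq> U\<close>])
  qed
qed

lemma cartier_comp:
  assumes \<psi>: "\<psi> \<in> \<C> x e" and \<phi>: "\<phi> \<in> \<C> x d"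
  shows "(\<lambda>k. \<phi> (\<psi> k)) \<in> \<C> x (e + d)"
proof -
  obtain U where U: "openin (topo X) U" "x \<in> U"
    "\<psi> \<in> full_cartier X p U e"
    by (rule cartier_stalkE[OF \<psi>])
  obtain W where W: "openin (topo X) W" "x \<in> W"
    "\<phi> \<in> full_cartier X p W d"
    by (rule cartier_stalkE[OF \<phi>])
  show ?thesis
  proof (rule cartier_stalkI[of "U \<inter> W"])
    show "openin (topo X) (U \<inter> W)" "x \<in> U \<inter> W" using U(1,2) W(1,2) by auto
    show "p_linear K p (e + d) (\<lambda>k. \<phi> (\<psi> k))"
      using p_linear_comp[OF map_stalk_p_linear[OF \<psi>] map_stalk_p_linear[OF \<phi>]] .
    fix V k assume V: "openin (topo X) V" "V \<noteq> {}" "V \<subseteq> U \<inter> W" and k: "k \<in> sec_in X V"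
    have "V \<subseteq> U" "V \<subseteq> W" using V(3) by auto
    then show "\<phi> (\<psi> k) \<in> sec_in X V" using full_cartier_sec_in[OF U(3) V(1,2) _ k] full_cartier_sec_in[OF W(3) V(1,2)] by blast
  qed
qed

text \<open>\<open>full_cartier\<close> imposes a condition on every smaller open set, but
  \<open>\<theta>\<close> commutes with localization: a denominator raised to a
  \<open>p^e\<close>-th power leaves \<open>\<theta>\<close> as the denominator itself. This settles
  small neighbourhoods of each point, and the sheaf property assembles them.\<close>

lemma affine_cartier:
  assumes V: "affine_open X V" "x \<in> V" and \<theta>: "p_linear K p e \<theta>"
    and A: "\<And>a. a \<in> sec_in X V \<Longrightarrow> \<theta> a \<in> sec_in X V"
  shows "\<theta> \<in> \<C> x e"
proof (rule cartier_stalkI[OF _ V(2) \<theta>])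
  have oV: "openin (topo X) V" "V \<noteq> {}" using V affine_open_openin by auto
  show "openin (topo X) V" by (rule oV)
  note sV = subringE[OF sec_in_subring[OF oV]] and pV = subring_pow_closed[OF sec_in_subring[OF oV]]
  fix W k assume W: "openin (topo X) W" "W \<noteq> {}" "W \<subseteq> V" and k: "k \<in> sec_in X W"
  define \<U> where "\<U> = {D. openin (topo X) D \<and> D \<noteq> {} \<and> D \<subseteq> W \<and> \<theta> k \<in> sec_in X D}"
  have kc: "k \<in> carrier K" using sec_in_carrier[OF W(1,2) k] .
  have "\<exists>D\<in>\<U>. y \<in> D" if y: "y \<in> W" for y
  proof -
    have yV: "y \<in> V" using y W by blast
    obtain h D u where h: "h \<in> sec_in X V" and D: "openin (topo X) D" "y \<in> D" "D \<subseteq> W" "D \<subseteq> V"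
      and u: "u \<in> sec_in X D" "h \<otimes>\<^bsub>K\<^esub> u = \<one>\<^bsub>K\<^esub>"
      and loc: "\<And>k. k \<in> sec_in X D \<Longrightarrow> \<exists>n::nat. k \<otimes>\<^bsub>K\<^esub> h [^]\<^bsub>K\<^esub> n \<in> sec_in X V"
      using affine_basis[OF V(1) yV W(1) y] by metis
    have ne: "D \<noteq> {}" using D(2) by blast
    note sD = subringE[OF sec_in_subring[OF D(1) ne]] and pD = subring_pow_closed[OF sec_in_subring[OF D(1) ne]]
    have "k \<in> sec_in X D" using sec_in_mono[OF W(1) D(1) ne D(3)] k by blast
    then obtain n :: nat where n: "k \<otimes>\<^bsub>K\<^esub> h [^]\<^bsub>K\<^esub> n \<in> sec_in X V" using loc by blast
    have c: "h \<in> carrier K" "u \<in> carrier K" using sV(1) sD(1) h u(1) by auto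
    define H where "H = h [^]\<^bsub>K\<^esub> n"
    define q where "q = p ^ e"
    have q: "q = Suc (q - 1)" using p_ge by (simp add: q_def)
    have Hc: "H \<in> carrier K" "H \<in> sec_in X V" using c pV[OF h] by (auto simp: H_def)
    have Hu: "(u [^]\<^bsub>K\<^esub> n) [^]\<^bsub>K\<^esub> q \<otimes>\<^bsub>K\<^esub> H [^]\<^bsub>K\<^esub> q = \<one>\<^bsub>K\<^esub>"
    proof -
      have "u [^]\<^bsub>K\<^esub> n \<otimes>\<^bsub>K\<^esub> H = (h \<otimes>\<^bsub>K\<^esub> u) [^]\<^bsub>K\<^esub> n" using c by (simp add: H_def K.nat_pow_distrib K.m_comm)
      then have 1: "u [^]\<^bsub>K\<^esub> n \<otimes>\<^bsub>K\<^esub> H = \<one>\<^bsub>K\<^esub>" using u(2) by simp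
      show ?thesis using K.nat_pow_distrib[of "u [^]\<^bsub>K\<^esub> n" H q] 1 c Hc by simp
    qed
    \<comment> \<open>\<open>k * H\<close> is already a section over \<open>V\<close>; the extra
      factor \<open>H^(q - 1)\<close> turns the denominator of \<open>k\<close> into the
      \<open>q\<close>-th power \<open>H^q\<close>.\<close>
    define b where "b = (k \<otimes>\<^bsub>K\<^esub> H) \<otimes>\<^bsub>K\<^esub> H [^]\<^bsub>K\<^esub> (q - 1)"
    have b: "b \<in> sec_in X V" unfolding b_def using sV(6) n pV[OF Hc(2)] by (simp add: H_def)
    have bq: "b = k \<otimes>\<^bsub>K\<^esub> H [^]\<^bsub>K\<^esub> q"
      unfolding b_def using kc Hc by (subst q) (simp add: K.m_ac)
    have "(u [^]\<^bsub>K\<^esub> n) [^]\<^bsub>K\<^esub> q \<otimes>\<^bsub>K\<^esub> b = k \<otimes>\<^bsub>K\<^esub> ((u [^]\<^bsub>K\<^esub> n) [^]\<^bsub>K\<^esub> q \<otimes>\<^bsub>K\<^esub> H [^]\<^bsub>K\<^esub> q)"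
      unfolding bq using kc Hc c by (simp add: K.m_lcomm)
    then have "k = (u [^]\<^bsub>K\<^esub> n) [^]\<^bsub>K\<^esub> q \<otimes>\<^bsub>K\<^esub> b" using Hu kc by simp
    then have "\<theta> k = u [^]\<^bsub>K\<^esub> n \<otimes>\<^bsub>K\<^esub> \<theta> b"
      using p_linear_pow[OF \<theta>, of "u [^]\<^bsub>K\<^esub> n" b] c b sV(1) by (auto simp: q_def)
    moreover have "\<theta> b \<in> sec_in X D" using A[OF b] sec_in_mono[OF oV(1) D(1) ne D(4)] by blast
    ultimately have "\<theta> k \<in> sec_in X D" using sD(6) pD[OF u(1)] by simp
    then show ?thesis using D ne unfolding \<U>_def by blast
  qed
  then have Un: "\<Union>\<U> = W" unfolding \<U>_def by blast
  then have "\<U> \<noteq> {}" using W(2) by blast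
  then have "\<theta> k \<in> sec_in X (\<Union>\<U>)" by (intro sec_in_sheaf) (simp_all add: \<U>_def)
  then show "\<theta> k \<in> sec_in X W" unfolding Un .
qed

section \<open>Compatible closures, normalization and denominators of maps\<close>

lemma cartier_generize:
  assumes "z \<in> topo X closure_of {x}" "\<psi> \<in> \<C> z e"
  shows "\<psi> \<in> \<C> x e"
proof -
  obtain U where U: "openin (topo X) U" "z \<in> U" "\<psi> \<in> full_cartier X p U e"
    using assms(2) unfolding map_stalk_def by blast
  have "x \<in> U" using assms(1) U(1,2) by (auto simp: in_closure_of)
  then show ?thesis using U unfolding map_stalk_def by blast
qed

text \<open>A map near a point \<open>z\<close> of the closure is also a map near \<open>x\<close>,
  and a function regular at \<open>z\<close> that vanishes at \<open>x\<close> vanishes at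
  \<open>z\<close>. So stability at the generic point of the closure controls all stalks.\<close>

lemma uniformly_compatible_closure:
  assumes x: "x \<in> topspace (topo X)"
    and stable: "\<And>e \<psi> a. e \<ge> 1 \<Longrightarrow> \<psi> \<in> \<C> x e \<Longrightarrow> a \<in> \<mm> x \<Longrightarrow> \<psi> a \<in> \<mm> x"
  shows "uniformly_compatible X (full_cartier X p) (topo X closure_of {x})"
  unfolding uniformly_compatible_def
proof (intro ballI allI impI subsetI)
  fix y e \<psi> k assume y: "y \<in> topspace (topo X)" and e: "1 \<le> e" and \<psi>: "\<psi> \<in> \<C> y e"
    and "k \<in> \<psi> ` ideal_stalk X (topo X closure_of {x}) y"
  then obtain g where g: "g \<in> ideal_stalk X (topo X closure_of {x}) y" and k: "k = \<psi> g" by blast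
  obtain W where W: "openin (topo X) W" "y \<in> W" "g \<in> sec_in X W"
    "\<And>z. z \<in> W \<Longrightarrow> z \<in> topo X closure_of {x} \<Longrightarrow> g \<in> \<mm> z"
    using g unfolding ideal_stalk_def by blast
  obtain U where U: "openin (topo X) U" "y \<in> U" "\<psi> \<in> full_cartier X p U e"
    using \<psi> unfolding map_stalk_def by blast
  have o: "openin (topo X) (U \<inter> W)" "U \<inter> W \<noteq> {}" "y \<in> U \<inter> W" using U(1,2) W by auto
  have "g \<in> sec_in X (U \<inter> W)" using sec_in_mono[OF W(1) o(1,2)] W(3) by blast
  then have \<psi>g: "\<psi> g \<in> sec_in X (U \<inter> W)" using U(3) o unfolding full_cartier_def by blast
  have "\<psi> g \<in> \<mm> z" if z: "z \<in> U \<inter> W" "z \<in> topo X closure_of {x}" for z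
  proof -
    have "z \<in> U" using z by blast
    then have "\<psi> \<in> \<C> z e" using U unfolding map_stalk_def by blast
    then have \<psi>x: "\<psi> \<in> \<C> x e" by (rule cartier_generize[OF z(2)])
    have "g \<in> \<mm> z" using W(4) z by blast
    have "x \<in> W" using z W(1) by (auto simp: in_closure_of)
    moreover have "x \<in> topo X closure_of {x}" using x by (auto simp: in_closure_of)
    ultimately have "\<psi> g \<in> \<mm> x" using stable[OF e \<psi>x] W(4) by blast
    then show ?thesis using max_ideal_specialization[OF z(2) x] local_atI[OF o(1) z(1) \<psi>g] by blast
  qed
  then show "k \<in> ideal_stalk X (topo X closure_of {x}) y"
    unfolding k ideal_stalk_def using o \<psi>g by blast
qed

text \<open>If \<open>u\<close> inverts the unit \<open>\<psi> g\<close>, then premultiplication by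
  \<open>u^(p^e)\<close> changes the value at \<open>g\<close> to
  \<open>u * \<psi> g = 1\<close>.\<close>

lemma cartier_normalize:
  assumes x: "x \<in> topspace (topo X)" and \<psi>: "\<psi> \<in> \<C> x e" and g: "g \<in> local_at X x" "\<psi> g \<notin> \<mm> x"
  obtains \<phi> where "\<phi> \<in> \<C> x e" "\<phi> g = \<one>\<^bsub>K\<^esub>"
proof -
  obtain u where u: "u \<in> local_at X x" "\<psi> g \<otimes>\<^bsub>K\<^esub> u = \<one>\<^bsub>K\<^esub>"
    using local_at_unit[OF x cartier_local[OF \<psi> g(1)] g(2)] by blast
  have uq: "u [^]\<^bsub>K\<^esub> (p ^ e) \<in> local_at X x" using subring_pow_closed[OF local_at_subring[OF x] u(1)] .
  have c: "u \<in> carrier K" "g \<in> carrier K" using u g local_at_carrier[OF x] by auto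
  note lin = map_stalk_p_linear[OF \<psi>]
  have "\<psi> (u [^]\<^bsub>K\<^esub> (p ^ e) \<otimes>\<^bsub>K\<^esub> g) = \<one>\<^bsub>K\<^esub>"
    using p_linear_pow[OF lin c] u(2) K.m_comm[OF p_linear_closed[OF lin c(2)] c(1)] by simp
  then show ?thesis using that[OF cartier_premult[OF x \<psi> uq]] by blast
qed

text \<open>The element \<open>k^(p^e) * g\<close> is a preimage of \<open>k\<close>.\<close>

lemma surjective_if_one:
  assumes x: "x \<in> topspace (topo X)" and \<psi>: "\<psi> \<in> \<C> x e" and g: "g \<in> local_at X x" "\<psi> g = \<one>\<^bsub>K\<^esub>"
  shows "\<psi> ` local_at X x = local_at X x"
proof
  show "\<psi> ` local_at X x \<subseteq> local_at X x" using cartier_local[OF \<psi>] by blast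
  show "local_at X x \<subseteq> \<psi> ` local_at X x"
  proof
    fix k assume k: "k \<in> local_at X x"
    have c: "k \<in> carrier K" "g \<in> carrier K" using k g local_at_carrier[OF x] by auto
    have "\<psi> (k [^]\<^bsub>K\<^esub> (p ^ e) \<otimes>\<^bsub>K\<^esub> g) = k"
      using p_linear_pow[OF map_stalk_p_linear[OF \<psi>] c] g(2) c by simp
    moreover have "k [^]\<^bsub>K\<^esub> (p ^ e) \<otimes>\<^bsub>K\<^esub> g \<in> local_at X x"
      using local_at_mult[OF x subring_pow_closed[OF local_at_subring[OF x] k] g(1)] .
    ultimately show "k \<in> \<psi> ` local_at X x" by (metis imageI)
  qed
qed

text \<open>The sections outside \<open>\<mm> z\<close> form a multiplicative set by primality, and
  \<open>affine_fraction\<close> supplies a denominator for each single value of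
  \<open>\<psi>\<close>. Finite generation makes one denominator serve for all values.\<close>

lemma denominators_outside_prime:
  assumes V: "affine_open X V" "z \<in> V" and B: "finite B" "B \<subseteq> sec_in X V"
    and gen: "\<And>M. \<lbrakk>M \<subseteq> carrier K; \<zero>\<^bsub>K\<^esub> \<in> M; \<And>a b. a \<in> M \<Longrightarrow> b \<in> M \<Longrightarrow> a \<oplus>\<^bsub>K\<^esub> b \<in> M;
        \<And>u b. u \<in> sec_in X V \<Longrightarrow> b \<in> B \<Longrightarrow> u [^]\<^bsub>K\<^esub> p \<otimes>\<^bsub>K\<^esub> b \<in> M\<rbrakk> \<Longrightarrow> sec_in X V \<subseteq> M"
    and \<psi>: "p_linear K p e \<psi>" "\<And>a. a \<in> sec_in X V \<Longrightarrow> \<psi> a \<in> local_at X z"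
  obtains s where "s \<in> sec_in X V" "s \<notin> \<mm> z" "\<forall>a\<in>sec_in X V. s \<otimes>\<^bsub>K\<^esub> \<psi> a \<in> sec_in X V"
proof -
  have oV: "openin (topo X) V" "V \<noteq> {}" using V affine_open_openin by auto
  have z: "z \<in> topspace (topo X)" using affine_topspace[OF V] .
  note sV = subringE[OF sec_in_subring[OF oV]] and loc = affine_sec_in_local[OF V]
  have cK: "a \<in> carrier K" if "a \<in> sec_in X V" for a using sV(1) that by blast
  have "\<exists>s\<in>sec_in X V - \<mm> z. \<forall>a\<in>sec_in X V. s \<otimes>\<^bsub>K\<^esub> \<psi> a \<in> sec_in X V"
  proof (rule common_denominator[OF V(1) oV(2) B gen])
    show "\<one>\<^bsub>K\<^esub> \<in> sec_in X V - \<mm> z" using sV(3) one_notin_max_ideal[OF z] by blast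
    show "s \<otimes>\<^bsub>K\<^esub> t \<in> sec_in X V - \<mm> z" if st: "s \<in> sec_in X V - \<mm> z" "t \<in> sec_in X V - \<mm> z" for s t
    proof -
      have "s \<in> sec_in X V" "t \<in> sec_in X V" "s \<notin> \<mm> z" "t \<notin> \<mm> z" using st by auto
      then show ?thesis using sV(6)[of s t] max_ideal_prime[OF z loc[of s] loc[of t]] by blast
    qed
    fix a b assume a: "a \<in> sec_in X V"
    show "\<psi> a \<in> carrier K" using p_linear_closed[OF \<psi>(1) cK[OF a]] .
    obtain s where s: "s \<in> sec_in X V" "s \<notin> \<mm> z" "\<psi> a \<otimes>\<^bsub>K\<^esub> s \<in> sec_in X V"
      by (rule affine_fraction[OF V \<psi>(2)[OF a]])
    have "s \<otimes>\<^bsub>K\<^esub> \<psi> a = \<psi> a \<otimes>\<^bsub>K\<^esub> s" using K.m_comm[OF cK[OF s(1)] p_linear_closed[OF \<psi>(1) cK[OF a]]] .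
    then show "\<exists>s\<in>sec_in X V - \<mm> z. s \<otimes>\<^bsub>K\<^esub> \<psi> a \<in> sec_in X V"
      using s by (intro bexI[of _ s]) auto
    assume b: "b \<in> sec_in X V"
    show "\<psi> (a \<oplus>\<^bsub>K\<^esub> b) = \<psi> a \<oplus>\<^bsub>K\<^esub> \<psi> b" using p_linear_add[OF \<psi>(1) cK[OF a] cK[OF b]] .
    show "\<psi> (a [^]\<^bsub>K\<^esub> (p ^ e) \<otimes>\<^bsub>K\<^esub> b) = a \<otimes>\<^bsub>K\<^esub> \<psi> b" using p_linear_pow[OF \<psi>(1) cK[OF a] cK[OF b]] .
  qed blast+
  then obtain s where s: "s \<in> sec_in X V - \<mm> z" and sA: "\<forall>a\<in>sec_in X V. s \<otimes>\<^bsub>K\<^esub> \<psi> a \<in> sec_in X V"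
    by (rule bexE)
  then show ?thesis using that by blast
qed

text \<open>The generic point is treated apart because the hypotheses of (3) are silent about its
  trivial valuation. The field splitting need not preserve sections over any open set; a common
  denominator \<open>s\<close> repairs this, and since \<open>s\<close> is nonzero, hence a unit at
  the generic point, the value at 1 can be normalized back to 1.\<close>

lemma generic_F_pure:
  "\<exists>\<psi>\<in>\<C> (generic_point X) 1. \<psi> ` local_at X (generic_point X) = local_at X (generic_point X)"
proof -
  let ?g = "generic_point X"
  obtain \<psi> where \<psi>: "p_linear K p 1 \<psi>" "\<psi> \<one>\<^bsub>K\<^esub> = \<one>\<^bsub>K\<^esub>" by (rule frobenius_splitting_exists)
  obtain s where s: "s \<notin> \<mm> ?g" "s \<in> carrier K" "(\<lambda>k. s \<otimes>\<^bsub>K\<^esub> \<psi> k) \<in> \<C> ?g 1"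
  proof (rule frobenius_generators[OF generic_in_topspace])
    fix V B assume V: "affine_open X V" "?g \<in> V" and B: "finite B" "B \<subseteq> sec_in X V"
      and gen: "\<And>M. \<lbrakk>M \<subseteq> carrier K; \<zero>\<^bsub>K\<^esub> \<in> M; \<And>a b. a \<in> M \<Longrightarrow> b \<in> M \<Longrightarrow> a \<oplus>\<^bsub>K\<^esub> b \<in> M;
        \<And>u b. u \<in> sec_in X V \<Longrightarrow> b \<in> B \<Longrightarrow> u [^]\<^bsub>K\<^esub> p \<otimes>\<^bsub>K\<^esub> b \<in> M\<rbrakk> \<Longrightarrow> sec_in X V \<subseteq> M"
    have sub: "sec_in X V \<subseteq> carrier K" using subringE(1)[OF affine_sec_in_subring[OF V]] .
    then have "\<psi> a \<in> local_at X ?g" if "a \<in> sec_in X V" for a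
      unfolding local_at_generic using p_linear_closed[OF \<psi>(1)] that by blast
    from denominators_outside_prime[OF V B gen \<psi>(1) this]
    obtain s where s: "s \<in> sec_in X V" "s \<notin> \<mm> ?g" "\<forall>a\<in>sec_in X V. s \<otimes>\<^bsub>K\<^esub> \<psi> a \<in> sec_in X V" by blast
    have sc: "s \<in> carrier K" using s(1) sub by blast
    have "(\<lambda>k. s \<otimes>\<^bsub>K\<^esub> \<psi> k) \<in> \<C> ?g 1"
      using s(3) by (intro affine_cartier[OF V p_linear_postmult[OF \<psi>(1) sc]]) blast
    then show thesis using that[OF s(2) sc] by blast
  qed
  have "(\<lambda>k. s \<otimes>\<^bsub>K\<^esub> \<psi> k) \<one>\<^bsub>K\<^esub> \<notin> \<mm> ?g" using s(1,2) \<psi>(2) by simp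
  then obtain \<phi> where \<phi>: "\<phi> \<in> \<C> ?g 1" "\<phi> \<one>\<^bsub>K\<^esub> = \<one>\<^bsub>K\<^esub>"
    by (rule cartier_normalize[OF generic_in_topspace s(3) local_at_one[OF generic_in_topspace]])
  show ?thesis
    using surjective_if_one[OF generic_in_topspace \<phi>(1) local_at_one[OF generic_in_topspace] \<phi>(2)] \<phi>(1) by blast
qed

end

section \<open>Trivial semivaluations\<close>

definition trivial_valuation :: "('k, 'm) ring_scheme \<Rightarrow> 'k \<Rightarrow> ereal" where
  "trivial_valuation F a = (if a = \<zero>\<^bsub>F\<^esub> then \<infinity> else 0)"

lemma (in "domain") is_valuation_trivial: "is_valuation R (trivial_valuation R)"
  by (auto simp: is_valuation_def trivial_valuation_def integral_iff)

text \<open>Each term is a quotient with positive denominator and numerator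
  \<open>0 - p^(n * e) * w (\<phi> f)\<close>, which is 0 or, when \<open>\<phi> f = 0\<close>,
  equal to \<open>-\<infinity>\<close>. The bound is termwise, whatever stalk the supremum ranges
  over.\<close>

lemma A_gen_trivial_le:
  assumes "p \<ge> 2"
  shows "A_gen F S R p D (trivial_valuation F) \<le> 0"
proof -
  have "E_quot p (n * e) f \<phi> (trivial_valuation F) \<le> 0"
    if "1 \<le> e" "1 \<le> n" "f \<noteq> \<zero>\<^bsub>F\<^esub>" for n e f \<phi>
  proof -
    have "1 < real p ^ (n * e)" using that assms by (intro one_less_power) auto
    then show ?thesis using that(3) by (simp add: E_quot_def trivial_valuation_def)
  qed
  then show ?thesis
    unfolding A_gen_def A_map_def by (intro SUP_least) auto
qed

context integral_scheme_space
begin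

section \<open>Residue fields as quotients of local rings\<close>

lemma local_ring_at_domain:
  assumes "x \<in> topspace (topo X)" shows "domain (local_ring_at X x)"
  unfolding local_ring_at_def by (rule K.subring_is_domain[OF local_at_subring[OF assms]])

lemma local_ring_at_simps:
  "carrier (local_ring_at X x) = local_at X x" "mult (local_ring_at X x) = mult K"
  "one (local_ring_at X x) = \<one>\<^bsub>K\<^esub>" "zero (local_ring_at X x) = \<zero>\<^bsub>K\<^esub>" "add (local_ring_at X x) = add K"
  by (simp_all add: local_ring_at_def)

lemma max_ideal_ideal:
  assumes x: "x \<in> topspace (topo X)" shows "ideal (\<mm> x) (local_ring_at X x)"
proof -
  interpret R: "domain" "local_ring_at X x" by (rule local_ring_at_domain[OF x])
  have sub: "\<mm> x \<subseteq> local_at X x" using max_idealD by blast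
  show ?thesis
  proof (rule idealI[OF R.ring_axioms])
    show "subgroup (\<mm> x) (add_monoid (local_ring_at X x))"
    proof (rule R.add.subgroupI)
      show "\<mm> x \<noteq> {}" using zero_in_max_ideal[OF x] by blast
      fix a assume a: "a \<in> \<mm> x"
      then have aL: "a \<in> carrier (local_ring_at X x)" using sub by (auto simp: local_ring_at_simps)
      have "\<ominus>\<^bsub>local_ring_at X x\<^esub> \<one>\<^bsub>local_ring_at X x\<^esub> \<in> local_at X x"
        using R.a_inv_closed[OF R.one_closed] by (simp add: local_ring_at_simps)
      from max_ideal_mult[OF x a this]
      have "(\<ominus>\<^bsub>local_ring_at X x\<^esub> \<one>\<^bsub>local_ring_at X x\<^esub>) \<otimes>\<^bsub>local_ring_at X x\<^esub> a \<in> \<mm> x"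
        by (simp add: local_ring_at_simps(2))
      then show "\<ominus>\<^bsub>local_ring_at X x\<^esub> a \<in> \<mm> x" using R.l_minus[OF R.one_closed aL] aL by simp
    next
      fix a b assume "a \<in> \<mm> x" "b \<in> \<mm> x"
      then show "a \<oplus>\<^bsub>local_ring_at X x\<^esub> b \<in> \<mm> x"
        using max_ideal_add[OF x] by (simp add: local_ring_at_simps)
    qed (use sub in \<open>simp add: local_ring_at_simps\<close>)
  next
    fix a b assume a: "a \<in> \<mm> x" and b: "b \<in> carrier (local_ring_at X x)"
    then show 1: "b \<otimes>\<^bsub>local_ring_at X x\<^esub> a \<in> \<mm> x"
      using max_ideal_mult[OF x] by (simp add: local_ring_at_simps)
    have "a \<in> carrier (local_ring_at X x)" using a sub by (auto simp: local_ring_at_simps)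
    then show "a \<otimes>\<^bsub>local_ring_at X x\<^esub> b \<in> \<mm> x" using 1 R.m_comm[OF _ b] by simp
  qed
qed

lemma max_ideal_maximal:
  assumes x: "x \<in> topspace (topo X)" shows "maximalideal (\<mm> x) (local_ring_at X x)"
proof (rule maximalidealI[OF max_ideal_ideal[OF x]])
  show "carrier (local_ring_at X x) \<noteq> \<mm> x"
    using one_notin_max_ideal[OF x] local_at_one[OF x] by (auto simp: local_ring_at_simps)
  fix J assume J: "ideal J (local_ring_at X x)" "\<mm> x \<subseteq> J" "J \<subseteq> carrier (local_ring_at X x)"
  interpret J: ideal J "local_ring_at X x" by (rule J(1))
  show "J = \<mm> x \<or> J = carrier (local_ring_at X x)"
  proof (cases "J \<subseteq> \<mm> x")
    case False
    then obtain a where a: "a \<in> J" "a \<notin> \<mm> x" by blast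
    then have aL: "a \<in> local_at X x" using J(3) by (auto simp: local_ring_at_simps)
    obtain b where b: "b \<in> local_at X x" "a \<otimes>\<^bsub>K\<^esub> b = \<one>\<^bsub>K\<^esub>" using local_at_unit[OF x aL a(2)] by blast
    have "\<one>\<^bsub>local_ring_at X x\<^esub> \<in> J"
      using J.I_r_closed[OF a(1), of b] b by (simp add: local_ring_at_simps)
    then show ?thesis using J.one_imp_carrier by blast
  qed (use J(2) in blast)
qed

lemma residue_field_field:
  assumes "x \<in> topspace (topo X)" shows "field (residue_field X x)"
  unfolding residue_field_def
  by (rule maximalideal.quotient_is_field[OF max_ideal_maximal[OF assms]])
    (use local_ring_at_domain[OF assms] in \<open>simp add: domain_def\<close>)

lemma residue_ring_hom:
  assumes "x \<in> topspace (topo X)"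
  shows "residue X x \<in> ring_hom (local_ring_at X x) (residue_field X x)"
proof -
  have "residue X x = (+>\<^bsub>local_ring_at X x\<^esub>) (\<mm> x)" by (simp add: residue_def fun_eq_iff)
  then show ?thesis
    unfolding residue_field_def using ideal.rcos_ring_hom[OF max_ideal_ideal[OF assms]] by simp
qed

lemma residue_field_zero: "\<zero>\<^bsub>residue_field X x\<^esub> = \<mm> x"
  by (simp add: residue_field_def FactRing_def)

lemma residue_field_carrier: "carrier (residue_field X x) = residue X x ` local_at X x"
proof -
  have "carrier (residue_field X x) = a_rcosets\<^bsub>local_ring_at X x\<^esub> (\<mm> x)"
    by (simp add: residue_field_def FactRing_def)
  also have "\<dots> = residue X x ` local_at X x"
    unfolding A_RCOSETS_def' residue_def local_ring_at_simps by blast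
  finally show ?thesis .
qed

lemma residue_eq_zero_iff:
  assumes x: "x \<in> topspace (topo X)" and a: "a \<in> local_at X x"
  shows "residue X x a = \<zero>\<^bsub>residue_field X x\<^esub> \<longleftrightarrow> a \<in> \<mm> x"
proof -
  interpret I: ideal "\<mm> x" "local_ring_at X x" by (rule max_ideal_ideal[OF x])
  have "a \<in> carrier (local_ring_at X x)" using a by (simp add: local_ring_at_simps)
  then show ?thesis unfolding residue_field_zero residue_def
    using I.a_rcos_self I.a_rcos_const by blast
qed

text \<open>\<open>induced_map\<close> evaluates a map on all elements of a coset, so these must be
  known to lie in the local ring.\<close>

lemma residue_subset:
  assumes x: "x \<in> topspace (topo X)" and a: "a \<in> local_at X x"
  shows "residue X x a \<subseteq> local_at X x" "a \<in> residue X x a"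
proof -
  interpret I: ideal "\<mm> x" "local_ring_at X x" by (rule max_ideal_ideal[OF x])
  have ac: "a \<in> carrier (local_ring_at X x)" using a by (simp add: local_ring_at_simps)
  show "a \<in> residue X x a" unfolding residue_def by (rule I.a_rcos_self[OF ac])
  show "residue X x a \<subseteq> local_at X x"
    using I.a_r_coset_subset_G[OF I.a_subset ac] by (simp add: residue_def local_ring_at_simps)
qed

lemma self_in_closure: "x \<in> topspace (topo X) \<Longrightarrow> x \<in> topo X closure_of {x}"
  by (auto simp: in_closure_of)

section \<open>The trivial valuation of a residue field and its center\<close>

lemma trivial_in_beth:
  assumes x: "x \<in> topspace (topo X)"
  shows "(trivial_valuation (residue_field X x), x) \<in> beth X"
proof -
  interpret F: field "residue_field X x" by (rule residue_field_field[OF x])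
  have "centered (topo X closure_of {x}) (closed_local_at X x) (trivial_valuation (residue_field X x))"
    unfolding centered_def using self_in_closure[OF x]
    by (intro bexI[of _ x]) (auto simp: trivial_valuation_def)
  then show ?thesis using x F.is_valuation_trivial by (simp add: beth_def)
qed

lemma trivial_not_generic:
  "x \<noteq> generic_point X \<Longrightarrow> \<not> trivial_generic X (trivial_valuation (residue_field X x), x)"
  by (simp add: trivial_generic_def)

text \<open>The trivial valuation dominates only rings without nonzero non-units. If this holds at a
  specialization \<open>z\<close>, an element \<open>a\<close> of \<open>\<mm> z\<close> outside
  \<open>\<mm> x\<close> has an inverse \<open>b\<close> modulo \<open>\<mm> x\<close> that is
  regular at \<open>z\<close>. Then \<open>1 - a * b\<close> lies in \<open>\<mm> x\<close>, hence
  in \<open>\<mm> z\<close>, and 1 would lie in \<open>\<mm> z\<close>. So the two points have the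
  same prime.\<close>

lemma center_trivial:
  assumes x: "x \<in> topspace (topo X)"
  shows "center (residue_field X x) (topo X closure_of {x}) (closed_local_at X x)
    (trivial_valuation (residue_field X x)) = x"
  unfolding center_def
proof (rule the_equality)
  let ?F = "residue_field X x"
  interpret F: field ?F by (rule residue_field_field[OF x])
  have dom: "val_dominates ?F S (trivial_valuation ?F) \<longleftrightarrow> max_ideal (?F\<lparr>carrier := S\<rparr>) \<subseteq> {\<zero>\<^bsub>?F\<^esub>}" for S
    by (auto simp: val_dominates_def trivial_valuation_def)
  have "max_ideal (?F\<lparr>carrier := closed_local_at X x x\<rparr>) = carrier ?F - Units ?F"
    by (simp add: max_ideal_def closed_local_at_def flip: residue_field_carrier)
  then show "x \<in> topo X closure_of {x} \<and> val_dominates ?F (closed_local_at X x x) (trivial_valuation ?F)"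
    unfolding dom using self_in_closure[OF x] F.field_Units by blast
  fix z assume "z \<in> topo X closure_of {x} \<and> val_dominates ?F (closed_local_at X x z) (trivial_valuation ?F)"
  then have z: "z \<in> topo X closure_of {x}"
    and fld: "max_ideal (?F\<lparr>carrier := closed_local_at X x z\<rparr>) \<subseteq> {\<zero>\<^bsub>?F\<^esub>}" by (auto simp: dom)
  have zt: "z \<in> topspace (topo X)" using z by (simp add: in_closure_of)
  obtain V where V: "affine_open X V" "z \<in> V" using affine_cover zt by blast
  have xV: "x \<in> V" using z V(2) affine_open_openin[OF V(1)] by (auto simp: in_closure_of)
  note gen = local_at_generization[OF z] and spec = max_ideal_specialization[OF z x]
  have "a \<in> \<mm> x" if a: "a \<in> \<mm> z" for a
  proof (rule ccontr)
    assume nx: "a \<notin> \<mm> x"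
    have az: "a \<in> local_at X z" using max_idealD[OF a] .
    then have ax: "a \<in> local_at X x" using gen by blast
    have "residue X x a \<noteq> \<zero>\<^bsub>?F\<^esub>" using residue_eq_zero_iff[OF x ax] nx by simp
    then have "residue X x a \<notin> max_ideal (?F\<lparr>carrier := closed_local_at X x z\<rparr>)" using fld by blast
    moreover have "residue X x a \<in> closed_local_at X x z" using az by (simp add: closed_local_at_def)
    ultimately obtain b where b: "b \<in> local_at X z" "residue X x a \<otimes>\<^bsub>?F\<^esub> residue X x b = \<one>\<^bsub>?F\<^esub>"
      by (auto simp: max_ideal_def Units_def closed_local_at_def)
    have bx: "b \<in> local_at X x" using gen b(1) by blast
    note hom = residue_ring_hom[OF x]
    interpret R: "domain" "local_ring_at X x" by (rule local_ring_at_domain[OF x])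
    interpret h: ring_hom_ring "local_ring_at X x" ?F "residue X x"
      by (rule ring_hom_ringI2[OF R.ring_axioms F.ring_axioms hom])
    define c where "c = \<one>\<^bsub>K\<^esub> \<ominus>\<^bsub>K\<^esub> a \<otimes>\<^bsub>K\<^esub> b"
    have abz: "a \<otimes>\<^bsub>K\<^esub> b \<in> local_at X z" using local_at_mult[OF zt az b(1)] .
    have cz: "c \<in> local_at X z" unfolding c_def K.minus_eq
      using local_at_add[OF zt local_at_one[OF zt] local_at_minus[OF zt abz]] .
    have cx: "c \<in> local_at X x" using gen cz by blast
    have kc: "a \<in> carrier K" "b \<in> carrier K" "c \<in> carrier K" using ax bx cx local_at_carrier[OF x] by auto
    have abx: "a \<otimes>\<^bsub>K\<^esub> b \<in> local_at X x" using gen abz by blast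
    have sum: "c \<oplus>\<^bsub>K\<^esub> a \<otimes>\<^bsub>K\<^esub> b = \<one>\<^bsub>K\<^esub>" unfolding c_def using kc(1,2) by algebra
    have "residue X x (c \<oplus>\<^bsub>K\<^esub> a \<otimes>\<^bsub>K\<^esub> b) = residue X x c \<oplus>\<^bsub>?F\<^esub> residue X x (a \<otimes>\<^bsub>K\<^esub> b)"
      using h.hom_add[of c "a \<otimes>\<^bsub>K\<^esub> b"] cx abx by (simp add: local_ring_at_simps)
    also have "residue X x (a \<otimes>\<^bsub>K\<^esub> b) = \<one>\<^bsub>?F\<^esub>"
      using h.hom_mult[of a b] ax bx b(2) by (simp add: local_ring_at_simps)
    finally have "\<one>\<^bsub>?F\<^esub> = residue X x c \<oplus>\<^bsub>?F\<^esub> \<one>\<^bsub>?F\<^esub>"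
      using sum h.hom_one by (simp add: local_ring_at_simps)
    moreover have rc: "residue X x c \<in> carrier ?F" unfolding residue_field_carrier using cx by blast
    ultimately have "residue X x c = \<zero>\<^bsub>?F\<^esub>" by (simp add: F.add.l_cancel_one')
    then have "c \<in> \<mm> x" using residue_eq_zero_iff[OF x cx] by simp
    then have "c \<in> \<mm> z" using spec cz by blast
    moreover have "a \<otimes>\<^bsub>K\<^esub> b \<in> \<mm> z"
      using max_ideal_mult[OF zt a b(1)] K.m_comm[OF kc(1,2)] by simp
    ultimately have "\<one>\<^bsub>K\<^esub> \<in> \<mm> z" using max_ideal_add[OF zt] sum by metis
    then show False using one_notin_max_ideal[OF zt] by blast
  qed
  then have "sec_in X V \<inter> \<mm> z = sec_in X V \<inter> \<mm> x"
    using spec affine_sec_in_local[OF V] by blast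
  then show "z = x" using affine_point_unique[OF V xV] by blast
qed

end

section \<open>F-purity and F-regularity from log discrepancies\<close>

context F_finite_integral_scheme
begin

section \<open>Log discrepancies of trivial semivaluations\<close>

lemma A_beth_trivial_le:
  assumes x: "x \<in> topspace (topo X)"
    and stable: "\<And>e \<psi> a. e \<ge> 1 \<Longrightarrow> \<psi> \<in> \<C> x e \<Longrightarrow> a \<in> \<mm> x \<Longrightarrow> \<psi> a \<in> \<mm> x"
  shows "A_beth X p (full_cartier X p) (trivial_valuation (residue_field X x), x) \<le> 0"
proof -
  have "uniformly_compatible X (full_cartier X p) (topo X closure_of {x})"
    by (rule uniformly_compatible_closure[OF x]) (rule stable)
  then show ?thesis using A_gen_trivial_le[OF p_ge] by (simp add: A_beth_def)
qed

text \<open>All induced maps at the center are zero, while the supremum admits nonzero maps only; it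
  runs over the empty set in every degree. Identifying the center as \<open>x\<close> is what tells
  which stalk supplies the maps.\<close>

lemma A_beth_trivial_minus_infinity:
  assumes x: "x \<in> topspace (topo X)"
    and vanish: "\<And>e \<psi> a. e \<ge> 1 \<Longrightarrow> \<psi> \<in> \<C> x e \<Longrightarrow> a \<in> local_at X x \<Longrightarrow> \<psi> a \<in> \<mm> x"
  shows "A_beth X p (full_cartier X p) (trivial_valuation (residue_field X x), x) = - \<infinity>"
proof -
  let ?F = "residue_field X x"
  have compat: "uniformly_compatible X (full_cartier X p) (topo X closure_of {x})"
    by (rule uniformly_compatible_closure[OF x]) (blast intro: vanish max_idealD)
  have empty: "{\<chi> \<in> induced_map X x ` \<C> x e. \<exists>f\<in>carrier ?F. \<chi> f \<noteq> \<zero>\<^bsub>?F\<^esub>} = {}" if e: "e \<ge> 1" for e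
  proof -
    have "induced_map X x \<psi> f = \<zero>\<^bsub>?F\<^esub>" if \<psi>: "\<psi> \<in> \<C> x e" and f: "f \<in> carrier ?F" for \<psi> f
    proof -
      obtain a where a: "a \<in> local_at X x" "f = residue X x a" using f unfolding residue_field_carrier by blast
      have zero: "residue X x (\<psi> b) = \<zero>\<^bsub>?F\<^esub>" if "b \<in> f" for b
      proof -
        have "b \<in> local_at X x" using that residue_subset(1)[OF x a(1)] a(2) by blast
        then show ?thesis using vanish[OF e \<psi>] residue_eq_zero_iff[OF x] max_idealD by blast
      qed
      \<comment> \<open>The coset is nonempty, so the image is exactly the singleton expected by
        \<open>the_elem\<close>.\<close>
      have "a \<in> f" using residue_subset(2)[OF x a(1)] a(2) by simp
      then have "(\<lambda>b. residue X x (\<psi> b)) ` f = {\<zero>\<^bsub>?F\<^esub>}" using zero by force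
      then show ?thesis by (simp add: induced_map_def)
    qed
    then show ?thesis by blast
  qed
  have "A_gen ?F (topo X closure_of {x}) (closed_local_at X x) p (\<lambda>z e. induced_map X x ` \<C> z e)
    (trivial_valuation ?F) \<le> - \<infinity>"
    unfolding A_gen_def center_trivial[OF x]
  proof (rule SUP_least)
    fix e :: nat assume "e \<in> {1..}"
    then have "1 \<le> e" by simp
    from empty[OF this]
    show "(SUP \<chi>\<in>{\<chi> \<in> induced_map X x ` \<C> x e. \<exists>f\<in>carrier ?F. \<chi> f \<noteq> \<zero>\<^bsub>?F\<^esub>}.
      A_map ?F p e \<chi> (trivial_valuation ?F)) \<le> - \<infinity>"
      by (simp only: SUP_empty bot_ereal_def order_refl)
  qed
  then show ?thesis using compat by (simp add: A_beth_def)
qed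

lemma F_pure_if_A_beth_nonneg:
  assumes H: "\<And>\<xi>. \<xi> \<in> beth X \<Longrightarrow> \<not> trivial_generic X \<xi> \<Longrightarrow> 0 \<le> A_beth X p (full_cartier X p) \<xi>"
  shows "F_pure X p"
  unfolding F_pure_def
proof (rule ballI)
  fix x assume x: "x \<in> topspace (topo X)"
  show "\<exists>e\<ge>1. \<exists>\<psi>\<in>\<C> x e. \<psi> ` local_at X x = local_at X x"
  proof (cases "x = generic_point X")
    case True
    then show ?thesis using generic_F_pure by blast
  next
    case False
    show ?thesis
    proof (rule ccontr)
      assume none: "\<not> ?thesis"
      \<comment> \<open>A single unit value would already suffice for F-purity: it can be normalized
        to 1, and a map taking the value 1 is surjective.\<close>
      have "\<psi> a \<in> \<mm> x" if e: "e \<ge> 1" and \<psi>: "\<psi> \<in> \<C> x e" and a: "a \<in> local_at X x" for e \<psi> a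
      proof (rule ccontr)
        assume "\<psi> a \<notin> \<mm> x"
        then obtain \<phi> where \<phi>: "\<phi> \<in> \<C> x e" "\<phi> a = \<one>\<^bsub>K\<^esub>" by (rule cartier_normalize[OF x \<psi> a])
        then have "\<phi> ` local_at X x = local_at X x" by (intro surjective_if_one[OF x \<phi>(1) a])
        then show False using \<phi>(1) none e by blast
      qed
      then have "A_beth X p (full_cartier X p) (trivial_valuation (residue_field X x), x) = - \<infinity>"
        by (rule A_beth_trivial_minus_infinity[OF x])
      then show False using H[OF trivial_in_beth[OF x] trivial_not_generic[OF False]] by simp
    qed
  qed
qed

text \<open>If \<open>X\<close> is F-pure at \<open>x\<close>, this is the largest proper ideal of the local ring at \<open>x\<close> that is
  stable under all \<open>p\<^sup>-\<^sup>e\<close>-linear maps.\<close>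

definition splitting_prime :: "'x \<Rightarrow> ('x, 'a) germ set" where
  "splitting_prime x = {g \<in> local_at X x. \<forall>e\<ge>1. \<forall>\<psi>\<in>\<C> x e. \<psi> g \<in> \<mm> x}"

text \<open>A map applied to \<open>\<psi> g\<close> is a composite map of positive degree applied
  to \<open>g\<close>.\<close>

lemma splitting_prime_stable:
  assumes "e \<ge> 1" "\<psi> \<in> \<C> x e" "g \<in> splitting_prime x"
  shows "\<psi> g \<in> splitting_prime x"
proof -
  have g: "g \<in> local_at X x" "\<And>e \<psi>. e \<ge> 1 \<Longrightarrow> \<psi> \<in> \<C> x e \<Longrightarrow> \<psi> g \<in> \<mm> x"
    using assms(3) by (auto simp: splitting_prime_def)
  have "\<phi> (\<psi> g) \<in> \<mm> x" if "d \<ge> 1" "\<phi> \<in> \<C> x d" for d \<phi>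
    using g(2)[OF _ cartier_comp[OF assms(2) that(2)]] that(1) by simp
  then show ?thesis using cartier_local[OF assms(2) g(1)] by (simp add: splitting_prime_def)
qed

lemma splitting_prime_add:
  assumes x: "x \<in> topspace (topo X)" and ab: "a \<in> splitting_prime x" "b \<in> splitting_prime x"
  shows "a \<oplus>\<^bsub>K\<^esub> b \<in> splitting_prime x"
proof -
  have c: "a \<in> local_at X x" "b \<in> local_at X x" using ab by (auto simp: splitting_prime_def)
  have "\<psi> (a \<oplus>\<^bsub>K\<^esub> b) \<in> \<mm> x" if "e \<ge> 1" "\<psi> \<in> \<C> x e" for e \<psi>
    using p_linear_add[OF map_stalk_p_linear[OF that(2)] local_at_carrier[OF x c(1)] local_at_carrier[OF x c(2)]]
      max_ideal_add[OF x] ab that by (simp add: splitting_prime_def)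
  then show ?thesis using local_at_add[OF x c] by (simp add: splitting_prime_def)
qed

lemma splitting_prime_mult:
  assumes x: "x \<in> topspace (topo X)" and a: "a \<in> splitting_prime x" and b: "b \<in> local_at X x"
  shows "b \<otimes>\<^bsub>K\<^esub> a \<in> splitting_prime x"
proof -
  have c: "a \<in> local_at X x" using a by (auto simp: splitting_prime_def)
  have "\<psi> (b \<otimes>\<^bsub>K\<^esub> a) \<in> \<mm> x" if "e \<ge> 1" "\<psi> \<in> \<C> x e" for e \<psi>
  proof -
    have "\<forall>\<phi>\<in>\<C> x e. \<phi> a \<in> \<mm> x" using a that(1) by (simp add: splitting_prime_def)
    then show ?thesis using cartier_premult[OF x that(2) b] by (rule bspec)
  qed
  then show ?thesis using local_at_mult[OF x b c] by (simp add: splitting_prime_def)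
qed

text \<open>If neither factor belongs to it, choose \<open>\<psi>\<close> of degree \<open>e\<close>
  with \<open>\<psi> a = 1\<close> and \<open>\<phi>\<close> with \<open>\<phi> b\<close> a unit.
  For \<open>q = p^e\<close> the map \<open>k \<mapsto> \<phi> (\<psi> (b^(q - 1) * k))\<close>
  sends \<open>a * b\<close> to \<open>\<phi> (b * \<psi> a) = \<phi> b\<close>, a unit, so the
  product does not belong to it either.\<close>

lemma splitting_prime_is_prime:
  assumes x: "x \<in> topspace (topo X)" and ab: "a \<in> local_at X x" "b \<in> local_at X x"
    and prod: "a \<otimes>\<^bsub>K\<^esub> b \<in> splitting_prime x"
  shows "a \<in> splitting_prime x \<or> b \<in> splitting_prime x"
proof (rule ccontr)
  assume "\<not> ?thesis"
  then obtain e \<psi>0 d \<phi> where e: "e \<ge> 1" and \<psi>0: "\<psi>0 \<in> \<C> x e" "\<psi>0 a \<notin> \<mm> x"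
    and d: "d \<ge> 1" and \<phi>: "\<phi> \<in> \<C> x d" "\<phi> b \<notin> \<mm> x"
    using ab unfolding splitting_prime_def by blast
  obtain \<psi> where \<psi>: "\<psi> \<in> \<C> x e" "\<psi> a = \<one>\<^bsub>K\<^esub>" by (rule cartier_normalize[OF x \<psi>0(1) ab(1) \<psi>0(2)])
  define q where "q = p ^ e"
  have q: "q = Suc (q - 1)" using p_ge by (simp add: q_def)
  have bq: "b [^]\<^bsub>K\<^esub> (q - 1) \<in> local_at X x" using subring_pow_closed[OF local_at_subring[OF x] ab(2)] .
  have c: "a \<in> carrier K" "b \<in> carrier K" using ab local_at_carrier[OF x] by auto
  have \<theta>: "(\<lambda>k. \<phi> (\<psi> (b [^]\<^bsub>K\<^esub> (q - 1) \<otimes>\<^bsub>K\<^esub> k))) \<in> \<C> x (e + d)"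
    by (rule cartier_comp[OF cartier_premult[OF x \<psi>(1) bq] \<phi>(1)])
  have "b [^]\<^bsub>K\<^esub> (q - 1) \<otimes>\<^bsub>K\<^esub> (a \<otimes>\<^bsub>K\<^esub> b) = b [^]\<^bsub>K\<^esub> q \<otimes>\<^bsub>K\<^esub> a"
    by (subst (2) q) (use c in \<open>simp add: K.m_ac\<close>)
  then have "\<psi> (b [^]\<^bsub>K\<^esub> (q - 1) \<otimes>\<^bsub>K\<^esub> (a \<otimes>\<^bsub>K\<^esub> b)) = b"
    using p_linear_pow[OF map_stalk_p_linear[OF \<psi>(1)] c(2,1)] \<psi>(2) c by (simp add: q_def)
  moreover have "\<phi> (\<psi> (b [^]\<^bsub>K\<^esub> (q - 1) \<otimes>\<^bsub>K\<^esub> (a \<otimes>\<^bsub>K\<^esub> b))) \<in> \<mm> x"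
  proof -
    have "1 \<le> e + d" using e by simp
    then have "\<forall>\<theta>\<in>\<C> x (e + d). \<theta> (a \<otimes>\<^bsub>K\<^esub> b) \<in> \<mm> x" using prod by (simp add: splitting_prime_def)
    then show ?thesis using \<theta> by (rule bspec)
  qed
  ultimately show False using \<phi>(2) by simp
qed

text \<open>With 1 it would contain, as an ideal, the element that F-purity maps to 1.\<close>

lemma splitting_prime_proper:
  assumes x: "x \<in> topspace (topo X)" and pure: "F_pure X p"
  shows "\<one>\<^bsub>K\<^esub> \<notin> splitting_prime x"
proof
  assume one: "\<one>\<^bsub>K\<^esub> \<in> splitting_prime x"
  obtain e \<psi> where e: "e \<ge> 1" and \<psi>: "\<psi> \<in> \<C> x e" "\<psi> ` local_at X x = local_at X x"
    using pure x unfolding F_pure_def by blast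
  have "\<one>\<^bsub>K\<^esub> \<in> \<psi> ` local_at X x" using \<psi>(2) local_at_one[OF x] by simp
  then obtain g where g: "g \<in> local_at X x" "\<psi> g = \<one>\<^bsub>K\<^esub>" by (metis imageE)
  have "g \<otimes>\<^bsub>K\<^esub> \<one>\<^bsub>K\<^esub> \<in> splitting_prime x" by (rule splitting_prime_mult[OF x one g(1)])
  then have "g \<in> splitting_prime x" using local_at_carrier[OF x g(1)] by simp
  then have "\<psi> g \<in> \<mm> x" using e \<psi>(1) unfolding splitting_prime_def by blast
  then show False using g(2) one_notin_max_ideal[OF x] by simp
qed

lemma F_regular_if_A_beth_pos:
  assumes H: "\<And>\<xi>. \<xi> \<in> beth X \<Longrightarrow> \<not> trivial_generic X \<xi> \<Longrightarrow> 0 < A_beth X p (full_cartier X p) \<xi>"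
  shows "F_regular X p"
  unfolding F_regular_def
proof (intro ballI)
  fix x f assume x: "x \<in> topspace (topo X)" and "f \<in> local_at X x - {\<zero>\<^bsub>K\<^esub>}"
  then have f: "f \<in> local_at X x" "f \<noteq> \<zero>\<^bsub>K\<^esub>" by auto
  \<comment> \<open>F-purity comes first, because it keeps the splitting prime proper.\<close>
  have pure: "F_pure X p" using H by (intro F_pure_if_A_beth_nonneg order.strict_implies_order)
  show "\<exists>e\<ge>1. \<exists>\<psi>\<in>\<C> x e. \<psi> f = \<one>\<^bsub>K\<^esub>"
  proof (rule ccontr)
    assume none: "\<not> ?thesis"
    let ?P = "splitting_prime x"
    have fP: "f \<in> ?P"
    proof -
      have "\<psi> f \<in> \<mm> x" if e: "e \<ge> 1" and \<psi>: "\<psi> \<in> \<C> x e" for e \<psi>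
      proof (rule ccontr)
        assume "\<psi> f \<notin> \<mm> x"
        then obtain \<phi> where "\<phi> \<in> \<C> x e" "\<phi> f = \<one>\<^bsub>K\<^esub>" by (rule cartier_normalize[OF x \<psi> f(1)])
        then show False using none e by blast
      qed
      then show ?thesis using f(1) by (simp add: splitting_prime_def)
    qed
    show False
    proof (rule frobenius_generators[OF x])
      fix V B assume V: "affine_open X V" "x \<in> V" and B: "finite B" "B \<subseteq> sec_in X V"
        and gen: "\<And>M. \<lbrakk>M \<subseteq> carrier K; \<zero>\<^bsub>K\<^esub> \<in> M; \<And>a b. a \<in> M \<Longrightarrow> b \<in> M \<Longrightarrow> a \<oplus>\<^bsub>K\<^esub> b \<in> M;
        \<And>u b. u \<in> sec_in X V \<Longrightarrow> b \<in> B \<Longrightarrow> u [^]\<^bsub>K\<^esub> p \<otimes>\<^bsub>K\<^esub> b \<in> M\<rbrakk> \<Longrightarrow> sec_in X V \<subseteq> M"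
      have oV: "openin (topo X) V" "V \<noteq> {}" using V affine_open_openin by auto
      note sV = subringE[OF affine_sec_in_subring[OF V]]
      note loc = affine_sec_in_local[OF V]
      \<comment> \<open>The contraction of the splitting prime to the sections over \<open>V\<close>
        is a prime of these sections, and \<open>z\<close> is its point.\<close>
      obtain z where z: "z \<in> V" and Pz: "sec_in X V \<inter> \<mm> z = sec_in X V \<inter> ?P"
      proof (rule affine_prime_point[OF V(1) oV(2), of "sec_in X V \<inter> ?P"])
        have "f \<in> carrier K" using local_at_carrier[OF x f(1)] .
        then have "\<zero>\<^bsub>K\<^esub> \<in> ?P" using splitting_prime_mult[OF x fP local_at_zero[OF x]] by simp
        then show "\<zero>\<^bsub>K\<^esub> \<in> sec_in X V \<inter> ?P" using sV(2) by blast
        show "\<one>\<^bsub>K\<^esub> \<notin> sec_in X V \<inter> ?P" using splitting_prime_proper[OF x pure] by blast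
        show "a \<oplus>\<^bsub>K\<^esub> b \<in> sec_in X V \<inter> ?P" if "a \<in> sec_in X V \<inter> ?P" "b \<in> sec_in X V \<inter> ?P" for a b
          using that sV(7) splitting_prime_add[OF x] by simp
        show "b \<otimes>\<^bsub>K\<^esub> a \<in> sec_in X V \<inter> ?P" if "a \<in> sec_in X V \<inter> ?P" "b \<in> sec_in X V" for a b
          using that sV(6) splitting_prime_mult[OF x _ loc] by simp
        show "a \<in> sec_in X V \<inter> ?P \<or> b \<in> sec_in X V \<inter> ?P"
          if "a \<in> sec_in X V" "b \<in> sec_in X V" "a \<otimes>\<^bsub>K\<^esub> b \<in> sec_in X V \<inter> ?P" for a b
          using that splitting_prime_is_prime[OF x loc loc] by simp
      qed auto
      have zt: "z \<in> topspace (topo X)" using affine_topspace[OF V(1) z] .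
      \<comment> \<open>The witness \<open>f\<close> may fail to be a section over \<open>V\<close>,
        so it is replaced by the nonzero multiple \<open>f * s\<close>, which is one and still lies
        in the splitting prime.\<close>
      have ng: "z \<noteq> generic_point X"
      proof
        assume zg: "z = generic_point X"
        obtain s where s: "s \<in> sec_in X V" "s \<notin> \<mm> x" "f \<otimes>\<^bsub>K\<^esub> s \<in> sec_in X V"
          by (rule affine_fraction[OF V f(1)])
        have c: "f \<in> carrier K" "s \<in> carrier K" using f(1) loc[OF s(1)] local_at_carrier[OF x] by auto
        have "f \<otimes>\<^bsub>K\<^esub> s \<in> ?P" using splitting_prime_mult[OF x fP loc[OF s(1)]] K.m_comm[OF c] by simp
        then have "f \<otimes>\<^bsub>K\<^esub> s \<in> sec_in X V \<inter> \<mm> z" unfolding Pz using s(3) by blast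
        then have "f \<otimes>\<^bsub>K\<^esub> s = \<zero>\<^bsub>K\<^esub>" by (simp add: zg max_ideal_generic)
        then have "s = \<zero>\<^bsub>K\<^esub>" using f(2) c K.integral by blast
        then show False using s(2) zero_in_max_ideal[OF x] by simp
      qed
      \<comment> \<open>Here stability has to pass from maps at \<open>x\<close> to maps at
        \<open>z\<close>. Both the map and the element acquire denominators: \<open>s\<close> for
        the values of \<open>\<psi>\<close>, \<open>t\<close> for \<open>a\<close>.\<close>
      have "\<psi> a \<in> \<mm> z" if e: "e \<ge> 1" and \<psi>: "\<psi> \<in> \<C> z e" and a: "a \<in> \<mm> z" for e \<psi> a
      proof -
        note locz = affine_sec_in_local[OF V(1) z] and lin = map_stalk_p_linear[OF \<psi>]
        have \<psi>loc: "\<psi> b \<in> local_at X z" if "b \<in> sec_in X V" for b using cartier_local[OF \<psi> locz[OF that]] .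
        from denominators_outside_prime[OF V(1) z B gen lin \<psi>loc]
        obtain s where s: "s \<in> sec_in X V" "s \<notin> \<mm> z" "\<forall>a\<in>sec_in X V. s \<otimes>\<^bsub>K\<^esub> \<psi> a \<in> sec_in X V" by blast
        have aL: "a \<in> local_at X z" using max_idealD[OF a] .
        obtain t where t: "t \<in> sec_in X V" "t \<notin> \<mm> z" "a \<otimes>\<^bsub>K\<^esub> t \<in> sec_in X V"
          by (rule affine_fraction[OF V(1) z aL])
        have c: "a \<in> carrier K" "s \<in> carrier K" "t \<in> carrier K"
          using aL locz[OF s(1)] locz[OF t(1)] local_at_carrier[OF zt] by auto
        define q where "q = p ^ e"
        have q: "q = Suc (q - 1)" using p_ge by (simp add: q_def)
        \<comment> \<open>The denominator of \<open>a\<close> is taken to the \<open>q\<close>-th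
          power so that it leaves \<open>\<psi>\<close> as the plain factor
          \<open>t\<close>.\<close>
        define g where "g = t [^]\<^bsub>K\<^esub> q \<otimes>\<^bsub>K\<^esub> a"
        have pV: "t [^]\<^bsub>K\<^esub> (n::nat) \<in> sec_in X V" for n
          by (rule subring_pow_closed[OF affine_sec_in_subring[OF V] t(1)])
        have "g = (a \<otimes>\<^bsub>K\<^esub> t) \<otimes>\<^bsub>K\<^esub> t [^]\<^bsub>K\<^esub> (q - 1)"
          unfolding g_def by (subst q) (use c in \<open>simp add: K.m_ac\<close>)
        then have gV: "g \<in> sec_in X V" using sV(6)[OF t(3) pV] by simp
        have "g \<in> \<mm> z" unfolding g_def by (rule max_ideal_mult[OF zt a locz[OF pV]])
        then have "g \<in> sec_in X V \<inter> ?P" using gV Pz by blast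
        \<comment> \<open>Preserving the sections over \<open>V\<close> makes
          \<open>s * \<psi>\<close> a map at every point of \<open>V\<close>, in particular at
          \<open>x\<close>, where the splitting prime is stable.\<close>
        moreover have "(\<lambda>k. s \<otimes>\<^bsub>K\<^esub> \<psi> k) \<in> \<C> x e"
          using s(3) by (intro affine_cartier[OF V p_linear_postmult[OF lin c(2)]]) blast
        ultimately have "s \<otimes>\<^bsub>K\<^esub> \<psi> g \<in> ?P" using splitting_prime_stable[OF e] by blast
        then have m: "s \<otimes>\<^bsub>K\<^esub> \<psi> g \<in> \<mm> z" using s(3) gV Pz by blast
        have \<psi>a: "\<psi> a \<in> local_at X z" by (rule cartier_local[OF \<psi> aL])
        have \<psi>g: "\<psi> g = t \<otimes>\<^bsub>K\<^esub> \<psi> a" unfolding g_def q_def by (rule p_linear_pow[OF lin c(3,1)])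
        \<comment> \<open>Primality of \<open>\<mm> z\<close> now cancels \<open>s\<close> and then
          \<open>t\<close>, both chosen outside it.\<close>
        have "t \<otimes>\<^bsub>K\<^esub> \<psi> a \<in> \<mm> z"
          using max_ideal_prime[OF zt locz[OF s(1)] local_at_mult[OF zt locz[OF t(1)] \<psi>a] _ s(2)] m \<psi>g by simp
        then show ?thesis by (rule max_ideal_prime[OF zt locz[OF t(1)] \<psi>a _ t(2)])
      qed
      then have "A_beth X p (full_cartier X p) (trivial_valuation (residue_field X z), z) \<le> 0"
        by (rule A_beth_trivial_le[OF zt])
      then show False using H[OF trivial_in_beth[OF zt] trivial_not_generic[OF ng]] by simp
    qed
  qed
qed

end

theorem theoremA:
  fixes X :: "('x, 'a) rspace" and p :: nat
  assumes "scheme X" and "separated_scheme X" and "noetherian_scheme X"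
    and "integral_scheme X" and "has_char X p" and "F_finite X p"
  shows
    "(F_pure X p \<longrightarrow>
        (\<forall>(Y :: ('y, 'b) rspace) f E v.
           divisor_over TYPE(('t, 's) rspace) TYPE(('u, 'w) rspace) X Y f E \<and> is_ord X Y f E v \<longrightarrow>
           0 \<le> A_val X p (full_cartier X p) v)) \<and>
     (F_regular X p \<longrightarrow>
        (\<forall>(Y :: ('y, 'b) rspace) f E v.
           divisor_over TYPE(('t, 's) rspace) TYPE(('u, 'w) rspace) X Y f E \<and> is_ord X Y f E v \<longrightarrow>
           0 < A_val X p (full_cartier X p) v)) \<and>
     ((\<forall>\<xi>\<in>beth X. \<not> trivial_generic X \<xi> \<longrightarrow> 0 \<le> A_beth X p (full_cartier X p) \<xi>) \<longrightarrow>
        F_pure X p) \<and>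
     ((\<forall>\<xi>\<in>beth X. \<not> trivial_generic X \<xi> \<longrightarrow> 0 < A_beth X p (full_cartier X p) \<xi>) \<longrightarrow>
        F_regular X p)"
proof -
  interpret X: integral_scheme_space X
    using assms(1,4) by (simp add: integral_scheme_space_def integral_scheme_space_axioms_def)
  have p: "p \<ge> 2" using assms(5) by (simp add: has_char_def prime_ge_2_nat)
  interpret F: F_finite_integral_scheme X p
    by unfold_locales (use p assms(6) in auto)
  have Y: "integral_scheme_space Y \<and> birational_morphism Y X f"
    if "divisor_over TYPE(('t, 's) rspace) TYPE(('u, 'w) rspace) X Y f E"
    for Y :: "('y, 'b) rspace" and f E
    using that by (simp add: divisor_over_def integral_scheme_space_def integral_scheme_space_axioms_def)
  show ?thesis
  proof (intro conjI impI allI)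
    fix Y :: "('y, 'b) rspace" and f E v
    assume D: "divisor_over TYPE(('t, 's) rspace) TYPE(('u, 'w) rspace) X Y f E \<and> is_ord X Y f E v"
    show "0 \<le> A_val X p (full_cartier X p) v" if "F_pure X p"
      using X.F_pure_log_canonical[OF assms(2) p that] Y D by blast
    show "0 < A_val X p (full_cartier X p) v" if "F_regular X p"
      using X.F_regular_klt[OF assms(2) p that] Y D by blast
  next
    assume "\<forall>\<xi>\<in>beth X. \<not> trivial_generic X \<xi> \<longrightarrow> 0 \<le> A_beth X p (full_cartier X p) \<xi>"
    then show "F_pure X p" by (intro F.F_pure_if_A_beth_nonneg) blast
  next
    assume "\<forall>\<xi>\<in>beth X. \<not> trivial_generic X \<xi> \<longrightarrow> 0 < A_beth X p (full_cartier X p) \<xi>"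
    then show "F_regular X p" by (intro F.F_regular_if_A_beth_pos) blast
  qed
qed

end
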